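(* (Adapted inequalities with prescribed minimizer, case $\lambda=1$.) Let $\Omega=(x_i,x_f)\subseteq\mathbb R$ be an open interval and let $f^\star$ be a probability density with support $\overline\Omega$, positive on $\Omega$. Let $p\in\mathbb R$ with Hölder conjugate $p^*>0$, let $\alpha>0$, and assume $r:=N_{(\alpha-1)/\alpha}[g_{p,1}]<\infty$. Take as reference function $h^\star(x)=f^\star(x)\,\mathcal C_{p,1}(f^\star;x)^{1/\alpha}$, $x\in\Omega$. Let $f$ be a probability density with support $\overline\Omega$, positive on $\Omega$. Then: (i) $$\sigma^\star_{p^*,\alpha}[f^\star;f]\;e^{D[f\|f^\star]}\ \ge\ \big(K^{(0)}_{p,1}\big)^{1/\alpha}\,e^{\frac1\alpha\langle\log\mathcal C_{p,1}(f^\star;x)\rangle}.$$ (ii) If $p>1$, the densities are differentiable on $\Omega$, and the relative differential-escort density $\mathfrak R_\alpha^{[h^\star]}[f]$ is absolutely continuous on $\mathbb R$ (being $0$ outside its support), then $$\frac{\phi_{p,\alpha}[f\|h^\star]}{e^{D[f\|f^\star]-\frac1\alpha\langle\log\mathcal C_{p,1}(f^\star;x)\rangle}}\ \ge\ \Big(\frac{K^{(1)}_{p,1}}\alpha\Big)^{1/\alpha},$$ and this inequality is minimized only by $f=f^\star$.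
   Context: $D[f\|g]=\int_\Omega f\log\frac fg\,dx$, and $\langle\log\mathcal C_{p,1}(f^\star;x)\rangle=\int_\Omega f(x)\log\mathcal C_{p,1}(f^\star;x)\,dx$, so that $D[f\|h^\star]=D[f\|f^\star]-\frac1\alpha\langle\log\mathcal C_{p,1}(f^\star;x)\rangle$. Let $g_{p,1}(x)=a_{p,1}e^{-|x|^{p^*}}$ with $a_{p,1}$ the normalization constant. For a density $g$: $N_\gamma[g]=(\int g^\gamma)^{1/(1-\gamma)}$ for $\gamma\neq1$ (integral over the support of $g$), $N[g]=\exp(-\int g\log g)$, $\sigma_q[g]=(\int|x|^qg)^{1/q}$, $\phi_{p,1}[g]=(\int|g'/g|^pg\,dx)^{1/p}$. Constants: $K^{(0)}_{p,1}=\sigma_{p^*}[g_{p,1}]/N[g_{p,1}]$, $K^{(1)}_{p,1}=\phi_{p,1}[g_{p,1}]\,N[g_{p,1}]$. Relative differential-escort transformation: $\mathfrak R_\alpha^{[h]}[f](y)=\big(f(x(y))/h(x(y))\big)^\alpha$, $y'(x)=f(x)^{1-\alpha}h(x)^\alpha$, with $x(y)$ the inverse of $y(x)$; a probability density, defined up to translation. Its inverse is $\mathfrak R_\alpha^{-1,[h]}[g](x)=[rg(ry(x))]^{1/\alpha}h(x)$, $y'(x)=[rg(ry(x))]^{-(\alpha-1)/\alpha}h(x)$, $r=N_{(\alpha-1)/\alpha}[g]$. The function $h^\star$ is obtained by imposing $\mathfrak R_\alpha^{-1,[h^\star]}[g_{p,1}]=f^\star$. This leads to the change of variable $y(x)$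 determined by $\int_0^{y(x)} r g_{p,1}(rt)\,dt=F^\star(x)$, where $F^\star(x)=\int f^\star(x)\,dx$ denotes the cumulative function of $f^\star$, and to $$\mathcal C_{p,1}(f^\star;x)=\frac1{r\,a_{p,1}}\exp\Big[\gamma^{-1}\Big(\frac1{p^*};\frac{p^*}{a_{p,1}}F^\star(x)\Big)\Big],$$ where $\gamma^{-1}(s;\cdot)$ is the inverse of the incomplete Gamma function $u\mapsto\gamma(s,u)=\int_0^ut^{s-1}e^{-t}dt$. For $p=2$, $\mathcal C_{2,1}(f^\star;x)=r^{-1}\pi^{1/2}\exp\big[\big(\operatorname{erf}^{-1}(2F^\star(x))\big)^2\big]$. Adapted moment (the relative cumulative moment of $f$ with respect to $h^\star$), for $q>0$: $$\sigma^\star_{q,\alpha}[f^\star;f]=\Big[\int_\Omega\Big|\int_{x_i}^xf(s)^{1-\alpha}f^\star(s)^\alpha\,\mathcal C_{p,1}(f^\star;s)\,ds\Big|^qf(x)\,dx\Big]^{\frac1{q\alpha}}.$$ Relative Fisher divergence, for $p>1$, $\lambda\neq0$ and differentiable densities: $\phi_{p,\lambda}[f\|h]=\Big(\int_\Omega f^{1+p(\lambda-1)}h^{-\lambda p}\big|\frac d{dx}\log\frac fh\big|^pdx\Big)^{1/(p\lambda)}$.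
   Formalization: F* is taken as the centred cumulative function (the integral of f* from x_i to x, minus 1/2), and γ^{-1} is evaluated at (p*/a)|F*(x)|, since the printed argument (p*/a)F*(x) falls outside the domain of γ^{-1} on part of Ω. *)

theory Defs
  imports "HOL-Analysis.Analysis"
begin

text \<open>
  The moments, entropies and Fisher divergences below may be infinite, so all functionals take
  values in \<open>[0,\<infinity>]\<close> and are built from the non-negative Lebesgue integral.  (The Bochner
  integral, and hence the library's Kullback-Leibler divergence, is \<open>0\<close> on non-integrable
  functions.)
\<close>

definition enn_powr :: "ennreal \<Rightarrow> real \<Rightarrow> ennreal" where
  "enn_powr x a =
     (if x = \<infinity> then (if a > 0 then \<infinity> else if a = 0 then 1 else 0)
      else if x = 0 \<and> a < 0 then \<infinity>
      else ennreal (enn2real x powr a))"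

definition exp_ereal :: "ereal \<Rightarrow> ennreal" where
  "exp_ereal x = (case x of ereal t \<Rightarrow> ennreal (exp t) | PInfty \<Rightarrow> \<infinity> | MInfty \<Rightarrow> 0)"

text \<open>
  The integral of a function whose positive or negative part is integrable.  In the undefined case
  \<open>\<infinity> - \<infinity>\<close> the value is meaningless.
\<close>

definition ext_integral :: "real set \<Rightarrow> (real \<Rightarrow> real) \<Rightarrow> ereal" where
  "ext_integral A \<phi> =
     enn2ereal (\<integral>\<^sup>+x\<in>A. ennreal (\<phi> x) \<partial>lborel) - enn2ereal (\<integral>\<^sup>+x\<in>A. ennreal (- \<phi> x) \<partial>lborel)"

definition density_on :: "real set \<Rightarrow> (real \<Rightarrow> real) \<Rightarrow> bool" where
  "density_on \<Omega> f \<longleftrightarrow>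
     f \<in> borel_measurable borel \<and> (\<forall>x. 0 \<le> f x) \<and> (\<forall>x\<in>\<Omega>. 0 < f x) \<and> (\<forall>x. x \<notin> closure \<Omega> \<longrightarrow> f x = 0) \<and>
     (\<integral>\<^sup>+x. ennreal (f x) \<partial>lborel) = 1"

definition ac_on :: "real set \<Rightarrow> (real \<Rightarrow> real) \<Rightarrow> bool" where
  "ac_on S F \<longleftrightarrow>
     (\<forall>\<epsilon>>0. \<exists>\<delta>>0. \<forall>(n::nat) a b.
        (\<forall>i<n. a i \<le> b i \<and> {a i..b i} \<subseteq> S) \<and> disjoint_family_on (\<lambda>i. {a i<..<b i}) {..<n} \<and>
        (\<Sum>i<n. b i - a i) < \<delta> \<longrightarrow>
        (\<Sum>i<n. \<bar>F (b i) - F (a i)\<bar>) < \<epsilon>)"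


definition entropy_power :: "real \<Rightarrow> (real \<Rightarrow> real) \<Rightarrow> ennreal" where
  "entropy_power \<gamma> g =
     (if \<gamma> = 1 then exp_ereal (- ext_integral UNIV (\<lambda>x. g x * ln (g x)))
      else enn_powr (\<integral>\<^sup>+x\<in>{x. g x \<noteq> 0}. ennreal (g x powr \<gamma>) \<partial>lborel) (1 / (1 - \<gamma>)))"

definition abs_moment :: "real \<Rightarrow> (real \<Rightarrow> real) \<Rightarrow> ennreal" where
  "abs_moment q g = enn_powr (\<integral>\<^sup>+x. ennreal (\<bar>x\<bar> powr q * g x) \<partial>lborel) (1 / q)"

definition fisher :: "real \<Rightarrow> (real \<Rightarrow> real) \<Rightarrow> ennreal" where
  "fisher p g = enn_powr (\<integral>\<^sup>+x. ennreal (\<bar>deriv g x / g x\<bar> powr p * g x) \<partial>lborel) (1 / p)"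

definition rel_entropy :: "real set \<Rightarrow> (real \<Rightarrow> real) \<Rightarrow> (real \<Rightarrow> real) \<Rightarrow> ereal" where
  "rel_entropy \<Omega> f g = ext_integral \<Omega> (\<lambda>x. f x * ln (f x / g x))"

definition rel_fisher :: "real \<Rightarrow> real \<Rightarrow> real set \<Rightarrow> (real \<Rightarrow> real) \<Rightarrow> (real \<Rightarrow> real) \<Rightarrow> ennreal" where
  "rel_fisher p l \<Omega> f h =
     enn_powr (\<integral>\<^sup>+x\<in>\<Omega>. ennreal (f x powr (1 + p * (l - 1)) * h x powr (- l * p) *
                 \<bar>deriv (\<lambda>t. ln (f t / h t)) x\<bar> powr p) \<partial>lborel) (1 / (p * l))"


definition hconj :: "real \<Rightarrow> real" where
  "hconj p = p / (p - 1)"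

definition gauss_const :: "real \<Rightarrow> real" where
  "gauss_const p = 1 / (LBINT x. exp (- (\<bar>x\<bar> powr hconj p)))"

definition gen_gauss :: "real \<Rightarrow> real \<Rightarrow> real" where
  "gen_gauss p x = gauss_const p * exp (- (\<bar>x\<bar> powr hconj p))"

definition K0 :: "real \<Rightarrow> ennreal" where
  "K0 p = abs_moment (hconj p) (gen_gauss p) / entropy_power 1 (gen_gauss p)"

definition K1 :: "real \<Rightarrow> ennreal" where
  "K1 p = fisher p (gen_gauss p) * entropy_power 1 (gen_gauss p)"

definition r_const :: "real \<Rightarrow> real \<Rightarrow> real" where
  "r_const p \<alpha> = enn2real (entropy_power ((\<alpha> - 1) / \<alpha>) (gen_gauss p))"


definition lower_gamma :: "real \<Rightarrow> real \<Rightarrow> real" where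
  "lower_gamma s u = (LBINT t:{0..u}. t powr (s - 1) * exp (- t))"

definition inv_lower_gamma :: "real \<Rightarrow> real \<Rightarrow> real" where
  "inv_lower_gamma s = the_inv_into {0..} (lower_gamma s)"

text \<open>
  The change of variable \<open>\<integral>\<^sub>0\<^sup>y r g(rt) dt = F x\<close>, with \<open>g\<close> even and of mass \<open>1\<close>, has a solution
  \<open>y\<close> for every \<open>x\<close> in \<open>\<Omega>\<close> only when the cumulative function ranges over \<open>(-1/2, 1/2)\<close>, i.e.
  vanishes at the median.
\<close>

definition centred_cdf :: "real set \<Rightarrow> (real \<Rightarrow> real) \<Rightarrow> real \<Rightarrow> real" where
  "centred_cdf \<Omega> f x = (LBINT s:\<Omega> \<inter> {..x}. f s) - 1 / 2"

text \<open>
  Since \<open>\<bar>r y\<bar> powr hconj p\<close> is even in \<open>y\<close>, the inverse incomplete Gamma function is evaluated at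
  the absolute value of the centred cumulative function; for \<open>p = 2\<close> the exponent is the square of
  \<open>erf\<^sup>-\<^sup>1(2F)\<close>, which is even in \<open>F\<close>.
\<close>

definition C_fun :: "real \<Rightarrow> real \<Rightarrow> real set \<Rightarrow> (real \<Rightarrow> real) \<Rightarrow> real \<Rightarrow> real" where
  "C_fun p \<alpha> \<Omega> fs x =
     1 / (r_const p \<alpha> * gauss_const p) *
     exp (inv_lower_gamma (1 / hconj p) (hconj p / gauss_const p * \<bar>centred_cdf \<Omega> fs x\<bar>))"

definition h_star :: "real \<Rightarrow> real \<Rightarrow> real set \<Rightarrow> (real \<Rightarrow> real) \<Rightarrow> real \<Rightarrow> real" where
  "h_star p \<alpha> \<Omega> fs x = fs x * C_fun p \<alpha> \<Omega> fs x powr (1 / \<alpha>)"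

definition mean_log_C :: "real \<Rightarrow> real \<Rightarrow> real set \<Rightarrow> (real \<Rightarrow> real) \<Rightarrow> (real \<Rightarrow> real) \<Rightarrow> ereal" where
  "mean_log_C p \<alpha> \<Omega> fs f = ext_integral \<Omega> (\<lambda>x. f x * ln (C_fun p \<alpha> \<Omega> fs x))"

definition adapted_moment ::
    "real \<Rightarrow> real \<Rightarrow> real \<Rightarrow> real set \<Rightarrow> (real \<Rightarrow> real) \<Rightarrow> (real \<Rightarrow> real) \<Rightarrow> ennreal" where
  "adapted_moment p q \<alpha> \<Omega> fs f =
     enn_powr
       (\<integral>\<^sup>+x\<in>\<Omega>. enn_powr
            (\<integral>\<^sup>+s\<in>\<Omega> \<inter> {..x}. ennreal (f s powr (1 - \<alpha>) * fs s powr \<alpha> * C_fun p \<alpha> \<Omega> fs s) \<partial>lborel) q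
          * ennreal (f x) \<partial>lborel)
       (1 / (q * \<alpha>))"

text \<open>
  The relative differential-escort density is defined up to translation; the base point \<open>c\<close> (where
  \<open>y = 0\<close>) selects a representative.
\<close>

definition escort_coord ::
    "real \<Rightarrow> (real \<Rightarrow> real) \<Rightarrow> real \<Rightarrow> (real \<Rightarrow> real) \<Rightarrow> real \<Rightarrow> real" where
  "escort_coord \<alpha> h c f x = (LBINT s=ereal c..ereal x. f s powr (1 - \<alpha>) * h s powr \<alpha>)"

definition rel_escort ::
    "real \<Rightarrow> real set \<Rightarrow> (real \<Rightarrow> real) \<Rightarrow> real \<Rightarrow> (real \<Rightarrow> real) \<Rightarrow> real \<Rightarrow> real" where
  "rel_escort \<alpha> \<Omega> h c f y =
     (if y \<in> escort_coord \<alpha> h c f ` \<Omega>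
      then let x = the_inv_into \<Omega> (escort_coord \<alpha> h c f) y in (f x / h x) powr \<alpha>
      else 0)"

end

theory Submission
  imports Defs "HOL-Probability.Probability" "HOL-Real_Asymp.Real_Asymp"
begin

text \<open>
  Let \<open>G\<close> be the cumulative function of the generalised Gaussian \<open>g\<close>, and for a density \<open>f\<close> with
  cumulative function \<open>F\<close> let \<open>W = G\<^sup>-\<^sup>1 \<circ> F\<close> be the monotone map that transports \<open>f\<close> to \<open>g\<close>.  For the
  prescribed minimizer, whose map is \<open>w\<close>, the weight is \<open>C = 1 / (r g(w))\<close>.

  (i) is Gibbs' inequality for the escort density against a Gaussian scaled to its own moment, pulled
  back to \<open>\<Omega>\<close>.

  (ii) Put \<open>u = (f/h)\<^sup>\<alpha>\<close>, the escort density in the original coordinate.  By Jensen's inequality the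
  entropy term is at most \<open>\<integral> f ln g(W) + ln \<integral> f u / g(W)\<close>, and \<open>\<integral> f u / g(W) = \<integral> u dW\<close> is at most
  \<open>\<integral> |u'| |W|\<close> by integration by parts, hence at most the Fisher divergence times a moment of \<open>g\<close> by
  Hoelder's inequality.  Absolute continuity enters only through uniform continuity, which makes \<open>u\<close>
  bounded and forces it to vanish at both ends of \<open>\<Omega>\<close>.  Equality in Jensen's inequality means that
  \<open>u / g(W)\<close> is constant, and this forces \<open>W = w\<close>.
\<close>

section \<open>Integrals of generalised Gaussians\<close>

text \<open>The weight is forced by the prescription. In the original coordinate the escort density
  of the minimizer is \<open>1 / C = r * g (w)\<close>, and mass conservation makes its escort
  coordinate \<open>w / r\<close> up to a constant, so this density is a translate of
  \<open>r * g (r * y)\<close>. Both inequalities can thus be proved on \<Omega> itself; the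
  transport maps are handled through distribution functions, since in (i) the densities are only
  measurable. In (ii) the derivative of \<open>u\<close> exists on \<Omega> but need not be
  continuous. The gauge integral controls the increments of \<open>u\<close>, which leaves to
  absolute continuity the behaviour at the ends of \<Omega>. Infinite values are the other obstacle.
  Both entropy integrands have integrable negative parts, so neither integral is -\<infinity>. In
  (i) a finite moment and a finite relative entropy make the mean of \<open>ln C\<close> finite; in
  (ii) boundedness of \<open>u\<close> bounds the relative entropy by that mean. Finiteness of
  \<open>r\<close> makes the weight positive. In the equality case it also fixes the proportionality
  constant, by comparing finite integrals of
  \<open>g powr ((\<alpha> - 1) / \<alpha>)\<close>.\<close>

lemma integrable_exp_minus_powr:
  fixes s q :: real
  assumes "0 < s" "0 < q"
  shows "integrable lborel (\<lambda>x. exp (- (s * \<bar>x\<bar> powr q)))"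
proof -
  \<comment> \<open>The exponent \<open>2 / q\<close> turns \<open>\<bar>x\<bar> powr q\<close> into
    \<open>x\<^sup>2\<close>: from \<open>exp y \<ge> (y / k) powr k\<close> the tail is at most
    \<open>M / x\<^sup>2\<close>, and \<open>2 + 2 * M\<close> is large enough for both ranges of
    \<open>x\<close>.\<close>
  define k where "k = 2 / q"
  have "k > 0" using assms by (simp add: k_def)
  define M where "M = (k / s) powr k"
  have "M > 0" unfolding M_def using assms \<open>k > 0\<close> by simp
  have bound: "exp (- (s * \<bar>x\<bar> powr q)) \<le> (2 + 2 * M) * inverse (1 + x^2)" for x :: real
  proof (cases "\<bar>x\<bar> \<le> 1")
    case True
    then have "x^2 \<le> 1" by (simp add: abs_square_le_1)
    have "exp (- (s * \<bar>x\<bar> powr q)) \<le> 1" using assms by simp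
    also have "1 \<le> 2 * inverse (1 + x^2)" using \<open>x^2 \<le> 1\<close> by (simp add: field_simps add_pos_nonneg)
    also have "\<dots> \<le> (2 + 2 * M) * inverse (1 + x^2)"
      using \<open>M > 0\<close> by (intro mult_right_mono) auto
    finally show ?thesis .
  next
    case False
    define y where "y = s * \<bar>x\<bar> powr q"
    have "y > 0" unfolding y_def using False assms by simp
    have "y / k \<le> exp (y / k)" using exp_ge_add_one_self[of "y/k"] by linarith
    then have "(y / k) powr k \<le> exp (y / k) powr k"
      using \<open>y > 0\<close> \<open>k > 0\<close> by (intro powr_mono2) auto
    also have "\<dots> = exp y" using \<open>k > 0\<close> by (simp add: powr_def)
    finally have "(y / k) powr k \<le> exp y" .
    moreover have "(y / k) powr k = x\<^sup>2 / M"
    proof -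
      have "(\<bar>x\<bar> powr q) powr k = x\<^sup>2"
        using False assms by (simp add: powr_powr k_def)
      then show ?thesis unfolding y_def M_def using assms \<open>k > 0\<close>
        by (simp add: powr_divide powr_mult)
    qed
    ultimately have "x\<^sup>2 / M \<le> exp y" by simp
    then have "exp (- y) \<le> M / x\<^sup>2"
      using \<open>M > 0\<close> False le_imp_inverse_le[of "x\<^sup>2 / M" "exp y"] by (simp add: exp_minus)
    also have "\<dots> \<le> (2 + 2 * M) * inverse (1 + x^2)"
    proof -
      have "1 \<le> x\<^sup>2" using False power_mono[of 1 "\<bar>x\<bar>" 2] by simp
      then have "M * (1 + x\<^sup>2) \<le> M * (x\<^sup>2 + x\<^sup>2)" using \<open>M > 0\<close> by (intro mult_left_mono) auto
      also have "\<dots> \<le> (2 + 2 * M) * x\<^sup>2" by (simp add: algebra_simps)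
      finally have "M * (1 + x\<^sup>2) \<le> (2 + 2 * M) * x\<^sup>2" .
      then have "M * (1 + x\<^sup>2) / x\<^sup>2 \<le> 2 + 2 * M"
        using \<open>1 \<le> x\<^sup>2\<close> by (intro mult_imp_div_pos_le) auto
      then have "M / x\<^sup>2 \<le> (2 + 2 * M) / (1 + x\<^sup>2)"
        using \<open>1 \<le> x\<^sup>2\<close> by (intro mult_imp_le_div_pos) auto
      then show ?thesis by (simp add: divide_inverse)
    qed
    finally show ?thesis by (simp add: y_def)
  qed
  have "integrable lborel (\<lambda>x. (2 + 2 * M) * inverse (1 + x^2 :: real))"
    using integrable_inverse_1_plus_square by (simp add: set_integrable_def)
  then show ?thesis
    by (rule Bochner_Integration.integrable_bound) (use bound \<open>M > 0\<close> in \<open>auto intro!: AE_I2 simp: add_pos_nonneg\<close>)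
qed

text \<open>Off 0 this is the chain rule; at 0 the factorisation of
  \<open>\<bar>z\<bar> powr q\<close> as slope times \<open>z\<close> has a slope that is continuous
  there when \<open>1 < q\<close>. The disjunction serves both uses: the moment identity knows only
  \<open>0 < q\<close> and treats 0 apart, the Fisher part has \<open>1 < q\<close>.\<close>

lemma DERIV_abs_powr:
  fixes q x :: real
  assumes "x \<noteq> 0 \<or> 1 < q"
  shows "((\<lambda>x. \<bar>x\<bar> powr q) has_real_derivative q * \<bar>x\<bar> powr (q - 1) * sgn x) (at x)"
proof (cases "x = 0")
  case False
  have "(abs has_real_derivative sgn x) (at x)"
  proof (cases "0 < x")
    case True
    then have "((\<lambda>x. x) has_real_derivative sgn x) (at x)" by simp
    then show ?thesis
      by (rule has_field_derivative_transform_within_open[of _ _ _ "{0<..}"]) (use True in auto)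
  next
    case False
    with \<open>x \<noteq> 0\<close> have "(uminus has_real_derivative sgn x) (at x)" by (auto intro!: derivative_eq_intros)
    then show ?thesis
      by (rule has_field_derivative_transform_within_open[of _ _ _ "{..<0}"]) (use False \<open>x \<noteq> 0\<close> in auto)
  qed
  from DERIV_chain2[OF has_real_derivative_powr this, of q] False
  show ?thesis by simp
next
  case True
  with assms have "1 < q" by simp
  have "isCont (\<lambda>z. \<bar>z\<bar> powr (q - 1) * sgn z) 0"
  proof -
    have "((\<lambda>z::real. \<bar>z\<bar> powr (q - 1)) \<longlongrightarrow> 0 powr (q - 1)) (at 0)"
      using \<open>1 < q\<close> by (intro tendsto_powr') (auto intro!: tendsto_eq_intros)
    then have "((\<lambda>z::real. \<bar>z\<bar> powr (q - 1)) \<longlongrightarrow> 0) (at 0)" by simp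
    then have "((\<lambda>z::real. \<bar>z\<bar> powr (q - 1) * sgn z) \<longlongrightarrow> 0) (at 0)"
      by (rule Lim_null_comparison[rotated]) (auto simp: abs_mult abs_sgn_eq intro!: always_eventually)
    then show ?thesis by (simp add: isCont_def)
  qed
  moreover have "\<bar>z\<bar> powr q = \<bar>z\<bar> powr (q - 1) * sgn z * z" for z :: real
    by (cases "z = 0") (auto simp: powr_diff sgn_if)
  ultimately show ?thesis unfolding CARAT_DERIV True
    using \<open>1 < q\<close> by (intro exI[of _ "\<lambda>z. \<bar>z\<bar> powr (q - 1) * sgn z"]) simp
qed

lemma continuous_abs_powr:
  fixes q :: real assumes "0 < q"
  shows "isCont (\<lambda>x. \<bar>x\<bar> powr q) x"
  unfolding isCont_def using assms by (intro tendsto_powr') (auto intro!: tendsto_eq_intros)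

text \<open>The function \<open>x * exp (- (\<bar>x\<bar> powr q))\<close> vanishes at both ends of
  the line, so its derivative, the Gaussian minus \<open>q\<close> times the integrand, has integral
  0.\<close>

lemma has_bochner_integral_abs_powr_exp:
  fixes q :: real
  assumes q: "0 < q"
  defines "I \<equiv> LBINT x. exp (- (\<bar>x\<bar> powr q))"
  shows "has_bochner_integral lborel (\<lambda>x. \<bar>x\<bar> powr q * exp (- (\<bar>x\<bar> powr q))) (I / q)"
proof -
  let ?e = "\<lambda>x::real. exp (- (\<bar>x\<bar> powr q))"
  have int1: "integrable lborel ?e"
    using integrable_exp_minus_powr[of 1 q] q by simp
  have int2: "integrable lborel (\<lambda>x. \<bar>x\<bar> powr q * ?e x)"
  proof (rule Bochner_Integration.integrable_bound)
    show "integrable lborel (\<lambda>x::real. 2 * exp (- (1/2 * \<bar>x\<bar> powr q)))"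
      using integrable_exp_minus_powr[of "1/2" q] q by simp
    have "y * exp (- y) \<le> 2 * exp (- (1/2 * y))" for y :: real
    proof -
      have "y / 2 \<le> exp (y / 2)" using exp_ge_add_one_self[of "y/2"] by linarith
      then have "y / 2 * exp (- y) \<le> exp (y / 2) * exp (- y)" by (intro mult_right_mono) auto
      also have "\<dots> = exp (- (1/2 * y))" by (simp flip: exp_add)
      finally show ?thesis by simp
    qed
    then show "AE x in lborel. norm (\<bar>x\<bar> powr q * ?e x) \<le> norm (2 * exp (- (1/2 * \<bar>x\<bar> powr q)))"
      by (auto simp: abs_mult)
  qed auto
  let ?f = "\<lambda>x. ?e x - q * (\<bar>x\<bar> powr q * ?e x)"
  have D: "((\<lambda>x. x * ?e x) has_real_derivative ?f x) (at x)" for x :: real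
  proof (cases "x = 0")
    case True
    \<comment> \<open>For \<open>q \<le> 1\<close> the exponent is not differentiable at 0, but the
      factor \<open>x\<close> makes continuity of the exponential enough.\<close>
    have "isCont ?e 0" using continuous_abs_powr[OF q, of 0] by (auto intro!: continuous_intros)
    then show ?thesis unfolding CARAT_DERIV True by (intro exI[of _ ?e]) auto
  next
    case False
    have "\<bar>x\<bar> powr q = \<bar>x\<bar> powr (q - 1) * sgn x * x"
      using False by (auto simp: powr_diff sgn_if)
    moreover have "((\<lambda>x. x * exp (- k x)) has_real_derivative exp (- k x) - x * d * exp (- k x)) (at x)"
      if "(k has_real_derivative d) (at x)" for k d
      using that by (auto intro!: derivative_eq_intros)
    from this[OF DERIV_abs_powr[of x q]] have
      "((\<lambda>x. x * ?e x) has_real_derivative ?e x - x * (q * \<bar>x\<bar> powr (q - 1) * sgn x) * ?e x) (at x)"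
      using False by simp
    ultimately show ?thesis by (simp add: algebra_simps)
  qed
  have C: "isCont ?f x" for x :: real
    using continuous_abs_powr[OF q, of x] by (auto intro!: continuous_intros)
  have intf: "integrable lborel ?f" using int1 int2 by auto
  have lim: "((\<lambda>x. x * ?e x) \<longlongrightarrow> 0) at_top" "((\<lambda>x. x * ?e x) \<longlongrightarrow> 0) at_bot"
  proof -
    show *: "((\<lambda>x. x * ?e x) \<longlongrightarrow> 0) at_top"
    proof -
      have "((\<lambda>x::real. x * exp (- (x powr q))) \<longlongrightarrow> 0) at_top" using q by real_asymp
      then show ?thesis
        by (rule Lim_transform_eventually)
           (auto intro!: eventually_mono[OF eventually_ge_at_top[of 0]])
    qed
    then have "((\<lambda>x. - (x * ?e x)) \<longlongrightarrow> 0) at_top" using tendsto_minus by fastforce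
    then show "((\<lambda>x. x * ?e x) \<longlongrightarrow> 0) at_bot" by (simp add: filterlim_at_bot_mirror)
  qed
  have "(LBINT x=-\<infinity>..\<infinity>. ?f x) = 0 - 0"
  proof (rule interval_integral_FTC_integrable)
    show "((\<lambda>x. x * ?e x) has_vector_derivative ?f x) (at x)" for x
      using D[of x] by (simp add: has_real_derivative_iff_has_vector_derivative)
    show "isCont ?f x" for x by (rule C)
    show "set_integrable lborel (einterval (-\<infinity>) \<infinity>) ?f" using intf by (simp add: set_integrable_def)
    show "(((\<lambda>x. x * ?e x) \<circ> real_of_ereal) \<longlongrightarrow> 0) (at_right (-\<infinity>))"
      using lim(2) by (simp add: ereal_tendsto_simps del: o_apply)
    show "(((\<lambda>x. x * ?e x) \<circ> real_of_ereal) \<longlongrightarrow> 0) (at_left \<infinity>)"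
      using lim(1) by (simp add: ereal_tendsto_simps del: o_apply)
  qed auto
  then have "(LBINT x. ?f x) = 0" by (simp add: interval_lebesgue_integral_def set_lebesgue_integral_def)
  then have "I - q * (LBINT x. \<bar>x\<bar> powr q * ?e x) = 0"
    unfolding I_def using int1 int2 by simp
  then have "(LBINT x. \<bar>x\<bar> powr q * ?e x) = I / q" using q by (simp add: field_simps)
  with int2 show ?thesis by (simp add: has_bochner_integral_iff)
qed

section \<open>Densities on intervals and their cumulative functions\<close>

locale real_density =
  fixes \<Omega> :: "real set" and f :: "real \<Rightarrow> real"
  assumes dens: "density_on \<Omega> f"
begin

lemma borel_measurable_density [measurable]: "f \<in> borel_measurable borel"
  and f_nonneg: "0 \<le> f x"
  and f_pos: "x \<in> \<Omega> \<Longrightarrow> 0 < f x"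
  and f_mass: "(\<integral>\<^sup>+x. ennreal (f x) \<partial>lborel) = 1"
  using dens by (auto simp: density_on_def)

abbreviation M :: "real measure" where "M \<equiv> density lborel (\<lambda>x. ennreal (f x))"
abbreviation F :: "real \<Rightarrow> real" where "F \<equiv> cdf M"

lemma integrable_density: "integrable lborel f"
  using f_mass by (intro integrableI_nonneg) (auto simp: f_nonneg)

sublocale real_distribution M
  using f_mass
  by (auto simp: real_distribution_def real_distribution_axioms_def emeasure_density intro!: prob_spaceI)

lemma set_integrable_density: "A \<in> sets borel \<Longrightarrow> set_integrable lborel A f"
  unfolding set_integrable_def by (rule integrable_mult_indicator) (use integrable_density in auto)

lemma measure_density_eq:
  assumes "A \<in> sets borel"
  shows "measure M A = (LBINT x:A. f x)"
proof -
  have "emeasure M A = (\<integral>\<^sup>+x. ennreal (indicator A x *\<^sub>R f x) \<partial>lborel)"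
    using assms by (auto simp: emeasure_density intro!: nn_integral_cong split: split_indicator)
  also have "\<dots> = ennreal (LBINT x:A. f x)"
    unfolding set_lebesgue_integral_def
    by (rule nn_integral_eq_integral)
       (use set_integrable_density[OF assms] f_nonneg in \<open>auto simp: set_integrable_def\<close>)
  finally show ?thesis
    using f_nonneg
    by (auto simp: measure_def set_lebesgue_integral_def intro!: enn2real_ennreal integral_nonneg_AE)
qed

lemma isCont_F: "isCont F x"
  by (subst isCont_cdf) (simp add: measure_def emeasure_density nn_integral_null_set null_sets_def)

lemma DERIV_F:
  assumes "open S" "x \<in> S" "continuous_on S f"
  shows "(F has_real_derivative f x) (at x)"
proof -
  obtain e where e: "0 < e" "cball x e \<subseteq> S"
    using open_contains_cball assms(1,2) by blast
  then have sub: "{x - e..x + e} \<subseteq> S" by (simp add: cball_eq_atLeastAtMost)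
  have "((\<lambda>u. LBINT y=x - e..u. f y) has_vector_derivative f x) (at x within {x - e..x + e})"
    by (rule interval_integral_FTC2) (use e sub assms(3) in \<open>auto intro: continuous_on_subset\<close>)
  then have "((\<lambda>u. F (x - e) + (LBINT y=x - e..u. f y)) has_real_derivative f x) (at x within {x - e<..<x + e})"
    by (auto simp: has_real_derivative_iff_has_vector_derivative
             intro!: derivative_eq_intros intro: has_vector_derivative_within_subset)
  then have "((\<lambda>u. F (x - e) + (LBINT y=x - e..u. f y)) has_real_derivative f x) (at x)"
    using e at_within_open[of x "{x - e<..<x + e}"] by auto
  then show ?thesis
  proof (rule has_field_derivative_transform_within_open[of _ _ _ "{x - e<..<x + e}"])
    fix u assume "u \<in> {x - e<..<x + e}"
    then have u: "x - e < u" "u < x + e" by auto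
    then have "F u - F (x - e) = (LBINT y:{x - e<..u}. f y)"
      by (simp add: cdf_diff_eq measure_density_eq)
    also have "\<dots> = (LBINT y=x - e..u. f y)"
      using u by (simp add: interval_integral_Ioc)
    finally show "F (x - e) + (LBINT y=x - e..u. f y) = F u" by simp
  qed (use e in auto)
qed

end

locale interval_density = real_density +
  fixes xi xf :: ereal
  assumes \<Omega>_eq: "\<Omega> = einterval xi xf" and xi_less_xf: "xi < xf"
begin

lemma open_\<Omega> [simp]: "open \<Omega>" by (simp add: \<Omega>_eq)

lemma \<Omega>_borel [measurable, simp]: "\<Omega> \<in> sets borel" by (simp add: \<Omega>_eq)

lemma mem_\<Omega>: "x \<in> \<Omega> \<longleftrightarrow> xi < ereal x \<and> ereal x < xf"
  by (simp add: \<Omega>_eq einterval_iff)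

lemma \<Omega>_interval: "x \<in> \<Omega> \<Longrightarrow> y \<in> \<Omega> \<Longrightarrow> x \<le> z \<Longrightarrow> z \<le> y \<Longrightarrow> z \<in> \<Omega>"
  unfolding mem_\<Omega> by (meson ereal_less_eq(3) le_less_trans less_le_trans)

text \<open>\<open>density_on\<close> leaves the value at a finite endpoint of \<Omega> free; there
  are at most two such points, a null set.\<close>

lemma AE_density_zero_outside: "AE x in lborel. x \<notin> \<Omega> \<longrightarrow> f x = 0"
proof -
  have "finite {x. ereal x = xi \<or> ereal x = xf}"
    by (rule finite_subset[of _ "{real_of_ereal xi, real_of_ereal xf}"]) auto
  then have "AE x in lborel. x \<notin> {x. ereal x = xi \<or> ereal x = xf}"
    by (intro AE_not_in finite_imp_null_set_lborel)
  then show ?thesis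
  proof (rule AE_mp, intro AE_I2 impI)
    fix x assume x: "x \<notin> {x. ereal x = xi \<or> ereal x = xf}" "x \<notin> \<Omega>"
    have "closed {x. xi \<le> ereal x \<and> ereal x \<le> xf}"
      by (intro closed_Collect_conj closed_Collect_le continuous_intros)
    then have "closure \<Omega> \<subseteq> {x. xi \<le> ereal x \<and> ereal x \<le> xf}"
      by (intro closure_minimal) (auto simp: mem_\<Omega>)
    with x have "x \<notin> closure \<Omega>" by (auto simp: mem_\<Omega> less_le)
    with dens show "f x = 0" by (simp add: density_on_def)
  qed
qed

lemma AE_\<Omega>: "AE x in M. x \<in> \<Omega>"
  using AE_density_zero_outside by (subst AE_density) (auto elim!: eventually_mono)

lemma nn_integral_\<Omega>: 
  assumes [measurable]: "h \<in> borel_measurable borel"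
  shows "(\<integral>\<^sup>+x\<in>\<Omega>. ennreal (f x) * h x \<partial>lborel) = (\<integral>\<^sup>+x. h x \<partial>M)"
  by (subst nn_integral_density)
     (auto intro!: nn_integral_cong_AE eventually_mono[OF AE_density_zero_outside] split: split_indicator)

lemma F_eq: "F x = (LBINT s:\<Omega> \<inter> {..x}. f s)"
proof -
  have "F x = (LBINT s:{..x}. f s)" by (simp add: cdf_def2 measure_density_eq)
  also have "\<dots> = (LBINT s:\<Omega> \<inter> {..x}. f s)"
    unfolding set_lebesgue_integral_def
    by (intro integral_cong_AE eventually_mono[OF AE_density_zero_outside])
       (auto split: split_indicator)
  finally show ?thesis .
qed

lemma exists_between_\<Omega>: assumes "x \<in> \<Omega>" shows "\<exists>y\<in>\<Omega>. y < x" "\<exists>y\<in>\<Omega>. x < y"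
proof -
  obtain e where "e > 0" "ball x e \<subseteq> \<Omega>" using open_\<Omega> assms openE by blast
  then have "x - e/2 \<in> \<Omega>" "x + e/2 \<in> \<Omega>" by (auto simp: subset_iff dist_real_def)
  then show "\<exists>y\<in>\<Omega>. y < x" "\<exists>y\<in>\<Omega>. x < y" using \<open>e > 0\<close> by (force intro: bexI[of _ "x - e/2"], force intro: bexI[of _ "x + e/2"])
qed

lemma F_strict_mono: assumes "x < y" "x \<in> \<Omega>" "y \<in> \<Omega>" shows "F x < F y"
proof -
  have "emeasure M {x<..y} \<noteq> 0"
  proof
    assume "emeasure M {x<..y} = 0"
    then have "AE s in lborel. ennreal (f s) * indicator {x<..y} s = 0"
      by (simp add: emeasure_density nn_integral_0_iff_AE)
    then have "AE s in lborel. s \<notin> {x<..y}"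
    proof (rule eventually_mono)
      fix s assume 0: "ennreal (f s) * indicator {x<..y} s = 0"
      show "s \<notin> {x<..y}"
      proof
        assume s: "s \<in> {x<..y}"
        then have "0 < f s" using \<Omega>_interval[OF assms(2,3), of s] f_pos by auto
        with 0 s show False by simp
      qed
    qed
    then have "emeasure lborel {x<..y} = 0" by (subst (asm) AE_iff_measurable[of "{x<..y}"]) auto
    with assms show False by simp
  qed
  then have "0 < measure M {x<..y}" by (simp add: emeasure_eq_measure zero_less_measure_iff)
  then show ?thesis using cdf_diff_eq[OF assms(1)] by simp
qed

lemma F_bounds: assumes "x \<in> \<Omega>" shows "0 < F x" "F x < 1"
proof -
  obtain y z where "y \<in> \<Omega>" "y < x" "z \<in> \<Omega>" "x < z" using exists_between_\<Omega>[OF assms] by blast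
  then show "0 < F x" "F x < 1"
    using F_strict_mono[of y x] F_strict_mono[of x z] cdf_nonneg[of y] cdf_bounded_prob[of z] assms by linarith+
qed

text \<open>The intermediate value theorem yields a point of the line. To the left of \<Omega> the
  cumulative function is 0 and to the right it is 1, so the point lies in \<Omega>.\<close>

lemma F_surj: assumes "0 < t" "t < 1" shows "\<exists>x\<in>\<Omega>. F x = t"
proof -
  obtain a where a: "F a < t" 
    using order_tendstoD(2)[OF cdf_lim_at_bot \<open>0 < t\<close>] by (auto simp: eventually_at_bot_linorder)
  obtain b where b: "t < F b" 
    using order_tendstoD(1)[OF cdf_lim_at_top_prob \<open>t < 1\<close>] by (auto simp: eventually_at_top_linorder)
  have "a \<le> b" using a b cdf_nondecreasing[of b a] by linarith
  then obtain x where x: "F x = t" using IVT[of F a t b] a b isCont_F by auto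
  have "x \<in> \<Omega>"
  proof (rule ccontr)
    assume "x \<notin> \<Omega>"
    then consider "ereal x \<le> xi" | "xf \<le> ereal x" by (auto simp: mem_\<Omega>)
    then show False
    proof cases
      case 1
      have "s \<notin> \<Omega>" if "s \<le> x" for s
      proof -
        have "ereal s \<le> xi" using that 1 by (meson ereal_less_eq(3) order_trans)
        then show ?thesis by (auto simp: mem_\<Omega>)
      qed
      then have "\<Omega> \<inter> {..x} = {}" by auto
      with x assms show False by (simp add: F_eq set_lebesgue_integral_def)
    next
      case 2
      have "s \<le> x" if "s \<in> \<Omega>" for s
      proof -
        have "ereal s < ereal x" using that 2 less_le_trans unfolding mem_\<Omega> by blast
        then show ?thesis by simp
      qed
      then have "\<Omega> \<inter> {..x} = \<Omega>" by auto
      then have "F x = measure M \<Omega>" by (simp add: F_eq measure_density_eq)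
      also have "\<dots> = 1" using AE_\<Omega> by (simp add: prob_eq_1)
      finally show False using x assms by simp
    qed
  qed
  with x show ?thesis by blast
qed

end

section \<open>The generalised Gaussian, its cumulative function and the incomplete Gamma
  function\<close>

locale gen_gaussian =
  fixes p q a :: real
  assumes q_eq: "q = hconj p" and q_pos: "0 < q" and a_eq: "a = gauss_const p"
begin

abbreviation g :: "real \<Rightarrow> real" where "g \<equiv> gen_gauss p"

lemma g_def: "g x = a * exp (- (\<bar>x\<bar> powr q))"
  by (simp add: gen_gauss_def a_eq q_eq)

lemma a_pos: "0 < a"
proof -
  have int: "integrable lborel (\<lambda>x. exp (- (\<bar>x\<bar> powr q)))"
    using integrable_exp_minus_powr[of 1 q] q_pos by simp
  have "(LBINT x. exp (- (\<bar>x\<bar> powr q))) \<noteq> 0"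
    using integral_nonneg_eq_0_iff_AE[OF int] by (simp add: eventually_False ae_filter_eq_bot_iff)
  moreover have "(LBINT x. exp (- (\<bar>x\<bar> powr q))) \<ge> 0" by (rule integral_nonneg_AE) simp
  ultimately have "(LBINT x. exp (- (\<bar>x\<bar> powr q))) > 0" by linarith
  then show ?thesis unfolding a_eq gauss_const_def q_eq by simp
qed

lemma g_pos: "0 < g x"
  using a_pos by (simp add: g_def)

lemma ln_g: "ln (g x) = ln a - \<bar>x\<bar> powr q"
  using a_pos by (simp add: g_def ln_mult)

lemma integrable_g: "integrable lborel g"
  unfolding g_def using integrable_exp_minus_powr[of 1 q] q_pos by simp

lemma integral_g: "(LBINT x. g x) = 1"
  using a_pos unfolding g_def by (simp add: a_eq gauss_const_def q_eq)

lemma isCont_g: "isCont g x"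
  unfolding g_def using continuous_abs_powr[OF q_pos] by (auto intro!: continuous_intros)

lemma density_on_g: "density_on UNIV g"
proof -
  have "(\<integral>\<^sup>+x. ennreal (g x) \<partial>lborel) = ennreal (LBINT x. g x)"
    by (rule nn_integral_eq_integral) (auto simp: integrable_g less_imp_le[OF g_pos])
  moreover have "g \<in> borel_measurable borel"
    by (intro borel_measurable_continuous_onI continuous_at_imp_continuous_on ballI isCont_g)
  ultimately show ?thesis
    by (simp add: density_on_def integral_g g_pos less_imp_le[OF g_pos])
qed

lemma interval_density_g: "interval_density UNIV g (-\<infinity>) \<infinity>"
  by (intro interval_density.intro real_density.intro interval_density_axioms.intro density_on_g)
     (simp_all add: einterval_def)

sublocale G: interval_density UNIV g "-\<infinity>" "\<infinity>"
  by (rule interval_density_g)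

lemma DERIV_G: "(G.F has_real_derivative g x) (at x)"
  by (rule G.DERIV_F[of UNIV]) (auto intro!: continuous_at_imp_continuous_on isCont_g)

lemma G_minus: "G.F (- x) = 1 - G.F x"
proof -
  have D: "((\<lambda>x. G.F x + G.F (- x)) has_real_derivative 0) (at x)" for x
  proof -
    have "((\<lambda>x. G.F (- x)) has_real_derivative g (- x) * (- 1)) (at x)"
      by (rule DERIV_chain2[OF DERIV_G]) (auto intro!: derivative_eq_intros)
    from DERIV_add[OF DERIV_G this] show ?thesis by (simp add: gen_gauss_def)
  qed
  have lim: "((\<lambda>x. G.F x + G.F (- x)) \<longlongrightarrow> 1 + 0) at_top"
    by (intro tendsto_add G.cdf_lim_at_top_prob filterlim_compose[OF G.cdf_lim_at_bot] filterlim_uminus_at_bot_at_top)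
  have const: "(\<lambda>y. G.F y + G.F (- y)) = (\<lambda>_. G.F x + G.F (- x))"
    using DERIV_isconst_all[of "\<lambda>x. G.F x + G.F (- x)"] D by blast
  have "G.F x + G.F (- x) = 1"
    using lim unfolding const by (simp add: tendsto_const_iff)
  then show ?thesis by simp
qed

lemma G_0: "G.F 0 = 1 / 2"
  using G_minus[of 0] by simp

lemma has_bochner_integral_moment: "has_bochner_integral lborel (\<lambda>x. \<bar>x\<bar> powr q * g x) (1 / q)"
proof -
  have "has_bochner_integral lborel (\<lambda>x. a * (\<bar>x\<bar> powr q * exp (- (\<bar>x\<bar> powr q)))) (a * ((LBINT x. exp (- (\<bar>x\<bar> powr q))) / q))"
    by (rule has_bochner_integral_mult_right) (rule has_bochner_integral_abs_powr_exp[OF q_pos])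
  moreover have "a * (LBINT x. exp (- (\<bar>x\<bar> powr q))) = 1"
    using a_pos by (simp add: a_eq gauss_const_def q_eq)
  ultimately show ?thesis by (simp add: g_def mult_ac)
qed

lemma nn_integral_moment: "(\<integral>\<^sup>+x. ennreal (\<bar>x\<bar> powr q * g x) \<partial>lborel) = ennreal (1 / q)"
  using has_bochner_integral_moment g_pos
  by (subst nn_integral_eq_integral) (auto simp: has_bochner_integral_iff less_imp_le)

text \<open>The substitution \<open>t = w powr q\<close> turns the Gamma integrand into
  \<open>q / a * g w\<close>. The integrand may blow up at 0, so the fundamental theorem is used in
  the interior, and absolute integrability follows from the sign.\<close>

lemma lower_gamma_eq:
  assumes "0 \<le> u"
  shows "lower_gamma (1 / q) u = q / a * (G.F (u powr (1 / q)) - 1 / 2)"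
proof -
  let ?h = "\<lambda>t::real. t powr (1 / q - 1) * exp (- t)"
  let ?H = "\<lambda>t::real. q / a * G.F (t powr (1 / q))"
  have "(?h has_integral (?H u - ?H 0)) {0..u}"
  proof (rule fundamental_theorem_of_calculus_interior[OF assms])
    have c1: "continuous_on {0..u} (\<lambda>t::real. t powr (1 / q))"
      using q_pos by (intro continuous_on_powr' continuous_intros) auto
    have c2: "continuous_on UNIV G.F"
      by (auto intro!: continuous_at_imp_continuous_on G.isCont_F)
    have "continuous_on {0..u} (\<lambda>t. G.F (t powr (1 / q)))"
      by (rule continuous_on_compose2[OF c2 c1]) auto
    then show "continuous_on {0..u} ?H" by (rule continuous_on_mult_left)
  next
    fix t assume "t \<in> {0<..<u}"
    then have t: "0 < t" by simp
    have "(?H has_real_derivative q / a * (g (t powr (1 / q)) * (1 / q * t powr (1 / q - 1)))) (at t)"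
      by (intro DERIV_cmult DERIV_chain2[OF DERIV_G] has_real_derivative_powr t)
    also have "q / a * (g (t powr (1 / q)) * (1 / q * t powr (1 / q - 1))) = ?h t"
      using t q_pos a_pos by (simp add: g_def powr_powr)
    finally show "(?H has_vector_derivative ?h t) (at t)"
      by (simp add: has_real_derivative_iff_has_vector_derivative)
  qed
  then have hi: "(?h has_integral (q / a * (G.F (u powr (1 / q)) - 1 / 2))) {0..u}"
    using G_0 by (simp add: algebra_simps)
  then have "?h absolutely_integrable_on {0..u}"
    by (intro nonnegative_absolutely_integrable_1) (auto simp: integrable_on_def)
  then have "set_integrable lborel {0..u} ?h"
    by (simp add: set_integrable_def integrable_completion)
  from set_borel_integral_eq_integral(2)[OF this] show ?thesis
    unfolding lower_gamma_def integral_unique[OF hi] .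
qed

text \<open>This identifies the exponent in \<open>C_fun\<close>: when the centred cumulative
  function equals \<open>G.F w - 1 / 2\<close>, the exponential is \<open>a / g w\<close>, by the
  symmetry of \<open>g\<close> for \<open>w\<close> of either sign.\<close>

lemma inv_lower_gamma_eq: "inv_lower_gamma (1 / q) (q / a * \<bar>G.F w - 1 / 2\<bar>) = \<bar>w\<bar> powr q"
proof -
  have inj: "inj_on (lower_gamma (1 / q)) {0..}"
  proof (rule inj_onI)
    fix u v :: real assume uv: "u \<in> {0..}" "v \<in> {0..}" "lower_gamma (1 / q) u = lower_gamma (1 / q) v"
    have "q / a * (G.F (u powr (1 / q)) - 1 / 2) = q / a * (G.F (v powr (1 / q)) - 1 / 2)"
      using uv(3) unfolding lower_gamma_eq[OF uv(1)[unfolded atLeast_iff]] lower_gamma_eq[OF uv(2)[unfolded atLeast_iff]] .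
    moreover have "q / a \<noteq> 0" using q_pos a_pos by simp
    ultimately have "G.F (u powr (1 / q)) = G.F (v powr (1 / q))"
      unfolding mult_cancel_left by linarith
    then have "u powr (1 / q) = v powr (1 / q)"
      using G.F_strict_mono[of "u powr (1 / q)" "v powr (1 / q)"] G.F_strict_mono[of "v powr (1 / q)" "u powr (1 / q)"]
      by (cases "u powr (1 / q)" "v powr (1 / q)" rule: linorder_cases) auto
    then have "(u powr (1 / q)) powr q = (v powr (1 / q)) powr q" by simp
    then show "u = v" using uv q_pos by (simp add: powr_powr)
  qed
  have abs: "\<bar>G.F w - 1 / 2\<bar> = G.F \<bar>w\<bar> - 1 / 2"
    using G_minus[of w] G.cdf_nondecreasing[of 0 "w"] G.cdf_nondecreasing[of "w" 0] G_0
    by (cases "w \<ge> 0") auto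
  have "lower_gamma (1 / q) (\<bar>w\<bar> powr q) = q / a * \<bar>G.F w - 1 / 2\<bar>"
    using q_pos unfolding abs by (simp add: lower_gamma_eq powr_powr)
  then show ?thesis
    unfolding inv_lower_gamma_def using the_inv_into_f_f[OF inj, of "\<bar>w\<bar> powr q"] by simp
qed

end

section \<open>Extended integrals and monotone transport to the Gaussian\<close>

lemma ext_integral_eq:
  assumes "set_integrable lborel A \<phi>"
  shows "ext_integral A \<phi> = ereal (LBINT x:A. \<phi> x)"
proof -
  let ?h = "\<lambda>x. indicator A x * \<phi> x"
  have int: "integrable lborel ?h" using assms by (simp add: set_integrable_def)
  have 1: "(\<integral>\<^sup>+x\<in>A. ennreal (\<phi> x) \<partial>lborel) = (\<integral>\<^sup>+x. ennreal (?h x) \<partial>lborel)"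
    and 2: "(\<integral>\<^sup>+x\<in>A. ennreal (- \<phi> x) \<partial>lborel) = (\<integral>\<^sup>+x. ennreal (- ?h x) \<partial>lborel)"
    by (auto intro!: nn_integral_cong split: split_indicator)
  have fin: "(\<integral>\<^sup>+x. ennreal (?h x) \<partial>lborel) \<noteq> \<infinity>" "(\<integral>\<^sup>+x. ennreal (- ?h x) \<partial>lborel) \<noteq> \<infinity>"
    using int by (auto simp: real_integrable_def)
  have "enn2ereal y = ereal (enn2real y)" if "y \<noteq> \<infinity>" for y
    using that by (cases y) auto
  then show ?thesis
    unfolding ext_integral_def 1 2 using fin real_lebesgue_integral_def[OF int]
    by (simp add: set_lebesgue_integral_def)
qed

lemma set_integrable_of_ext_integral:
  assumes "set_borel_measurable lborel A \<phi>"
    and "(\<integral>\<^sup>+x\<in>A. ennreal (- \<phi> x) \<partial>lborel) \<noteq> \<infinity>" "ext_integral A \<phi> \<noteq> \<infinity>"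
  shows "set_integrable lborel A \<phi>"
proof -
  let ?h = "\<lambda>x. indicator A x * \<phi> x"
  have 1: "(\<integral>\<^sup>+x\<in>A. ennreal (\<phi> x) \<partial>lborel) = (\<integral>\<^sup>+x. ennreal (?h x) \<partial>lborel)"
    and 2: "(\<integral>\<^sup>+x\<in>A. ennreal (- \<phi> x) \<partial>lborel) = (\<integral>\<^sup>+x. ennreal (- ?h x) \<partial>lborel)"
    by (auto intro!: nn_integral_cong split: split_indicator)
  have "(\<integral>\<^sup>+x. ennreal (?h x) \<partial>lborel) \<noteq> \<infinity>"
    using assms(2,3) unfolding ext_integral_def 1 2
    by (cases "\<integral>\<^sup>+x. ennreal (- ?h x) \<partial>lborel") auto
  then show ?thesis
    using assms(1,2) unfolding 2 by (simp add: set_integrable_def real_integrable_def set_borel_measurable_def)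
qed

lemma ext_integral_neq_minf:
  assumes "(\<integral>\<^sup>+x\<in>A. ennreal (- \<phi> x) \<partial>lborel) \<noteq> \<infinity>"
  shows "ext_integral A \<phi> \<noteq> -\<infinity>"
  using assms unfolding ext_integral_def
  by (cases "\<integral>\<^sup>+x\<in>A. ennreal (- \<phi> x) \<partial>lborel"; cases "\<integral>\<^sup>+x\<in>A. ennreal (\<phi> x) \<partial>lborel") auto

lemma enn_powr_ennreal: "0 < x \<Longrightarrow> enn_powr (ennreal x) s = ennreal (x powr s)"
  by (simp add: enn_powr_def)

context gen_gaussian
begin

lemma set_integrable_g_ln_g: "set_integrable lborel UNIV (\<lambda>x. g x * ln (g x))"
  and integral_g_ln_g: "(LBINT x:UNIV. g x * ln (g x)) = ln a - 1 / q"
proof -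
  have eq: "(\<lambda>x. g x * ln (g x)) = (\<lambda>x. ln a * g x - \<bar>x\<bar> powr q * g x)"
    by (auto simp: ln_g algebra_simps)
  have "has_bochner_integral lborel (\<lambda>x. ln a * g x) (ln a * 1)"
    by (intro has_bochner_integral_mult_right) (simp add: has_bochner_integral_iff integrable_g integral_g)
  from has_bochner_integral_diff[OF this has_bochner_integral_moment]
  show "set_integrable lborel UNIV (\<lambda>x. g x * ln (g x))"
    and "(LBINT x:UNIV. g x * ln (g x)) = ln a - 1 / q"
    unfolding eq by (simp_all add: has_bochner_integral_iff set_integrable_def set_lebesgue_integral_def)
qed

lemma entropy_power_g: "entropy_power 1 g = ennreal (exp (1 / q) / a)"
  using a_pos ext_integral_eq[OF set_integrable_g_ln_g] integral_g_ln_g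
  by (simp add: entropy_power_def exp_ereal_def exp_diff)

lemma K0_eq: "K0 p = ennreal ((1 / q) powr (1 / q) * a / exp (1 / q))"
proof -
  have "abs_moment q g = ennreal ((1 / q) powr (1 / q))"
    using q_pos by (simp only: abs_moment_def nn_integral_moment) (simp add: enn_powr_ennreal)
  then show ?thesis
    using a_pos by (simp add: K0_def entropy_power_g divide_ennreal flip: q_eq)
qed

lemma conjugate_exponents: assumes "1 < p" shows "1 < q" "1 / p + 1 / q = 1" "(q - 1) * p = q"
  using assms unfolding q_eq hconj_def by (auto simp: field_simps)

lemma DERIV_g: assumes "1 < p" shows "(g has_real_derivative - (q * \<bar>x\<bar> powr (q - 1) * sgn x) * g x) (at x)"
proof -
  have "((\<lambda>x. a * exp (- k x)) has_real_derivative - d * (a * exp (- k x))) (at x)"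
    if "(k has_real_derivative d) (at x)" for k d
    using that by (auto intro!: derivative_eq_intros)
  from this[OF DERIV_abs_powr[of x q]] show ?thesis
    using conjugate_exponents[OF assms] unfolding g_def[abs_def] by simp
qed

lemma K1_eq: assumes "1 < p" shows "K1 p = ennreal (q powr (1 / q) * (exp (1 / q) / a))"
proof -
  have "\<bar>deriv g x / g x\<bar> powr p * g x = q powr p * (\<bar>x\<bar> powr q * g x)" for x
  proof -
    have "\<bar>deriv g x / g x\<bar> = q * \<bar>x\<bar> powr (q - 1)"
      using g_pos[of x] q_pos conjugate_exponents(1)[OF assms]
      by (simp add: DERIV_imp_deriv[OF DERIV_g[OF assms]] abs_mult abs_sgn_eq)
    then show ?thesis using q_pos conjugate_exponents(3)[OF assms] by (simp add: powr_mult powr_powr)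
  qed
  then have "(\<integral>\<^sup>+x. ennreal (\<bar>deriv g x / g x\<bar> powr p * g x) \<partial>lborel)
      = (\<integral>\<^sup>+x. ennreal (q powr p) * ennreal (\<bar>x\<bar> powr q * g x) \<partial>lborel)"
    by (simp only: ennreal_mult'[OF powr_ge_zero])
  also have "\<dots> = ennreal (q powr p) * ennreal (1 / q)"
    by (subst nn_integral_cmult) (auto simp: nn_integral_moment)
  also have "\<dots> = ennreal (q powr (p - 1))"
    using q_pos by (simp add: powr_diff flip: ennreal_mult')
  finally have "fisher p g = ennreal (q powr ((p - 1) / p))"
    unfolding fisher_def using q_pos by (simp only: enn_powr_ennreal powr_gt_zero) (simp add: powr_powr)
  also have "(p - 1) / p = 1 / q" using assms by (simp add: q_eq hconj_def)
  finally show ?thesis by (simp only: K1_def entropy_power_g ennreal_mult'[OF powr_ge_zero])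
qed

end

section \<open>Monotone transport of a density to the generalised Gaussian\<close>

locale transport = gen_gaussian p q a + interval_density \<Omega> f xi xf
  for p q a \<Omega> f xi xf
begin

definition W :: "real \<Rightarrow> real" where "W x = the_inv G.F (F x)"

lemma inj_G: "inj G.F"
  using G.F_strict_mono by (intro linorder_injI) (metis UNIV_I less_irrefl)

lemma G_the_inv: assumes "0 < y" "y < 1" shows "G.F (the_inv G.F y) = y"
  using G.F_surj[OF assms] inj_G by (metis f_the_inv_into_f rangeI)

lemma G_W: "x \<in> \<Omega> \<Longrightarrow> G.F (W x) = F x"
  by (simp add: W_def G_the_inv F_bounds)

lemma W_eqI: "G.F t = F x \<Longrightarrow> W x = t"
  using the_inv_f_f[OF inj_G, of t] by (simp add: W_def)

lemma G_less_iff: "G.F s < G.F t \<longleftrightarrow> s < t"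
  using G.F_strict_mono[of s t] G.F_strict_mono[of t s] by (cases s t rule: linorder_cases) auto

lemma W_strict_mono: "x \<in> \<Omega> \<Longrightarrow> y \<in> \<Omega> \<Longrightarrow> x < y \<Longrightarrow> W x < W y"
  using F_strict_mono[of x y] G_W[of x] G_W[of y] G_less_iff[of "W x" "W y"] by simp

lemma W_le_iff: "x \<in> \<Omega> \<Longrightarrow> y \<in> \<Omega> \<Longrightarrow> W x \<le> W y \<longleftrightarrow> x \<le> y"
  using W_strict_mono[of x y] W_strict_mono[of y x] by (cases x y rule: linorder_cases) auto

lemma W_surj: "\<exists>x\<in>\<Omega>. W x = t"
proof -
  obtain x where "x \<in> \<Omega>" "F x = G.F t" using F_surj G.F_bounds[of t] by auto
  then show ?thesis using W_eqI[of t x] by auto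
qed

lemma isCont_the_inv_G: "x \<in> \<Omega> \<Longrightarrow> isCont (the_inv G.F) (F x)"
  using isCont_inverse_function[of 1 "W x" "the_inv G.F" G.F] the_inv_f_f[OF inj_G] G.isCont_F
  by (simp add: G_W)

lemma isCont_W: "x \<in> \<Omega> \<Longrightarrow> isCont W x"
  unfolding W_def[abs_def] by (rule isCont_o2[OF isCont_F isCont_the_inv_G])

lemma continuous_on_W: "continuous_on \<Omega> W"
  by (intro continuous_at_imp_continuous_on ballI isCont_W)

lemma DERIV_W:
  assumes "continuous_on \<Omega> f" "x \<in> \<Omega>"
  shows "(W has_real_derivative f x / g (W x)) (at x)"
proof -
  have "(the_inv G.F has_real_derivative inverse (g (W x))) (at (F x))"
  proof (rule DERIV_inverse_function[of G.F])
    show "(G.F has_real_derivative g (W x)) (at (the_inv G.F (F x)))"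
      using DERIV_G by (simp add: W_def)
    show "isCont (the_inv G.F) (F x)" by (rule isCont_the_inv_G[OF assms(2)])
  qed (use F_bounds[OF assms(2)] G_the_inv g_pos[of "W x"] in auto)
  from DERIV_chain2[OF this DERIV_F[OF open_\<Omega> assms(2,1)]]
  show ?thesis unfolding W_def[abs_def] by (simp add: divide_inverse mult.commute)
qed

text \<open>\<open>W\<close> is under control only on \<Omega>, where \<open>F\<close> takes values
  strictly between 0 and 1; off \<Omega> \<open>the_inv\<close> may be applied outside the range of
  \<open>G.F\<close>. The cut-off version is Borel measurable on the line.\<close>

definition W0 :: "real \<Rightarrow> real" where "W0 x = indicator \<Omega> x *\<^sub>R W x"

lemma W0_eq: "x \<in> \<Omega> \<Longrightarrow> W0 x = W x"
  by (simp add: W0_def)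

lemma borel_measurable_W0 [measurable]: "W0 \<in> borel_measurable borel"
  unfolding W0_def[abs_def] by (rule borel_measurable_continuous_on_indicator) (auto simp: continuous_on_W)

text \<open>Both laws have the same distribution function: \<open>W\<close> is increasing on
  \<Omega>, so the event that it is at most \<open>t\<close> is the part of \<Omega> up to the point
  where it equals \<open>t\<close>. The change of variables below thus covers discontinuous
  densities.\<close>

lemma distr_W: "distr M borel W0 = G.M"
proof (rule cdf_unique)
  show "real_distribution (distr M borel W0)" by simp
  show "real_distribution G.M" by (rule G.real_distribution_axioms)
  show "cdf (distr M borel W0) = G.F"
  proof
    fix t
    obtain z where z: "z \<in> \<Omega>" "W z = t" using W_surj by blast
    have "cdf (distr M borel W0) t = measure M {x. W0 x \<le> t}"
      by (simp add: cdf_def2 measure_distr vimage_def)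
    also have "\<dots> = measure M {..z}"
    proof (rule finite_measure_eq_AE)
      show "AE x in M. x \<in> {x. W0 x \<le> t} \<longleftrightarrow> x \<in> {..z}"
        using AE_\<Omega> by eventually_elim (use z W_le_iff W0_eq in auto)
      show "{x. W0 x \<le> t} \<in> events" by measurable
    qed auto
    also have "\<dots> = G.F t" using G_W[OF z(1)] z by (simp add: cdf_def2)
    finally show "cdf (distr M borel W0) t = G.F t" .
  qed
qed

lemma nn_integral_transport:
  assumes [measurable]: "h \<in> borel_measurable borel"
  shows "(\<integral>\<^sup>+x\<in>\<Omega>. ennreal (f x) * h (W x) \<partial>lborel) = (\<integral>\<^sup>+t. ennreal (g t) * h t \<partial>lborel)"
proof -
  have "(\<integral>\<^sup>+x\<in>\<Omega>. ennreal (f x) * h (W x) \<partial>lborel) = (\<integral>\<^sup>+x\<in>\<Omega>. ennreal (f x) * h (W0 x) \<partial>lborel)"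
    by (intro nn_integral_cong) (simp add: W0_def split: split_indicator)
  also have "\<dots> = (\<integral>\<^sup>+x. h (W0 x) \<partial>M)" by (rule nn_integral_\<Omega>) simp
  also have "\<dots> = (\<integral>\<^sup>+t. h t \<partial>distr M borel W0)" by (simp add: nn_integral_distr)
  also have "\<dots> = (\<integral>\<^sup>+t. ennreal (g t) * h t \<partial>lborel)" by (simp add: distr_W nn_integral_density)
  finally show ?thesis .
qed

lemma C_fun_eq: "x \<in> \<Omega> \<Longrightarrow> C_fun p \<alpha> \<Omega> f x = 1 / (r_const p \<alpha> * g (W x))"
proof -
  assume x: "x \<in> \<Omega>"
  have "centred_cdf \<Omega> f x = G.F (W x) - 1 / 2"
    by (simp add: centred_cdf_def G_W[OF x] F_eq)
  then show ?thesis
    unfolding C_fun_def q_eq[symmetric] a_eq[symmetric]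
    by (simp only: inv_lower_gamma_eq) (simp add: g_def exp_minus field_simps)
qed

end

section \<open>The moment inequality\<close>

lemma emeasure_open_pos: 
  fixes S :: "real set" assumes "open S" "S \<noteq> {}" shows "emeasure lborel S \<noteq> 0"
proof
  assume 0: "emeasure lborel S = 0"
  obtain x e where "0 < e" "cball x e \<subseteq> S" using assms open_contains_cball by blast
  then have "emeasure lborel {x - e..x + e} \<le> emeasure lborel S"
    using assms by (intro emeasure_mono) (auto simp: cball_eq_atLeastAtMost)
  with 0 \<open>0 < e\<close> show False by simp
qed

lemma AE_open_witness:
  fixes S :: "real set" assumes "AE x in lborel. x \<in> S \<longrightarrow> P x" "open S" "S \<noteq> {}"
  shows "\<exists>x\<in>S. P x"
proof (rule ccontr)
  assume "\<not> ?thesis"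
  then have "AE x in lborel. x \<notin> S" using assms(1) by auto
  then have "emeasure lborel S = 0" using assms(2) by (subst (asm) AE_iff_measurable[of S]) auto
  with emeasure_open_pos[OF assms(2,3)] show False by simp
qed

lemma density_on_normalise:
  assumes "\<Omega> \<in> sets borel" "k \<in> borel_measurable borel" "\<And>x. x \<in> \<Omega> \<Longrightarrow> 0 < k x"
    and "(\<integral>\<^sup>+x\<in>\<Omega>. ennreal (k x) \<partial>lborel) = ennreal Y" "0 < Y"
  shows "density_on \<Omega> (\<lambda>x. indicator \<Omega> x * (k x / Y))"
proof -
  have [measurable]: "\<Omega> \<in> sets borel" "k \<in> borel_measurable borel" by (fact assms)+
  have "(\<integral>\<^sup>+x. ennreal (indicator \<Omega> x * (k x / Y)) \<partial>lborel)
      = (\<integral>\<^sup>+x. ennreal (k x) * indicator \<Omega> x / ennreal Y \<partial>lborel)"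
    using assms(3,5) by (intro nn_integral_cong) (auto simp: divide_ennreal less_imp_le split: split_indicator)
  also have "\<dots> = 1"
    using assms(4,5) by (subst nn_integral_divide) (auto simp: divide_ennreal)
  finally show ?thesis
    using assms(3,5) closure_subset[of \<Omega>]
    by (auto simp: density_on_def less_imp_le split: split_indicator)
qed

context gen_gaussian
begin

text \<open>Formally this is the substitution \<open>t = Y x\<close> with
  \<open>dt = k x dx\<close>, but \<open>k\<close> is only measurable. Truncated at
  \<open>x0\<close> and normalised, \<open>k\<close> is a density with cumulative function
  \<open>Y x / Y x0\<close>; transporting it to \<open>g\<close> replaces \<open>Y x\<close> by
  \<open>Y x0 * G.F t\<close>, and the new integrand is an exact derivative.\<close>

lemma nn_integral_gaussian_pullback_le:
  assumes \<Omega>: "\<Omega> = einterval xi xf" "xi < xf"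
    and [measurable]: "k \<in> borel_measurable borel" and k: "\<And>x. x \<in> \<Omega> \<Longrightarrow> 0 < k x"
    and Y: "\<And>x. x \<in> \<Omega> \<Longrightarrow> (\<integral>\<^sup>+s\<in>\<Omega> \<inter> {..x}. ennreal (k s) \<partial>lborel) = ennreal (Y x)" "\<And>x. x \<in> \<Omega> \<Longrightarrow> 0 < Y x"
    and b: "0 < b" and x0: "x0 \<in> \<Omega>"
  shows "(\<integral>\<^sup>+x\<in>\<Omega> \<inter> {..<x0}. ennreal (k x * (g (Y x / b) / b)) \<partial>lborel) \<le> 1"
proof -
  have [measurable]: "\<Omega> \<in> sets borel" by (simp add: \<Omega>)
  define A where "A = einterval xi (ereal x0)"
  have "ereal x < xf" if "x < x0" for x
    using that x0 less_trans[of "ereal x" "ereal x0" xf] by (simp add: \<Omega> einterval_iff)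
  then have A_eq: "A = \<Omega> \<inter> {..<x0}"
    by (auto simp: A_def \<Omega> einterval_iff)
  have xi: "xi < ereal x0" using x0 by (simp add: \<Omega> einterval_iff)
  let ?Y = "Y x0"
  let ?d = "\<lambda>x. indicator A x * (k x / ?Y)"
  have mass: "(\<integral>\<^sup>+s\<in>A. ennreal (k s) \<partial>lborel) = ennreal ?Y"
  proof -
    have "(\<integral>\<^sup>+s\<in>A. ennreal (k s) \<partial>lborel) = (\<integral>\<^sup>+s\<in>\<Omega> \<inter> {..x0}. ennreal (k s) \<partial>lborel)"
      by (intro nn_integral_cong_AE eventually_mono[OF AE_lborel_singleton[of x0]])
         (auto simp: A_eq split: split_indicator)
    with Y x0 show ?thesis by simp
  qed
  have dens: "density_on A ?d"
    by (rule density_on_normalise) (use mass Y(2)[OF x0] k in \<open>auto simp: A_eq \<Omega>\<close>)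
  interpret T: transport p q a A ?d xi "ereal x0"
    by (intro transport.intro gen_gaussian_axioms interval_density.intro real_density.intro
          interval_density_axioms.intro dens A_def xi)
  have F_eq: "T.F x = Y x / ?Y" if "x \<in> A" for x
  proof -
    have x: "x \<in> \<Omega>" "x < x0" using that by (auto simp: A_eq)
    have "T.F x = enn2real (\<integral>\<^sup>+s. ennreal (?d s) * indicator {..x} s \<partial>lborel)"
      by (simp add: cdf_def2 measure_def emeasure_density)
    also have "(\<integral>\<^sup>+s. ennreal (?d s) * indicator {..x} s \<partial>lborel)
        = (\<integral>\<^sup>+s. ennreal (k s) * indicator (\<Omega> \<inter> {..x}) s / ennreal ?Y \<partial>lborel)"
      using x Y(2)[OF x0] k
      by (intro nn_integral_cong) (auto simp: divide_ennreal less_imp_le A_eq split: split_indicator)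
    also have "\<dots> = ennreal (Y x) / ennreal ?Y"
      by (subst nn_integral_divide) (auto simp: Y(1)[OF x(1)])
    also have "\<dots> = ennreal (Y x / ?Y)"
      using Y(2) x x0 by (simp add: divide_ennreal less_imp_le)
    finally show ?thesis using Y(2)[OF x(1)] Y(2)[OF x0] by simp
  qed
  let ?h = "\<lambda>t. ennreal (?Y * (g (?Y * G.F t / b) / b))"
  have [measurable]: "g \<in> borel_measurable borel" by (rule G.borel_measurable_density)
  have [measurable]: "G.F \<in> borel_measurable borel"
    by (intro borel_measurable_continuous_onI continuous_at_imp_continuous_on ballI G.isCont_F)
  have "(\<integral>\<^sup>+x\<in>\<Omega> \<inter> {..<x0}. ennreal (k x * (g (Y x / b) / b)) \<partial>lborel)
      = (\<integral>\<^sup>+x\<in>A. ennreal (?d x) * ?h (T.W x) \<partial>lborel)"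
  proof (intro nn_integral_cong)
    fix x
    show "ennreal (k x * (g (Y x / b) / b)) * indicator (\<Omega> \<inter> {..<x0}) x = ennreal (?d x) * ?h (T.W x) * indicator A x"
    proof (cases "x \<in> A")
      case True
      then have "?Y * G.F (T.W x) = Y x" using T.G_W F_eq Y(2)[OF x0] by simp
      then show ?thesis using True k[of x] Y(2)[OF x0] by (simp add: A_eq flip: ennreal_mult')
    qed (simp add: A_eq)
  qed
  also have "\<dots> = (\<integral>\<^sup>+t. ennreal (g t) * ?h t \<partial>lborel)"
    by (rule T.nn_integral_transport) measurable
  also have "\<dots> = (\<integral>\<^sup>+t. ennreal (g (?Y * G.F t / b) * (?Y * g t / b)) \<partial>lborel)"
    using g_pos[THEN less_imp_le] by (intro nn_integral_cong) (simp add: mult_ac flip: ennreal_mult')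
  also have "\<dots> = ennreal (G.F (?Y * 1 / b) - G.F (?Y * 0 / b))"
  proof -
    let ?D = "\<lambda>t. g (?Y * G.F t / b) * (?Y * g t / b)" and ?H = "\<lambda>t. G.F (?Y * G.F t / b)"
    have D: "(?H has_real_derivative ?D t) (at t)" for t
      by (rule DERIV_chain2[OF DERIV_G]) (use DERIV_cdivide[OF DERIV_cmult[OF DERIV_G]] in blast)
    have C: "isCont ?D t" for t
    proof -
      have "isCont (\<lambda>t. ?Y * G.F t / b) t"
        using b by (intro continuous_divide continuous_mult continuous_const G.isCont_F) auto
      from isCont_o2[OF this isCont_g] show ?thesis
        using b by (intro continuous_mult continuous_divide continuous_const isCont_g) auto
    qed
    have lim: "(?H \<longlongrightarrow> G.F (?Y * 0 / b)) at_bot" "(?H \<longlongrightarrow> G.F (?Y * 1 / b)) at_top"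
      by (intro isCont_tendsto_compose[OF G.isCont_F] tendsto_divide tendsto_mult tendsto_const
            G.cdf_lim_at_bot G.cdf_lim_at_top_prob; use b in simp)+
    note FTC = interval_integral_FTC_nonneg[of "-\<infinity>" "\<infinity>" ?H ?D "G.F (?Y * 0 / b)" "G.F (?Y * 1 / b)"]
    have prem: "((?H \<circ> real_of_ereal) \<longlongrightarrow> G.F (?Y * 0 / b)) (at_right (-\<infinity>))"
      "((?H \<circ> real_of_ereal) \<longlongrightarrow> G.F (?Y * 1 / b)) (at_left \<infinity>)"
      using lim by (simp_all only: ereal_tendsto_simps)
    have nonneg: "0 \<le> ?D t" for t using g_pos[THEN less_imp_le] Y(2)[OF x0] b by simp
    have "set_integrable lborel (einterval (-\<infinity>) \<infinity>) ?D" "(LBINT t=-\<infinity>..\<infinity>. ?D t) = G.F (?Y * 1 / b) - G.F (?Y * 0 / b)"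
      by (rule FTC; use D C prem nonneg in auto)+
    then have "integrable lborel ?D" "(LBINT t. ?D t) = G.F (?Y * 1 / b) - G.F (?Y * 0 / b)"
      by (simp_all add: set_integrable_def interval_lebesgue_integral_def set_lebesgue_integral_def)
    then show ?thesis using nonneg by (subst nn_integral_eq_integral) auto
  qed
  also have "\<dots> \<le> 1" using G.cdf_bounded_prob[of "?Y * 1 / b"] G.cdf_nonneg[of "?Y * 0 / b"] by (simp add: ennreal_le_1)
  finally show ?thesis .
qed

text \<open>Monotone convergence in the truncation point, because \<open>k\<close> may have infinite
  mass on \<Omega>.\<close>

lemma nn_integral_gaussian_pullback_le_1:
  assumes \<Omega>: "\<Omega> = einterval xi xf" "xi < xf"
    and [measurable]: "k \<in> borel_measurable borel" and k: "\<And>x. x \<in> \<Omega> \<Longrightarrow> 0 < k x"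
    and Y: "\<And>x. x \<in> \<Omega> \<Longrightarrow> (\<integral>\<^sup>+s\<in>\<Omega> \<inter> {..x}. ennreal (k s) \<partial>lborel) = ennreal (Y x)" "\<And>x. x \<in> \<Omega> \<Longrightarrow> 0 < Y x"
    and b: "0 < b" and [measurable]: "Y \<in> borel_measurable borel"
  shows "(\<integral>\<^sup>+x\<in>\<Omega>. ennreal (k x * (g (Y x / b) / b)) \<partial>lborel) \<le> 1"
proof -
  obtain u l where lu': "einterval xi xf = (\<Union>i. {l i .. u i})" "incseq u" "decseq l"
      "\<And>i. l i < u i" "\<And>i. xi < l i" "\<And>i. u i < xf" "l \<longlonglongrightarrow> xi" "u \<longlonglongrightarrow> xf"
    by (rule einterval_Icc_approximation[OF \<Omega>(2)]) (rule that)
  note lu = lu'(1,2,4,5,6,8)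
  have u: "u i \<in> \<Omega>" for i
    using less_trans[OF lu(4)[of i], of "ereal (u i)"] lu(3,5)[of i] by (simp add: \<Omega> einterval_iff)
  have [measurable]: "g \<in> borel_measurable borel" by (rule G.borel_measurable_density)
  have ind: "(SUP i. indicator (\<Omega> \<inter> {..<u i}) x) = (indicator \<Omega> x :: ennreal)" for x
  proof (cases "x \<in> \<Omega>")
    case True
    then have "ereal x < xf" by (simp add: \<Omega> einterval_iff)
    from order_tendstoD(1)[OF lu(6) this] obtain i where "ereal x < ereal (u i)"
      by (auto simp: eventually_sequentially)
    then have ge: "(1::ennreal) \<le> (SUP i. indicator (\<Omega> \<inter> {..<u i}) x)"
      using True by (intro SUP_upper2[of i]) auto
    have le: "(SUP i. indicator (\<Omega> \<inter> {..<u i}) x) \<le> (1::ennreal)" by (intro SUP_least) (simp add: indicator_def)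
    show ?thesis using antisym[OF le ge] True by simp
  qed simp
  have "(\<integral>\<^sup>+x\<in>\<Omega>. ennreal (k x * (g (Y x / b) / b)) \<partial>lborel)
      = (\<integral>\<^sup>+x. (SUP i. ennreal (k x * (g (Y x / b) / b)) * indicator (\<Omega> \<inter> {..<u i}) x) \<partial>lborel)"
    by (simp only: SUP_mult_left_ennreal[symmetric] ind)
  also have "\<dots> = (SUP i. (\<integral>\<^sup>+x\<in>\<Omega> \<inter> {..<u i}. ennreal (k x * (g (Y x / b) / b)) \<partial>lborel))"
  proof (rule nn_integral_monotone_convergence_SUP)
    show "incseq (\<lambda>i x. ennreal (k x * (g (Y x / b) / b)) * indicator (\<Omega> \<inter> {..<u i}) x)"
    proof (intro incseq_SucI le_funI mult_left_mono)
      fix i x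
      have "u i \<le> u (Suc i)" using lu(2) by (simp add: incseq_SucD)
      then show "indicator (\<Omega> \<inter> {..<u i}) x \<le> (indicator (\<Omega> \<inter> {..<u (Suc i)}) x :: ennreal)"
        by (auto split: split_indicator)
    qed simp
  qed (simp add: \<Omega>)
  also have "\<dots> \<le> 1"
    by (rule SUP_least) (rule nn_integral_gaussian_pullback_le[OF \<Omega> assms(3) k Y b u])
  finally show ?thesis .
qed

end

lemma nn_integral_zero_witness:
  fixes S A :: "real set" and k :: "real \<Rightarrow> ennreal"
  assumes "(\<integral>\<^sup>+x\<in>A. k x \<partial>lborel) = 0" "k \<in> borel_measurable borel" "A \<in> sets borel"
    and "open S" "S \<noteq> {}" "S \<subseteq> A"
  shows "\<exists>x\<in>S. k x = 0"
proof (rule AE_open_witness)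
  have "AE x in lborel. k x * indicator A x = 0"
    using assms(1-3) by (subst (asm) nn_integral_0_iff_AE) auto
  then show "AE x in lborel. x \<in> S \<longrightarrow> k x = 0"
    by (rule eventually_mono) (use assms(6) in \<open>auto split: split_indicator_asm\<close>)
qed fact+

lemma ext_integral_cong: "(\<And>x. x \<in> A \<Longrightarrow> \<phi> x = \<psi> x) \<Longrightarrow> ext_integral A \<phi> = ext_integral A \<psi>"
  unfolding ext_integral_def
  by (intro arg_cong2[where f="(-)"] arg_cong[where f=enn2ereal] nn_integral_cong) (auto split: split_indicator)

text \<open>A nonzero and finite integral of \<open>g powr ((\<alpha> - 1) / \<alpha>)\<close> keeps
  \<open>enn2real\<close> from its default 0. The finiteness itself is recorded for the equality
  case, where it fixes the proportionality constant.\<close>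

lemma (in gen_gaussian) r_const_pos:
  assumes "0 < \<alpha>" "entropy_power ((\<alpha> - 1) / \<alpha>) g < \<infinity>"
  shows "0 < r_const p \<alpha>" "(\<integral>\<^sup>+x. ennreal (g x powr ((\<alpha> - 1) / \<alpha>)) \<partial>lborel) < \<infinity>"
proof -
  let ?J = "\<integral>\<^sup>+x. ennreal (g x powr ((\<alpha> - 1) / \<alpha>)) \<partial>lborel"
  have [measurable]: "g \<in> borel_measurable borel" by (rule G.borel_measurable_density)
  have "(\<alpha> - 1) / \<alpha> \<noteq> 1" "1 / (1 - (\<alpha> - 1) / \<alpha>) = \<alpha>" using assms(1) by (auto simp: field_simps)
  moreover have "{x. g x \<noteq> 0} = UNIV" using g_pos by (auto simp: less_imp_neq[symmetric])
  ultimately have eq: "entropy_power ((\<alpha> - 1) / \<alpha>) g = enn_powr ?J \<alpha>"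
    by (simp add: entropy_power_def)
  show fin: "?J < \<infinity>" using assms unfolding eq by (auto simp: enn_powr_def less_top split: if_splits)
  have "?J \<noteq> 0"
  proof
    assume "?J = 0"
    then have "AE x in lborel. x \<in> UNIV \<longrightarrow> ennreal (g x powr ((\<alpha> - 1) / \<alpha>)) = 0"
      by (simp add: nn_integral_0_iff_AE)
    from AE_open_witness[OF this] obtain x where "ennreal (g x powr ((\<alpha> - 1) / \<alpha>)) = 0" by auto
    with g_pos[of x] show False by (simp add: ennreal_eq_0_iff)
  qed
  with fin have "0 < enn2real ?J" by (simp add: enn2real_positive_iff less_top zero_less_iff_neq_zero)
  then show "0 < r_const p \<alpha>"
    using fin \<open>?J \<noteq> 0\<close> unfolding r_const_def eq by (simp add: enn_powr_def less_top)
qed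

lemma (in interval_density) nn_integral_density_\<Omega>: "(\<integral>\<^sup>+x\<in>\<Omega>. ennreal (f x) \<partial>lborel) = 1"
  using nn_integral_\<Omega>[of "\<lambda>_. 1"] emeasure_space_1 by simp

lemma (in interval_density) set_integrable_\<Omega>: "set_integrable lborel \<Omega> f"
  and set_integral_\<Omega>: "(LBINT x:\<Omega>. f x) = 1"
proof -
  show *: "set_integrable lborel \<Omega> f" by (rule set_integrable_density) simp
  have "ennreal (LBINT x:\<Omega>. f x) = (\<integral>\<^sup>+x. ennreal (indicator \<Omega> x *\<^sub>R f x) \<partial>lborel)"
    unfolding set_lebesgue_integral_def
    by (rule nn_integral_eq_integral[symmetric]) (use * f_nonneg in \<open>auto simp: set_integrable_def\<close>)
  also have "\<dots> = (\<integral>\<^sup>+x\<in>\<Omega>. ennreal (f x) \<partial>lborel)"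
    by (intro nn_integral_cong) (auto split: split_indicator)
  finally have "ennreal (LBINT x:\<Omega>. f x) = ennreal 1" by (simp add: nn_integral_density_\<Omega>)
  moreover have "0 \<le> (LBINT x:\<Omega>. f x)" using f_nonneg
    by (auto simp: set_lebesgue_integral_def intro!: Bochner_Integration.integral_nonneg)
  ultimately show "(LBINT x:\<Omega>. f x) = 1" by (simp only: ennreal_inj)
qed

section \<open>The weight, the entropy integrals and the adapted coordinate\<close>

locale adapted = transport p q a \<Omega> f xi xf + S: transport p q a \<Omega> fs xi xf
  for p q a \<Omega> f fs xi xf +
  fixes \<alpha> :: real
  assumes \<alpha>_pos: "0 < \<alpha>" and entropy_fin: "entropy_power ((\<alpha> - 1) / \<alpha>) (gen_gauss p) < \<infinity>"
begin

abbreviation r :: real where "r \<equiv> r_const p \<alpha>"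

lemma r_pos: "0 < r"
  by (rule r_const_pos[OF \<alpha>_pos entropy_fin])

text \<open>A version of \<open>C_fun\<close> on the whole line: with \<open>S.W0\<close> it is
  positive and Borel everywhere, with the value \<open>1 / (r * a)\<close> off \<Omega>.\<close>

definition C :: "real \<Rightarrow> real" where "C x = 1 / (r * g (S.W0 x))"

lemma C_fun_C: "x \<in> \<Omega> \<Longrightarrow> C_fun p \<alpha> \<Omega> fs x = C x"
  by (simp add: C_def S.C_fun_eq S.W0_eq)

lemma C_pos: "0 < C x"
  using r_pos g_pos by (simp add: C_def)

lemma borel_measurable_C [measurable]: "C \<in> borel_measurable borel"
  using G.borel_measurable_density unfolding C_def[abs_def] by measurable

lemma ln_C: "ln (C x) = \<bar>S.W0 x\<bar> powr q - ln (r * a)"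
  using r_pos a_pos g_pos[of "S.W0 x"] by (simp add: C_def ln_div ln_mult ln_g)

abbreviation D :: ereal where "D \<equiv> rel_entropy \<Omega> f fs"
abbreviation L :: ereal where "L \<equiv> mean_log_C p \<alpha> \<Omega> fs f"

lemma L_eq: "L = ext_integral \<Omega> (\<lambda>x. f x * ln (C x))"
  unfolding mean_log_C_def by (rule ext_integral_cong) (simp add: C_fun_C)

text \<open>From \<open>ln t \<le> t - 1\<close> at \<open>t = fs x / f x\<close> the negative part
  is at most \<open>fs x\<close>, which has mass 1.\<close>

lemma D_neg: "(\<integral>\<^sup>+x\<in>\<Omega>. ennreal (- (f x * ln (f x / fs x))) \<partial>lborel) \<noteq> \<infinity>"
proof -
  have "(\<integral>\<^sup>+x\<in>\<Omega>. ennreal (- (f x * ln (f x / fs x))) \<partial>lborel) \<le> (\<integral>\<^sup>+x\<in>\<Omega>. ennreal (fs x) \<partial>lborel)"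
  proof (intro nn_integral_mono)
    fix x
    show "ennreal (- (f x * ln (f x / fs x))) * indicator \<Omega> x \<le> ennreal (fs x) * indicator \<Omega> x"
    proof (cases "x \<in> \<Omega>")
      case True
      then have pos: "0 < f x" "0 < fs x" by (auto simp: f_pos S.f_pos)
      have "f x * ln (fs x / f x) \<le> f x * (fs x / f x - 1)"
        using pos ln_le_minus_one[of "fs x / f x"] by (intro mult_left_mono) auto
      also have "\<dots> \<le> fs x" using pos by (simp add: field_simps)
      also have "f x * ln (fs x / f x) = - (f x * ln (f x / fs x))" using pos by (simp add: ln_div algebra_simps)
      finally show ?thesis using True by (simp add: ennreal_leI)
    qed simp
  qed
  then show ?thesis by (auto simp: S.nn_integral_density_\<Omega> top_unique)
qed

text \<open>The Gaussian is largest at 0, so \<open>ln (C x)\<close> is bounded below by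
  \<open>- ln (r * a)\<close>.\<close>

lemma L_neg: "(\<integral>\<^sup>+x\<in>\<Omega>. ennreal (- (f x * ln (C x))) \<partial>lborel) \<noteq> \<infinity>"
proof -
  have "(\<integral>\<^sup>+x\<in>\<Omega>. ennreal (- (f x * ln (C x))) \<partial>lborel) \<le> (\<integral>\<^sup>+x. ennreal \<bar>ln (r * a)\<bar> * ennreal (f x) * indicator \<Omega> x \<partial>lborel)"
  proof (intro nn_integral_mono)
    fix x
    have "- ln (C x) \<le> \<bar>ln (r * a)\<bar>"
      unfolding ln_C using powr_ge_zero[of "\<bar>S.W0 x\<bar>" q] by linarith
    then have "f x * (- ln (C x)) \<le> f x * \<bar>ln (r * a)\<bar>" by (intro mult_left_mono) (simp_all add: f_nonneg)
    then have "ennreal (- (f x * ln (C x))) \<le> ennreal (\<bar>ln (r * a)\<bar> * f x)"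
      by (intro ennreal_leI) (simp add: mult.commute)
    then show "ennreal (- (f x * ln (C x))) * indicator \<Omega> x \<le> ennreal \<bar>ln (r * a)\<bar> * ennreal (f x) * indicator \<Omega> x"
      unfolding ennreal_mult'[OF abs_ge_zero] by (rule mult_right_mono) simp
  qed
  also have "\<dots> = ennreal \<bar>ln (r * a)\<bar>"
    by (subst mult.assoc, subst nn_integral_cmult) (auto simp: nn_integral_density_\<Omega>)
  finally show ?thesis by (auto simp: top_unique)
qed

lemma D_neq_minf: "D \<noteq> -\<infinity>" and L_neq_minf: "L \<noteq> -\<infinity>"
  unfolding L_eq rel_entropy_def by (intro ext_integral_neq_minf D_neg L_neg)+

lemma set_borel_measurable_\<Omega>:
  fixes \<phi> :: "real \<Rightarrow> real"
  assumes [measurable]: "\<phi> \<in> borel_measurable borel"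
  shows "set_borel_measurable lborel \<Omega> \<phi>"
  unfolding set_borel_measurable_def by measurable

lemma D_finite:
  assumes "D \<noteq> \<infinity>"
  shows "set_integrable lborel \<Omega> (\<lambda>x. f x * ln (f x / fs x))" "D = ereal (LBINT x:\<Omega>. f x * ln (f x / fs x))"
proof -
  show "set_integrable lborel \<Omega> (\<lambda>x. f x * ln (f x / fs x))"
    by (intro set_integrable_of_ext_integral set_borel_measurable_\<Omega> D_neg)
       (use assms in \<open>auto simp: rel_entropy_def\<close>)
  then show "D = ereal (LBINT x:\<Omega>. f x * ln (f x / fs x))"
    unfolding rel_entropy_def by (rule ext_integral_eq)
qed

lemma L_finite:
  assumes "L \<noteq> \<infinity>"
  shows "set_integrable lborel \<Omega> (\<lambda>x. f x * ln (C x))" "L = ereal (LBINT x:\<Omega>. f x * ln (C x))"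
proof -
  show "set_integrable lborel \<Omega> (\<lambda>x. f x * ln (C x))"
    by (intro set_integrable_of_ext_integral set_borel_measurable_\<Omega> L_neg)
       (use assms in \<open>auto simp: L_eq\<close>)
  then show "L = ereal (LBINT x:\<Omega>. f x * ln (C x))"
    unfolding L_eq by (rule ext_integral_eq)
qed

text \<open>The derivative \<open>f powr (1 - \<alpha>) * h_star powr \<alpha>\<close> of the escort
  coordinate; \<open>C\<close> enters to the first power because \<open>h_star\<close> carries
  \<open>C powr (1 / \<alpha>)\<close>.\<close>

definition dy :: "real \<Rightarrow> real" where "dy s = f s powr (1 - \<alpha>) * fs s powr \<alpha> * C s"

lemma borel_measurable_dy [measurable]: "dy \<in> borel_measurable borel"
  unfolding dy_def[abs_def] by measurable

lemma dy_pos: "x \<in> \<Omega> \<Longrightarrow> 0 < dy x"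
  using f_pos[of x] S.f_pos[of x] C_pos[of x] by (auto simp: dy_def intro!: mult_pos_pos)

definition y :: "real \<Rightarrow> ennreal" where "y x = (\<integral>\<^sup>+s\<in>\<Omega> \<inter> {..x}. ennreal (dy s) \<partial>lborel)"

lemma borel_measurable_y [measurable]: "y \<in> borel_measurable borel"
proof -
  have "y = (\<lambda>x. \<integral>\<^sup>+s. (if s \<le> x then ennreal (dy s) * indicator \<Omega> s else 0) \<partial>lborel)"
    unfolding y_def[abs_def] by (intro ext nn_integral_cong) (auto split: split_indicator)
  also have "\<dots> \<in> borel_measurable borel" by measurable
  finally show ?thesis .
qed

lemma y_pos: assumes "x \<in> \<Omega>" shows "y x \<noteq> 0"
proof
  assume "y x = 0"
  moreover have "\<Omega> \<inter> {..<x} \<noteq> {}" using exists_between_\<Omega>(1)[OF assms] by auto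
  ultimately have "\<exists>s\<in>\<Omega> \<inter> {..<x}. ennreal (dy s) = 0"
    unfolding y_def by (intro nn_integral_zero_witness[where A = "\<Omega> \<inter> {..x}"]) auto
  then show False using dy_pos by (force simp: ennreal_eq_0_iff)
qed

definition m :: ennreal where "m = (\<integral>\<^sup>+x\<in>\<Omega>. enn_powr (y x) q * ennreal (f x) \<partial>lborel)"

lemma adapted_moment_eq: "adapted_moment p q \<alpha> \<Omega> fs f = enn_powr m (1 / (q * \<alpha>))"
proof -
  have "(\<integral>\<^sup>+s\<in>\<Omega> \<inter> {..x}. ennreal (f s powr (1 - \<alpha>) * fs s powr \<alpha> * C_fun p \<alpha> \<Omega> fs s) \<partial>lborel) = y x" for x
    unfolding y_def dy_def by (intro nn_integral_cong) (auto simp: C_fun_C split: split_indicator)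
  then show ?thesis by (simp add: adapted_moment_def m_def)
qed

text \<open>The coordinate is measured from the left end of \<Omega> and may be infinite. If it is
  so at \<open>x\<close>, then it is so to the right of \<open>x\<close>, where \<open>f\<close> has
  positive mass, and the moment is infinite.\<close>

lemma y_finite: assumes "m \<noteq> \<infinity>" "x \<in> \<Omega>" shows "y x \<noteq> \<infinity>"
proof
  assume inf: "y x = \<infinity>"
  let ?N = "\<integral>\<^sup>+s. ennreal (f s) * indicator (\<Omega> \<inter> {x<..}) s \<partial>lborel"
  have "y s = \<infinity>" if "x \<le> s" for s
  proof -
    have "y x \<le> y s" unfolding y_def using that by (intro nn_integral_mono) (auto split: split_indicator)
    with inf show ?thesis by (simp add: top_unique)
  qed
  then have "(\<integral>\<^sup>+s. \<infinity> * (ennreal (f s) * indicator (\<Omega> \<inter> {x<..}) s) \<partial>lborel) \<le> m"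
    unfolding m_def by (intro nn_integral_mono) (auto simp: enn_powr_def q_pos split: split_indicator)
  then have "\<infinity> * ?N \<le> m" by (subst (asm) nn_integral_cmult) auto
  with assms(1) have "?N = 0" by (auto simp: ennreal_top_mult top_unique split: if_splits)
  moreover have "\<Omega> \<inter> {x<..} \<noteq> {}" using exists_between_\<Omega>(2)[OF assms(2)] by auto
  ultimately have "\<exists>s\<in>\<Omega> \<inter> {x<..}. ennreal (f s) = 0"
    by (intro nn_integral_zero_witness[where A = "\<Omega> \<inter> {x<..}"]) auto
  then show False using f_pos by (force simp: ennreal_eq_0_iff)
qed

lemma m_pos: "m \<noteq> 0"
proof (cases "m = \<infinity>")
  case False
  show ?thesis
  proof
    assume m0: "m = 0"
    have [measurable]: "(\<lambda>x. enn_powr (y x) q) \<in> borel_measurable borel" unfolding enn_powr_def by measurable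
    have "\<Omega> \<noteq> {}" using W_surj by auto
    with m0 have "\<exists>x\<in>\<Omega>. enn_powr (y x) q * ennreal (f x) = 0"
      unfolding m_def by (intro nn_integral_zero_witness[where A = \<Omega>]) auto
    then obtain x where x: "x \<in> \<Omega>" "enn_powr (y x) q * ennreal (f x) = 0" by blast
    then have "enn_powr (y x) q = 0" using f_pos[OF x(1)] by (simp add: ennreal_eq_0_iff)
    then show False using y_pos[OF x(1)] y_finite[OF False x(1)] q_pos
      by (cases "y x") (auto simp: enn_powr_def ennreal_eq_0_iff split: if_splits)
  qed
qed simp

end

lemma set_nn_integral_eq_set_integral:
  assumes "set_integrable lborel A \<phi>" "\<And>x. x \<in> A \<Longrightarrow> 0 \<le> \<phi> x"
  shows "(\<integral>\<^sup>+x\<in>A. ennreal (\<phi> x) \<partial>lborel) = ennreal (LBINT x:A. \<phi> x)"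
proof -
  have "(\<integral>\<^sup>+x\<in>A. ennreal (\<phi> x) \<partial>lborel) = (\<integral>\<^sup>+x. ennreal (indicator A x *\<^sub>R \<phi> x) \<partial>lborel)"
    by (intro nn_integral_cong) (auto split: split_indicator)
  also have "\<dots> = ennreal (LBINT x:A. \<phi> x)"
    unfolding set_lebesgue_integral_def
    by (rule nn_integral_eq_integral)
       (use assms in \<open>auto simp: set_integrable_def split: split_indicator\<close>)
  finally show ?thesis .
qed

lemma set_integrable_of_nn_integral:
  assumes "set_borel_measurable lborel A \<phi>" "\<And>x. x \<in> A \<Longrightarrow> 0 \<le> \<phi> x"
    and "(\<integral>\<^sup>+x\<in>A. ennreal (\<phi> x) \<partial>lborel) < \<infinity>"
  shows "set_integrable lborel A \<phi>"
proof -
  have "(\<integral>\<^sup>+x\<in>A. ennreal (\<phi> x) \<partial>lborel) = (\<integral>\<^sup>+x. ennreal (indicator A x *\<^sub>R \<phi> x) \<partial>lborel)"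
    by (intro nn_integral_cong) (auto split: split_indicator)
  then show ?thesis
    using assms unfolding set_integrable_def set_borel_measurable_def
    by (intro integrableI_nonneg) (auto split: split_indicator)
qed

context adapted
begin

text \<open>Gibbs' inequality for \<open>f\<close> against the pullback under \<open>x \<mapsto> y x\<close> of a generalised Gaussian whose
  scale \<open>b\<close> is matched to the moment of \<open>f\<close>.\<close>

lemma moment_bound:
  assumes m: "m \<noteq> \<infinity>" and D: "D \<noteq> \<infinity>"
  shows "L \<noteq> \<infinity>"
    and "real_of_ereal L \<le> \<alpha> * real_of_ereal D + (ln q + ln (enn2real m)) / q - ln a + 1 / q"
proof -
  define mr where "mr = enn2real m"
  have mr: "m = ennreal mr" "0 < mr"
    using m m_pos by (auto simp: mr_def enn2real_positive_iff less_top zero_less_iff_neq_zero)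
  \<comment> \<open>The \<open>q\<close>-th moment of \<open>g\<close> is \<open>1 / q\<close>, so
    with \<open>b powr q = q * mr\<close> the rescaled Gaussian with density
    \<open>g (t / b) / b\<close> has moment \<open>mr\<close>.\<close>
  define b where "b = (q * mr) powr (1 / q)"
  have b: "0 < b" "b powr q = q * mr" using mr q_pos by (simp_all add: b_def powr_powr)
  define Y where "Y x = enn2real (y x)" for x
  have Y: "y x = ennreal (Y x)" "0 < Y x" if "x \<in> \<Omega>" for x
    using y_finite[OF m that] y_pos[OF that]
    by (auto simp: Y_def enn2real_positive_iff less_top zero_less_iff_neq_zero)
  have [measurable]: "Y \<in> borel_measurable borel" unfolding Y_def[abs_def] by measurable
  have [measurable]: "g \<in> borel_measurable borel" by (rule G.borel_measurable_density)
  define k where "k x = dy x * (g (Y x / b) / b)" for x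
  have [measurable]: "k \<in> borel_measurable borel" unfolding k_def[abs_def] by measurable
  have k_pos: "0 < k x" if "x \<in> \<Omega>" for x using dy_pos[OF that] g_pos b by (simp add: k_def)
  have k_le: "(\<integral>\<^sup>+x\<in>\<Omega>. ennreal (k x) \<partial>lborel) \<le> 1"
    unfolding k_def
    by (rule nn_integral_gaussian_pullback_le_1[OF \<Omega>_eq xi_less_xf])
       (use dy_pos Y b in \<open>auto simp: y_def\<close>)
  have int_k: "set_integrable lborel \<Omega> k"
    by (rule set_integrable_of_nn_integral)
       (use k_le k_pos in \<open>auto intro!: set_borel_measurable_\<Omega> simp: less_imp_le le_less_trans\<close>)
  have int_k_le: "(LBINT x:\<Omega>. k x) \<le> 1"
    using k_le set_nn_integral_eq_set_integral[OF int_k] k_pos by (simp add: less_imp_le ennreal_le_1)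
  have m_eq: "(\<integral>\<^sup>+x\<in>\<Omega>. ennreal (Y x powr q * f x) \<partial>lborel) = ennreal mr"
    unfolding mr(1)[symmetric] m_def
    by (intro nn_integral_cong)
       (auto simp: Y enn_powr_ennreal ennreal_mult'[OF powr_ge_zero] split: split_indicator)
  have int_m: "set_integrable lborel \<Omega> (\<lambda>x. Y x powr q * f x)"
    by (rule set_integrable_of_nn_integral)
       (use m_eq f_nonneg in \<open>auto intro!: set_borel_measurable_\<Omega>\<close>)
  have int_m_eq: "(LBINT x:\<Omega>. Y x powr q * f x) = mr"
  proof -
    have "0 \<le> (LBINT x:\<Omega>. Y x powr q * f x)"
      unfolding set_lebesgue_integral_def using f_nonneg by (auto intro!: Bochner_Integration.integral_nonneg)
    then show ?thesis
      using m_eq set_nn_integral_eq_set_integral[OF int_m] f_nonneg mr by simp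
  qed
  note int_D = D_finite[OF D]
  \<comment> \<open>Gibbs' inequality \<open>f * ln (k / f) \<le> k - f\<close>, solved for
    \<open>f * ln C\<close>. Every summand is integrable, so \<open>R\<close> also serves to show
    that \<open>L\<close> is finite.\<close>
  define R where "R x = (k x - f x) + \<alpha> * (f x * ln (f x / fs x)) + (ln b - ln a) * f x + (Y x powr q * f x) / (q * mr)" for x
  have int_R: "set_integrable lborel \<Omega> R"
    unfolding R_def[abs_def] using int_k int_m int_D set_integrable_\<Omega>
    by (intro set_integral_add set_integral_diff set_integrable_mult_right set_integrable_divide impI) auto
  have int_R_eq: "(LBINT x:\<Omega>. R x) = ((LBINT x:\<Omega>. k x) - 1) + \<alpha> * (LBINT x:\<Omega>. f x * ln (f x / fs x)) + (ln b - ln a) + 1 / q"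
  proof -
    have "(LBINT x:\<Omega>. R x) = ((LBINT x:\<Omega>. k x) - (LBINT x:\<Omega>. f x)) + \<alpha> * (LBINT x:\<Omega>. f x * ln (f x / fs x))
      + (ln b - ln a) * (LBINT x:\<Omega>. f x) + (LBINT x:\<Omega>. Y x powr q * f x) / (q * mr)"
      unfolding R_def[abs_def] using int_k int_m int_D(1) set_integrable_\<Omega>
      by (subst set_integral_add set_integral_diff | simp add: set_integrable_mult_right set_integrable_divide set_integral_add set_integral_diff)+
    then show ?thesis using mr by (simp add: set_integral_\<Omega> int_m_eq)
  qed
  have pointwise: "f x * ln (C x) \<le> R x" if x: "x \<in> \<Omega>" for x
  proof -
    have pos: "0 < f x" "0 < fs x" "0 < C x" "0 < k x" "0 < Y x"
      using f_pos[OF x] S.f_pos[OF x] C_pos k_pos[OF x] Y[OF x] by auto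
    have "ln (dy x) = (1 - \<alpha>) * ln (f x) + \<alpha> * ln (fs x) + ln (C x)"
      using pos by (simp add: dy_def ln_mult ln_powr)
    moreover have "ln (k x) = ln (dy x) + (ln a - (Y x / b) powr q - ln b)"
      using dy_pos[OF x] g_pos[of "Y x / b"] b pos by (simp add: k_def ln_mult ln_div ln_g)
    moreover have "(Y x / b) powr q = Y x powr q / (q * mr)"
      using pos b by (simp add: powr_divide)
    ultimately have ln_k: "ln (k x / f x) = - \<alpha> * ln (f x / fs x) + ln (C x) + ln a - Y x powr q / (q * mr) - ln b"
      using pos by (simp add: ln_div algebra_simps)
    have "f x * ln (k x / f x) \<le> f x * (k x / f x - 1)"
      using pos ln_le_minus_one[of "k x / f x"] by (intro mult_left_mono) auto
    also have "\<dots> = k x - f x" using pos by (simp add: field_simps)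
    finally show ?thesis unfolding ln_k R_def by (simp add: algebra_simps)
  qed
  show L: "L \<noteq> \<infinity>"
  proof -
    have "set_integrable lborel \<Omega> (\<lambda>x. f x * ln (C x))"
    proof (rule set_integrable_bound[OF set_integral_add(1)[OF set_integrable_abs[OF int_R] set_integrable_mult_right[of "\<bar>ln (r * a)\<bar>"]]])
      show "set_integrable lborel \<Omega> f" by (rule set_integrable_\<Omega>)
      show "set_borel_measurable lborel \<Omega> (\<lambda>x. f x * ln (C x))" by (intro set_borel_measurable_\<Omega>) measurable
      have "\<bar>f x * ln (C x)\<bar> \<le> \<bar>R x\<bar> + \<bar>ln (r * a)\<bar> * f x" if "x \<in> \<Omega>" for x
      proof -
        have "- ln (C x) \<le> \<bar>ln (r * a)\<bar>"
          unfolding ln_C using powr_ge_zero[of "\<bar>S.W0 x\<bar>" q] by linarith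
        then have "f x * (- ln (C x)) \<le> f x * \<bar>ln (r * a)\<bar>" by (intro mult_left_mono) (simp_all add: f_nonneg)
        moreover have "0 \<le> \<bar>ln (r * a)\<bar> * f x" using f_nonneg by simp
        ultimately show ?thesis using pointwise[OF that] by (simp add: mult.commute)
      qed
      then show "AE x in lborel. x \<in> \<Omega> \<longrightarrow> norm (f x * ln (C x)) \<le> norm (\<bar>R x\<bar> + \<bar>ln (r * a)\<bar> * f x)"
        unfolding real_norm_def by (intro AE_I2 impI) (rule order_trans[OF _ abs_ge_self])
    qed
    from ext_integral_eq[OF this] show ?thesis by (simp add: L_eq)
  qed
  note int_L = L_finite[OF L]
  have "(LBINT x:\<Omega>. f x * ln (C x)) \<le> (LBINT x:\<Omega>. R x)"
    by (rule set_integral_mono[OF int_L(1) int_R pointwise])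
  moreover have "ln b = (ln q + ln mr) / q"
    using mr q_pos by (simp add: b_def ln_powr ln_mult)
  ultimately show "real_of_ereal L \<le> \<alpha> * real_of_ereal D + (ln q + ln (enn2real m)) / q - ln a + 1 / q"
    using int_R_eq int_k_le int_D(2) int_L(2) by (simp flip: mr_def)
qed

lemma adapted_moment_ineq:
  "adapted_moment p q \<alpha> \<Omega> fs f * exp_ereal D \<ge> enn_powr (K0 p) (1 / \<alpha>) * exp_ereal (ereal (1 / \<alpha>) * L)"
proof (cases "m = \<infinity> \<or> D = \<infinity>")
  case True
  \<comment> \<open>In \<open>ennreal\<close> the product of 0 and \<infinity> is 0, so both factors
    must be nonzero for the infinite one to decide.\<close>
  have "exp_ereal D \<noteq> 0" using D_neq_minf by (cases D) (auto simp: exp_ereal_def ennreal_eq_0_iff)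
  moreover have "enn_powr m (1 / (q * \<alpha>)) \<noteq> 0"
    using m_pos q_pos \<alpha>_pos by (cases m) (auto simp: enn_powr_def ennreal_eq_0_iff)
  moreover have "enn_powr m (1 / (q * \<alpha>)) = \<infinity> \<or> exp_ereal D = \<infinity>"
    using True q_pos \<alpha>_pos by (auto simp: enn_powr_def exp_ereal_def)
  ultimately have "adapted_moment p q \<alpha> \<Omega> fs f * exp_ereal D = \<infinity>"
    unfolding adapted_moment_eq by (auto simp: ennreal_mult_eq_top_iff)
  then show ?thesis by simp
next
  case False
  then have m: "m \<noteq> \<infinity>" and D: "D \<noteq> \<infinity>" by auto
  obtain d where d: "D = ereal d" using D D_neq_minf by (cases D) auto
  obtain l where l: "L = ereal l" using moment_bound(1)[OF m D] L_neq_minf by (cases L) auto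
  obtain mr where mr: "m = ennreal mr" "0 < mr"
    using m m_pos by (cases m) (auto simp: less_le)
  have le: "l \<le> \<alpha> * d + (ln q + ln mr) / q - ln a + 1 / q"
    using moment_bound(2)[OF m D] mr by (simp add: d l)
  define k0 where "k0 = (1 / q) powr (1 / q) * a / exp (1 / q)"
  have k0: "0 < k0" "ln k0 = - ln q / q + ln a - 1 / q"
    using q_pos a_pos by (auto simp: k0_def ln_mult ln_div ln_powr)
  have "ln k0 * (1 / \<alpha>) + 1 / \<alpha> * l \<le> ln mr * (1 / (q * \<alpha>)) + d"
  proof -
    have "(ln k0 + l) / \<alpha> \<le> (ln mr / q + \<alpha> * d) / \<alpha>"
      using le \<alpha>_pos by (intro divide_right_mono) (auto simp: k0 add_divide_distrib)
    then show ?thesis using \<alpha>_pos by (simp add: add_divide_distrib)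
  qed
  then have "exp (ln k0 * (1 / \<alpha>)) * exp (1 / \<alpha> * l) \<le> exp (ln mr * (1 / (q * \<alpha>))) * exp d"
    by (simp flip: exp_add)
  then have "k0 powr (1 / \<alpha>) * exp (1 / \<alpha> * l) \<le> mr powr (1 / (q * \<alpha>)) * exp d"
    using k0(1) mr(2) by (simp add: powr_def mult.commute)
  from ennreal_leI[OF this] show ?thesis
    unfolding adapted_moment_eq mr(1) K0_eq k0_def[symmetric] d l
    using k0(1) mr(2) by (simp add: enn_powr_ennreal exp_ereal_def ennreal_mult')
qed

end

section \<open>Escort coordinates\<close>

locale escort =
  fixes \<alpha> c :: real and xi xf :: ereal and \<Omega> :: "real set" and f h :: "real \<Rightarrow> real"
  assumes \<Omega>: "\<Omega> = einterval xi xf" and c: "c \<in> \<Omega>"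
    and pos: "\<And>x. x \<in> \<Omega> \<Longrightarrow> 0 < f x" "\<And>x. x \<in> \<Omega> \<Longrightarrow> 0 < h x"
    and cont: "continuous_on \<Omega> f" "continuous_on \<Omega> h"
begin

definition dcoord :: "real \<Rightarrow> real" where "dcoord s = f s powr (1 - \<alpha>) * h s powr \<alpha>"

abbreviation coord :: "real \<Rightarrow> real" where "coord \<equiv> escort_coord \<alpha> h c f"
abbreviation \<rho> :: "real \<Rightarrow> real" where "\<rho> \<equiv> rel_escort \<alpha> \<Omega> h c f"

lemma dcoord_pos: "x \<in> \<Omega> \<Longrightarrow> 0 < dcoord x"
  using pos[of x] by (simp add: dcoord_def)

lemma continuous_on_dcoord: "continuous_on \<Omega> dcoord"
  unfolding dcoord_def[abs_def] using pos by (intro continuous_on_mult continuous_on_powr cont continuous_on_const) force+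

lemma interval_sub: "x \<in> \<Omega> \<Longrightarrow> y \<in> \<Omega> \<Longrightarrow> {x..y} \<subseteq> \<Omega>"
  unfolding \<Omega> einterval_iff subset_iff atLeastAtMost_iff
  by (meson ereal_less_eq(3) le_less_trans less_le_trans)

lemma DERIV_coord:
  assumes x: "x \<in> \<Omega>"
  shows "(coord has_real_derivative dcoord x) (at x)"
proof -
  have op: "open \<Omega>" by (simp add: \<Omega>)
  have mem: "min c x \<in> \<Omega>" "max c x \<in> \<Omega>" using x c by (auto simp: min_def max_def)
  obtain e where e: "0 < e" "cball (min c x) e \<subseteq> \<Omega>" using op mem(1) open_contains_cball by blast
  obtain e' where e': "0 < e'" "cball (max c x) e' \<subseteq> \<Omega>" using op mem(2) open_contains_cball by blast
  \<comment> \<open>The fundamental theorem is applied on a compact interval inside \<Omega> with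
    \<open>c\<close> and \<open>x\<close> in its interior, whichever of them is larger.\<close>
  let ?a = "min c x - e" and ?b = "max c x + e'"
  have ab: "?a \<in> \<Omega>" "?b \<in> \<Omega>" using e e' by (auto simp: subset_iff dist_real_def)
  have sub: "{?a..?b} \<subseteq> \<Omega>" by (rule interval_sub[OF ab])
  have "((\<lambda>u. LBINT s=c..u. dcoord s) has_vector_derivative dcoord x) (at x within {?a..?b})"
    using e(1) e'(1) by (intro interval_integral_FTC2 continuous_on_subset[OF continuous_on_dcoord sub]) auto
  then have "(coord has_vector_derivative dcoord x) (at x within {?a<..<?b})"
    unfolding escort_coord_def[abs_def] dcoord_def
    by (rule has_vector_derivative_within_subset) auto
  moreover have "at x within {?a<..<?b} = at x"
    using e(1) e'(1) by (intro at_within_open) auto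
  ultimately show ?thesis unfolding has_real_derivative_iff_has_vector_derivative by (simp only:)
qed

lemma coord_strict_mono:
  assumes "x \<in> \<Omega>" "y \<in> \<Omega>" "x < y" shows "coord x < coord y"
proof (rule DERIV_pos_imp_increasing[OF assms(3)])
  fix z assume "x \<le> z" "z \<le> y"
  then have "z \<in> \<Omega>" using interval_sub[OF assms(1,2)] by auto
  then show "\<exists>d. (coord has_real_derivative d) (at z) \<and> 0 < d" using DERIV_coord dcoord_pos by blast
qed

lemma coord_le_iff: "x \<in> \<Omega> \<Longrightarrow> y \<in> \<Omega> \<Longrightarrow> coord x \<le> coord y \<longleftrightarrow> x \<le> y"
  using coord_strict_mono[of x y] coord_strict_mono[of y x] by (cases x y rule: linorder_cases) auto

lemma inj_on_coord: "inj_on coord \<Omega>"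
  by (intro inj_onI antisym) (auto simp flip: coord_le_iff)

lemma \<rho>_coord: "x \<in> \<Omega> \<Longrightarrow> \<rho> (coord x) = (f x / h x) powr \<alpha>"
  by (simp add: rel_escort_def the_inv_into_f_f[OF inj_on_coord])

lemma \<rho>_pos_imp: "0 < \<rho> y \<Longrightarrow> y \<in> coord ` \<Omega>"
  by (auto simp: rel_escort_def split: if_splits)

text \<open>Mass conservation under the change of coordinate: \<open>f dx\<close> is the escort
  density times \<open>dy\<close>.\<close>

lemma dcoord_eq: assumes "x \<in> \<Omega>" shows "f x = (f x / h x) powr \<alpha> * dcoord x"
  using pos[OF assms] by (simp add: dcoord_def powr_divide powr_diff)

end

lemma ac_on_lipschitz:
  fixes F :: "real \<Rightarrow> real"
  assumes K: "0 < K" and lip: "\<And>x y. \<bar>F x - F y\<bar> \<le> K * \<bar>x - y\<bar>"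
  shows "ac_on S F"
  unfolding ac_on_def
proof (intro allI impI)
  fix \<epsilon> :: real assume \<epsilon>: "0 < \<epsilon>"
  show "\<exists>\<delta>>0. \<forall>(n::nat) a b. (\<forall>i<n. a i \<le> b i \<and> {a i..b i} \<subseteq> S) \<and>
      disjoint_family_on (\<lambda>i. {a i<..<b i}) {..<n} \<and> (\<Sum>i<n. b i - a i) < \<delta> \<longrightarrow>
      (\<Sum>i<n. \<bar>F (b i) - F (a i)\<bar>) < \<epsilon>"
  proof (intro exI[of _ "\<epsilon> / K"] conjI allI impI)
    fix n :: nat and a b :: "nat \<Rightarrow> real"
    assume *: "(\<forall>i<n. a i \<le> b i \<and> {a i..b i} \<subseteq> S) \<and>
      disjoint_family_on (\<lambda>i. {a i<..<b i}) {..<n} \<and> (\<Sum>i<n. b i - a i) < \<epsilon> / K"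
    have "(\<Sum>i<n. \<bar>F (b i) - F (a i)\<bar>) \<le> (\<Sum>i<n. K * (b i - a i))"
    proof (intro sum_mono)
      fix i assume "i \<in> {..<n}"
      then have "a i \<le> b i" using * by auto
      then show "\<bar>F (b i) - F (a i)\<bar> \<le> K * (b i - a i)" using lip[of "b i" "a i"] by simp
    qed
    also have "\<dots> = K * (\<Sum>i<n. b i - a i)" by (simp add: sum_distrib_left)
    also have "\<dots> < \<epsilon>" using * K by (simp add: field_simps)
    finally show "(\<Sum>i<n. \<bar>F (b i) - F (a i)\<bar>) < \<epsilon>" .
  qed (use \<epsilon> K in simp)
qed

lemma ac_on_uniform:
  fixes F :: "real \<Rightarrow> real"
  assumes "ac_on UNIV F" "0 < \<epsilon>"
  obtains \<delta> where "0 < \<delta>" "\<And>x y. \<bar>x - y\<bar> < \<delta> \<Longrightarrow> \<bar>F x - F y\<bar> < \<epsilon>"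
proof -
  from assms obtain \<delta> where \<delta>: "0 < \<delta>" and H: "\<And>(n::nat) a b. (\<forall>i<n. a i \<le> b i \<and> {a i..b i} \<subseteq> UNIV) \<and>
      disjoint_family_on (\<lambda>i. {a i<..<b i}) {..<n} \<and> (\<Sum>i<n. b i - a i) < \<delta> \<Longrightarrow>
      (\<Sum>i<n. \<bar>F (b i) - F (a i)\<bar>) < \<epsilon>"
    unfolding ac_on_def by blast
  have "\<bar>F x - F y\<bar> < \<epsilon>" if "\<bar>x - y\<bar> < \<delta>" for x y
    using H[of 1 "\<lambda>_. min x y" "\<lambda>_. max x y"] that
    by (cases "x \<le> y") (auto simp: disjoint_family_on_def abs_minus_commute)
  with \<delta> show ?thesis using that by blast
qed

lemma (in gen_gaussian) lipschitz_g:
  assumes "1 < p" shows "\<bar>g x - g y\<bar> \<le> (q * a) * \<bar>x - y\<bar>"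
proof -
  have bound: "\<bar>- (q * \<bar>x\<bar> powr (q - 1) * sgn x) * g x\<bar> \<le> q * a" for x
  proof -
    have "\<bar>x\<bar> powr (q - 1) * exp (- (\<bar>x\<bar> powr q)) \<le> 1"
    proof (cases "\<bar>x\<bar> \<le> 1")
      case True
      then have "\<bar>x\<bar> powr (q - 1) \<le> 1 powr (q - 1)"
        using conjugate_exponents[OF assms] by (intro powr_mono2) auto
      then show ?thesis by (intro mult_le_one) auto
    next
      case False
      then have "\<bar>x\<bar> powr (q - 1) \<le> \<bar>x\<bar> powr q" by (intro powr_mono) auto
      also have "\<dots> \<le> exp (\<bar>x\<bar> powr q)" using exp_ge_add_one_self[of "\<bar>x\<bar> powr q"] by linarith
      finally show ?thesis by (simp add: exp_minus field_simps)
    qed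
    then have "(q * a) * (\<bar>x\<bar> powr (q - 1) * exp (- (\<bar>x\<bar> powr q))) \<le> (q * a) * 1"
      using q_pos a_pos by (intro mult_left_mono) auto
    moreover have "\<bar>sgn x\<bar> * ((q * a) * (\<bar>x\<bar> powr (q - 1) * exp (- (\<bar>x\<bar> powr q)))) \<le> 1 * ((q * a) * (\<bar>x\<bar> powr (q - 1) * exp (- (\<bar>x\<bar> powr q))))"
      using q_pos a_pos by (intro mult_right_mono) (auto simp: abs_sgn_eq)
    ultimately show ?thesis using q_pos a_pos by (simp add: g_def abs_mult mult_ac)
  qed
  have "norm (g x - g y) \<le> (q * a) * norm (x - y)"
    by (rule field_differentiable_bound[OF convex_UNIV DERIV_g[OF assms]])
       (use bound in auto)
  then show ?thesis by simp
qed

lemma (in transport) h_star_eq: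
  "x \<in> \<Omega> \<Longrightarrow> h_star p \<alpha> \<Omega> f x = f x * (1 / (r_const p \<alpha> * g (W x))) powr (1 / \<alpha>)"
  by (simp add: h_star_def C_fun_eq)

lemma (in transport) continuous_on_h_star:
  assumes "0 < r_const p \<alpha>" "continuous_on \<Omega> f"
  shows "continuous_on \<Omega> (h_star p \<alpha> \<Omega> f)"
proof -
  have cg: "continuous_on UNIV g" by (auto intro!: continuous_at_imp_continuous_on isCont_g)
  have "continuous_on \<Omega> (\<lambda>x. g (W x))"
    by (rule continuous_on_compose2[OF cg continuous_on_W]) auto
  then have "continuous_on \<Omega> (\<lambda>x. f x * (1 / (r_const p \<alpha> * g (W x))) powr (1 / \<alpha>))"
    using assms g_pos
    by (intro continuous_on_mult continuous_on_powr continuous_on_divide continuous_on_const)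
       (auto simp: less_imp_neq[symmetric])
  then show ?thesis using h_star_eq continuous_on_cong by force
qed

text \<open>This makes the prescribed minimizer itself admissible in the Fisher inequality. Its
  coordinate has the derivative of \<open>W / ?r\<close>; hence its escort density is
  \<open>?r * g (?r * y + W c)\<close>, positive on the whole line and Lipschitz.\<close>

lemma (in transport) ac_on_escort_self:
  assumes p: "1 < p" and \<alpha>: "0 < \<alpha>" and r: "0 < r_const p \<alpha>" and c: "c \<in> \<Omega>" and cont: "continuous_on \<Omega> f"
  shows "ac_on UNIV (rel_escort \<alpha> \<Omega> (h_star p \<alpha> \<Omega> f) c f)"
proof -
  let ?r = "r_const p \<alpha>" and ?h = "h_star p \<alpha> \<Omega> f"
  interpret E: escort \<alpha> c xi xf \<Omega> f ?h
  proof
    show "0 < ?h x" if "x \<in> \<Omega>" for x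
      using f_pos[OF that] r g_pos[of "W x"] by (simp add: h_star_eq that)
  qed (use \<Omega>_eq c f_pos cont continuous_on_h_star[OF r cont] in auto)
  have u: "(f x / ?h x) powr \<alpha> = ?r * g (W x)" if "x \<in> \<Omega>" for x
    using f_pos[OF that] r g_pos[of "W x"] \<alpha> by (simp add: h_star_eq that powr_divide powr_powr)
  have deriv: "E.dcoord x = f x / g (W x) / ?r" if "x \<in> \<Omega>" for x
  proof -
    have "E.dcoord x * (?r * g (W x)) = f x"
      using E.dcoord_eq[OF that, symmetric] unfolding u[OF that] by (simp only: mult.commute)
    then show ?thesis
      using r g_pos[of "W x"] by (subst divide_divide_eq_left, subst nonzero_eq_divide_eq) (simp_all add: mult.commute)
  qed
  have coord: "E.coord x = (W x - W c) / ?r" if x: "x \<in> \<Omega>" for x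
  proof -
    have "\<exists>d. \<forall>x\<in>\<Omega>. E.coord x - W x / ?r = d"
    proof (rule has_field_derivative_zero_constant)
      show "convex \<Omega>" unfolding is_interval_convex_1[symmetric] is_interval_1 using \<Omega>_interval by blast
      fix z assume z: "z \<in> \<Omega>"
      have "((\<lambda>x. E.coord x - W x / ?r) has_real_derivative (E.dcoord z - f z / g (W z) / ?r)) (at z)"
        by (intro DERIV_diff E.DERIV_coord[OF z] DERIV_cdivide DERIV_W[OF cont z])
      then show "((\<lambda>x. E.coord x - W x / ?r) has_real_derivative 0) (at z within \<Omega>)"
        using deriv[OF z] by (simp add: has_field_derivative_at_within)
    qed
    then have "E.coord x - W x / ?r = E.coord c - W c / ?r" using x c by auto
    moreover have "E.coord c = 0" by (simp add: escort_coord_def)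
    ultimately show ?thesis by (simp add: diff_divide_distrib)
  qed
  have \<rho>: "E.\<rho> y = ?r * g (?r * y + W c)" for y
  proof -
    obtain x where x: "x \<in> \<Omega>" "W x = ?r * y + W c" using W_surj by blast
    then have "E.coord x = y" using r by (simp add: coord)
    with E.\<rho>_coord[OF x(1)] u[OF x(1)] x(2) show ?thesis by simp
  qed
  show ?thesis
  proof (rule ac_on_lipschitz)
    show "0 < ?r * ((q * a) * ?r)" using r q_pos a_pos by simp
    fix x y
    have "\<bar>E.\<rho> x - E.\<rho> y\<bar> = ?r * \<bar>g (?r * x + W c) - g (?r * y + W c)\<bar>"
      unfolding \<rho> right_diff_distrib[symmetric] abs_mult using r by simp
    also have "\<dots> \<le> ?r * ((q * a) * \<bar>(?r * x + W c) - (?r * y + W c)\<bar>)"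
      using r by (intro mult_left_mono lipschitz_g[OF p]) auto
    also have "(?r * x + W c) - (?r * y + W c) = ?r * (x - y)" by (simp add: right_diff_distrib)
    also have "\<bar>?r * (x - y)\<bar> = ?r * \<bar>x - y\<bar>" using r by (simp add: abs_mult)
    finally show "\<bar>E.\<rho> x - E.\<rho> y\<bar> \<le> ?r * ((q * a) * ?r) * \<bar>x - y\<bar>" by (simp add: mult_ac)
  qed
qed

section \<open>The Fisher inequality\<close>

context escort
begin

text \<open>As \<open>f\<close> is the escort density times the derivative of \<open>coord\<close>,
  the lower bound makes \<open>F - \<eta> * coord\<close> nondecreasing on the interval.\<close>

lemma mass_gain:
  assumes ab: "a \<in> \<Omega>" "b \<in> \<Omega>" "a \<le> b" and \<eta>: "\<And>s. a \<le> s \<Longrightarrow> s \<le> b \<Longrightarrow> \<eta> \<le> \<rho> (coord s)"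
    and F: "\<And>x. x \<in> \<Omega> \<Longrightarrow> (F has_real_derivative f x) (at x)"
  shows "\<eta> * (coord b - coord a) \<le> F b - F a"
proof -
  have "F a - \<eta> * coord a \<le> F b - \<eta> * coord b"
  proof (rule DERIV_nonneg_imp_nondecreasing[OF ab(3)])
    fix s assume s: "a \<le> s" "s \<le> b"
    then have s\<Omega>: "s \<in> \<Omega>" using interval_sub[OF ab(1,2)] by auto
    have "((\<lambda>s. F s - \<eta> * coord s) has_real_derivative f s - \<eta> * dcoord s) (at s)"
      by (intro DERIV_diff F s\<Omega> DERIV_cmult DERIV_coord)
    moreover have "\<eta> * dcoord s \<le> f s"
    proof -
      have "\<eta> * dcoord s \<le> \<rho> (coord s) * dcoord s"
        using \<eta>[OF s] dcoord_pos[OF s\<Omega>] by (intro mult_right_mono) auto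
      also have "\<dots> = f s" using dcoord_eq[OF s\<Omega>] by (simp only: \<rho>_coord[OF s\<Omega>])
      finally show ?thesis .
    qed
    ultimately show "\<exists>d. ((\<lambda>s. F s - \<eta> * coord s) has_real_derivative d) (at s) \<and> 0 \<le> d" by auto
  qed
  then show ?thesis by (simp add: algebra_simps)
qed

text \<open>Near a point where \<open>\<rho>\<close> is large, uniform continuity keeps it large, and in particular keeps
  the coordinate inside the range of \<open>coord\<close>.\<close>

lemma mass_near:
  assumes \<delta>: "0 < \<delta>" "\<And>s t. \<bar>s - t\<bar> < \<delta> \<Longrightarrow> \<bar>\<rho> s - \<rho> t\<bar> < \<epsilon>"
    and F: "\<And>x. x \<in> \<Omega> \<Longrightarrow> (F has_real_derivative f x) (at x)"
    and x: "x \<in> \<Omega>" "\<epsilon> < \<rho> (coord x)"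
  shows "\<exists>z\<in>\<Omega>. x < z \<and> (\<rho> (coord x) - \<epsilon>) * (\<delta> / 2) \<le> F z - F x"
    and "\<exists>z\<in>\<Omega>. z < x \<and> (\<rho> (coord x) - \<epsilon>) * (\<delta> / 2) \<le> F x - F z"
proof -
  have large: "\<rho> (coord x) - \<epsilon> \<le> \<rho> t" "0 < \<rho> t" if "\<bar>t - coord x\<bar> \<le> \<delta> / 2" for t
    using \<delta>(2)[of t "coord x"] that \<delta>(1) x(2) by auto
  have "coord x + \<delta> / 2 \<in> coord ` \<Omega>" using \<delta>(1) by (intro \<rho>_pos_imp large(2)) auto
  then obtain z where z: "z \<in> \<Omega>" "coord z = coord x + \<delta> / 2" by auto
  then have "x < z" using coord_le_iff[OF z(1) x(1)] \<delta>(1) by auto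
  moreover have "(\<rho> (coord x) - \<epsilon>) * (coord z - coord x) \<le> F z - F x"
  proof (rule mass_gain[OF x(1) z(1) _ _ F])
    fix s assume s: "x \<le> s" "s \<le> z"
    then have "s \<in> \<Omega>" using interval_sub[OF x(1) z(1)] by auto
    then have "coord x \<le> coord s" "coord s \<le> coord z"
      using s coord_le_iff[OF x(1)] coord_le_iff[OF _ z(1)] by blast+
    then show "\<rho> (coord x) - \<epsilon> \<le> \<rho> (coord s)" using z(2) by (intro large) auto
  qed (use \<open>x < z\<close> in auto)
  moreover have eq: "coord z - coord x = \<delta> / 2" using z(2) by linarith
  ultimately show "\<exists>z\<in>\<Omega>. x < z \<and> (\<rho> (coord x) - \<epsilon>) * (\<delta> / 2) \<le> F z - F x"
    using z(1) unfolding eq by blast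
  have "coord x - \<delta> / 2 \<in> coord ` \<Omega>" using \<delta>(1) by (intro \<rho>_pos_imp large(2)) auto
  then obtain z' where z': "z' \<in> \<Omega>" "coord z' = coord x - \<delta> / 2" by auto
  then have "z' < x" using coord_le_iff[OF x(1) z'(1)] \<delta>(1) by auto
  moreover have "(\<rho> (coord x) - \<epsilon>) * (coord x - coord z') \<le> F x - F z'"
  proof (rule mass_gain[OF z'(1) x(1) _ _ F])
    fix s assume s: "z' \<le> s" "s \<le> x"
    then have "s \<in> \<Omega>" using interval_sub[OF z'(1) x(1)] by auto
    then have "coord z' \<le> coord s" "coord s \<le> coord x"
      using s coord_le_iff[OF z'(1)] coord_le_iff[OF _ x(1)] by blast+
    then show "\<rho> (coord x) - \<epsilon> \<le> \<rho> (coord s)" using z'(2) by (intro large) auto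
  qed (use \<open>z' < x\<close> in auto)
  moreover have eq: "coord x - coord z' = \<delta> / 2" using z'(2) by linarith
  ultimately show "\<exists>z\<in>\<Omega>. z < x \<and> (\<rho> (coord x) - \<epsilon>) * (\<delta> / 2) \<le> F x - F z"
    using z'(1) unfolding eq by blast
qed

end

text \<open>The derivative need not be continuous or integrable. The gauge integral gives the
  increment without further conditions; it agrees with the Lebesgue integral when the right-hand
  side is finite, and otherwise the bound is trivial.\<close>

lemma abs_diff_le_nn_integral_deriv:
  fixes \<phi> \<phi>' :: "real \<Rightarrow> real"
  assumes "a \<le> b" and D: "\<And>x. a \<le> x \<Longrightarrow> x \<le> b \<Longrightarrow> (\<phi> has_real_derivative \<phi>' x) (at x)"
    and [measurable]: "\<phi>' \<in> borel_measurable borel"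
  shows "ennreal \<bar>\<phi> b - \<phi> a\<bar> \<le> (\<integral>\<^sup>+x\<in>{a..b}. ennreal \<bar>\<phi>' x\<bar> \<partial>lborel)"
proof (cases "(\<integral>\<^sup>+x\<in>{a..b}. ennreal \<bar>\<phi>' x\<bar> \<partial>lborel) = \<infinity>")
  case False
  have hi: "(\<phi>' has_integral (\<phi> b - \<phi> a)) {a..b}"
  proof (rule fundamental_theorem_of_calculus[OF assms(1)])
    fix x assume "x \<in> {a..b}"
    then have "(\<phi> has_real_derivative \<phi>' x) (at x)" by (intro D) auto
    then show "(\<phi> has_vector_derivative \<phi>' x) (at x within {a..b})"
      unfolding has_real_derivative_iff_has_vector_derivative by (rule has_vector_derivative_at_within)
  qed
  have fin: "(\<integral>\<^sup>+x\<in>{a..b}. ennreal \<bar>\<phi>' x\<bar> \<partial>lborel) < \<infinity>" using False by (simp add: less_top)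
  have si: "set_integrable lborel {a..b} (\<lambda>x. \<bar>\<phi>' x\<bar>)"
    by (rule set_integrable_of_nn_integral) (use fin in \<open>auto simp: set_borel_measurable_def\<close>)
  have si': "set_integrable lborel {a..b} \<phi>'"
    using si by (rule set_integrable_bound) (auto simp: set_borel_measurable_def)
  have "\<phi> b - \<phi> a = (LBINT x:{a..b}. \<phi>' x)"
    using set_borel_integral_eq_integral(2)[OF si'] integral_unique[OF hi] by simp
  also have "\<bar>\<dots>\<bar> \<le> (LBINT x:{a..b}. \<bar>\<phi>' x\<bar>)"
    using set_integral_norm_bound[OF si'] by simp
  finally show ?thesis
    using set_nn_integral_eq_set_integral[OF si] by (simp add: ennreal_leI)
qed simp

section \<open>Differentiable densities: the escort density in the original coordinate and its
  derivative\<close>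

locale adapted_smooth = adapted p q a \<Omega> f fs xi xf \<alpha>
  for p q a \<Omega> f fs xi xf \<alpha> +
  assumes p1: "1 < p" and diff_f: "f differentiable_on \<Omega>" and diff_fs: "fs differentiable_on \<Omega>"
begin

abbreviation h :: "real \<Rightarrow> real" where "h \<equiv> h_star p \<alpha> \<Omega> fs"

lemma h_eq: "x \<in> \<Omega> \<Longrightarrow> h x = fs x * C x powr (1 / \<alpha>)"
  by (simp add: h_star_def C_fun_C)

lemma h_pos: "x \<in> \<Omega> \<Longrightarrow> 0 < h x"
  using S.f_pos[of x] C_pos[of x] by (simp add: h_eq)

lemma cont_f: "continuous_on \<Omega> f" and cont_fs: "continuous_on \<Omega> fs"
  using diff_f diff_fs by (auto intro: differentiable_imp_continuous_on)

lemma cont_h: "continuous_on \<Omega> h"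
  by (rule S.continuous_on_h_star[OF r_pos cont_fs])

text \<open>\<open>h\<close> is spelled out through the global \<open>C\<close>, which makes
  \<open>u\<close> Borel on the whole line.\<close>

definition u :: "real \<Rightarrow> real" where "u x = (f x / (fs x * C x powr (1 / \<alpha>))) powr \<alpha>"

lemma borel_measurable_u [measurable]: "u \<in> borel_measurable borel"
  unfolding u_def[abs_def] by measurable

lemma u_h: "x \<in> \<Omega> \<Longrightarrow> u x = (f x / h x) powr \<alpha>"
  by (simp add: u_def h_eq)

lemma u_pos: "x \<in> \<Omega> \<Longrightarrow> 0 < u x"
  using f_pos[of x] h_pos[of x] by (simp add: u_h)

lemma ln_u: "x \<in> \<Omega> \<Longrightarrow> ln (u x) = \<alpha> * ln (f x / fs x) - ln (C x)"
  using f_pos[of x] S.f_pos[of x] C_pos[of x] \<alpha>_pos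
  by (simp add: u_def ln_powr ln_div ln_mult algebra_simps)

definition l :: "real \<Rightarrow> real" where "l x = ln (f x / h x)"

lemma u_l: "x \<in> \<Omega> \<Longrightarrow> u x = exp (\<alpha> * l x)"
  using f_pos[of x] h_pos[of x] by (simp add: u_h l_def powr_def)

lemma l_eq: "x \<in> \<Omega> \<Longrightarrow> l x = ln (f x) - ln (fs x) + (ln (r * a) - \<bar>S.W x\<bar> powr q) / \<alpha>"
  using f_pos[of x] S.f_pos[of x] C_pos[of x] ln_C[of x]
  by (simp add: l_def h_eq ln_div ln_mult ln_powr S.W0_eq diff_divide_distrib)

text \<open>The bound \<open>1 < q\<close> covers the point where \<open>S.W\<close>
  vanishes.\<close>

lemma DERIV_abs_W: "x \<in> \<Omega> \<Longrightarrow> ((\<lambda>x. \<bar>S.W x\<bar> powr q) has_real_derivative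
    q * \<bar>S.W x\<bar> powr (q - 1) * sgn (S.W x) * (fs x / g (S.W x))) (at x)"
  by (rule DERIV_chain2[OF DERIV_abs_powr S.DERIV_W]) (use conjugate_exponents[OF p1] cont_fs in auto)

lemma DERIV_l: assumes x: "x \<in> \<Omega>" shows "(l has_real_derivative deriv l x) (at x)"
proof -
  have D: "(\<phi> has_real_derivative deriv \<phi> x) (at x)" if "\<phi> differentiable_on \<Omega>" for \<phi> :: "real \<Rightarrow> real"
    using that[unfolded differentiable_on_def, rule_format, OF x]
    unfolding DERIV_deriv_iff_real_differentiable at_within_open[OF x open_\<Omega>] .
  have "((\<lambda>x. ln (f x) - ln (fs x) + (ln (r * a) - \<bar>S.W x\<bar> powr q) / \<alpha>) has_real_derivative
     inverse (f x) * deriv f x - inverse (fs x) * deriv fs x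
      + (0 - q * \<bar>S.W x\<bar> powr (q - 1) * sgn (S.W x) * (fs x / g (S.W x))) / \<alpha>) (at x)"
    by (intro DERIV_add DERIV_diff DERIV_cdivide DERIV_const DERIV_abs_W x
          DERIV_chain2[OF DERIV_ln] D diff_f diff_fs f_pos S.f_pos)
  then obtain d where
    "((\<lambda>x. ln (f x) - ln (fs x) + (ln (r * a) - \<bar>S.W x\<bar> powr q) / \<alpha>) has_real_derivative d) (at x)"
    by blast
  then have "(l has_real_derivative d) (at x)"
    by (rule has_field_derivative_transform_within_open[OF _ open_\<Omega> x]) (simp add: l_eq)
  from DERIV_imp_deriv[OF this] this show ?thesis by simp
qed

lemma DERIV_u: assumes x: "x \<in> \<Omega>" shows "(u has_real_derivative \<alpha> * u x * deriv l x) (at x)"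
proof -
  have "((\<lambda>x. exp (\<alpha> * l x)) has_real_derivative exp (\<alpha> * l x) * (\<alpha> * deriv l x)) (at x)"
    by (rule DERIV_chain2[OF DERIV_exp DERIV_cmult[OF DERIV_l[OF x]]])
  then have "(u has_real_derivative exp (\<alpha> * l x) * (\<alpha> * deriv l x)) (at x)"
    by (rule has_field_derivative_transform_within_open[OF _ open_\<Omega> x]) (simp add: u_l)
  then show ?thesis by (simp add: u_l[OF x] mult_ac)
qed

definition dl :: "real \<Rightarrow> real" where "dl x = indicator \<Omega> x * deriv l x"

lemma dl_eq: "x \<in> \<Omega> \<Longrightarrow> dl x = deriv l x"
  by (simp add: dl_def)

lemma borel_measurable_dl [measurable]: "dl \<in> borel_measurable borel"
proof -
  define l0 where "l0 x = ln (f x / (fs x * C x powr (1 / \<alpha>)))" for x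
  have [measurable]: "l0 \<in> borel_measurable borel" unfolding l0_def[abs_def] by measurable
  have l0: "l0 x = l x" if "x \<in> \<Omega>" for x using that by (simp add: l0_def l_def h_eq)
  show ?thesis
  proof (rule borel_measurable_LIMSEQ_real)
    show "(\<lambda>x. indicator \<Omega> x * ((l0 (x + inverse (real (Suc n))) - l0 x) / inverse (real (Suc n)))) \<in> borel_measurable borel" for n
      by measurable
    fix x
    show "(\<lambda>n. indicator \<Omega> x * ((l0 (x + inverse (real (Suc n))) - l0 x) / inverse (real (Suc n)))) \<longlonglongrightarrow> dl x"
    proof (cases "x \<in> \<Omega>")
      case True
      have lim: "filterlim (\<lambda>n. inverse (real (Suc n))) (at 0) sequentially"
        using LIMSEQ_inverse_real_of_nat by (auto simp: filterlim_at)
      have "((\<lambda>e. (l (x + e) - l x) / e) \<longlongrightarrow> deriv l x) (at 0)"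
        using DERIV_l[OF True] by (simp add: DERIV_def)
      from filterlim_compose[OF this lim]
      have "(\<lambda>n. (l (x + inverse (real (Suc n))) - l x) / inverse (real (Suc n))) \<longlonglongrightarrow> deriv l x" .
      moreover have "\<forall>\<^sub>F n in sequentially. x + inverse (real (Suc n)) \<in> \<Omega>"
      proof -
        have "(\<lambda>n. x + inverse (real (Suc n))) \<longlonglongrightarrow> x + 0"
          by (intro tendsto_add tendsto_const LIMSEQ_inverse_real_of_nat)
        then show ?thesis using topological_tendstoD[OF _ open_\<Omega>, of _ "x + 0"] True by simp
      qed
      then have "\<forall>\<^sub>F n in sequentially. (l (x + inverse (real (Suc n))) - l x) / inverse (real (Suc n)) =
          (l0 (x + inverse (real (Suc n))) - l0 x) / inverse (real (Suc n))"
        by eventually_elim (simp add: l0 True)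
      ultimately have "(\<lambda>n. (l0 (x + inverse (real (Suc n))) - l0 x) / inverse (real (Suc n))) \<longlonglongrightarrow> deriv l x"
        by (rule Lim_transform_eventually)
      then show ?thesis using True by (simp add: dl_eq)
    qed (simp add: dl_def)
  qed
qed

definition dW :: "real \<Rightarrow> real" where "dW x = f x / g (W0 x)"

lemma borel_measurable_dW [measurable]: "dW \<in> borel_measurable borel"
  using G.borel_measurable_density unfolding dW_def[abs_def] by measurable

lemma DERIV_W': "x \<in> \<Omega> \<Longrightarrow> (W has_real_derivative dW x) (at x)"
  using DERIV_W[OF cont_f] by (simp add: dW_def W0_eq)

lemma dW_nonneg: "0 \<le> dW x"
  using f_nonneg g_pos[of "W0 x"] by (simp add: dW_def)

end

context adapted_smooth
begin

lemma DERIV_F': "x \<in> \<Omega> \<Longrightarrow> (F has_real_derivative f x) (at x)"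
  by (rule DERIV_F[OF open_\<Omega> _ cont_f])

text \<open>On \<Omega> this is the modulus of the derivative of \<open>u\<close>, because there
  \<open>u = exp (\<alpha> * l)\<close>.\<close>

definition v :: "real \<Rightarrow> real" where "v x = \<alpha> * u x * \<bar>dl x\<bar>"

lemma borel_measurable_v [measurable]: "v \<in> borel_measurable borel"
  unfolding v_def[abs_def] by measurable

lemma v_nonneg: "0 \<le> v x"
  using \<alpha>_pos by (simp add: v_def u_def)

lemma interval_subset: "x \<in> \<Omega> \<Longrightarrow> z \<in> \<Omega> \<Longrightarrow> {x..z} \<subseteq> \<Omega>"
  by (rule subsetI, rule \<Omega>_interval[of x z]) auto

lemma u_diff_le:
  assumes "x \<in> \<Omega>" "z \<in> \<Omega>" "x \<le> z" "{x..z} \<subseteq> A" "A \<subseteq> \<Omega>"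
  shows "ennreal \<bar>u z - u x\<bar> \<le> (\<integral>\<^sup>+s\<in>A. ennreal (v s) \<partial>lborel)"
proof -
  have "ennreal \<bar>u z - u x\<bar> \<le> (\<integral>\<^sup>+s\<in>{x..z}. ennreal \<bar>\<alpha> * u s * dl s\<bar> \<partial>lborel)"
  proof (rule abs_diff_le_nn_integral_deriv[OF assms(3)])
    fix s assume "x \<le> s" "s \<le> z"
    then have "s \<in> \<Omega>" using assms(4,5) by auto
    then show "(u has_real_derivative \<alpha> * u s * dl s) (at s)" using DERIV_u by (simp add: dl_eq)
  qed measurable
  also have "\<dots> \<le> (\<integral>\<^sup>+s\<in>A. ennreal (v s) \<partial>lborel)"
    using assms(4) \<alpha>_pos
    by (intro nn_integral_mono) (auto simp: v_def abs_mult u_def split: split_indicator)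
  finally show ?thesis .
qed

lemma nn_integral_dW:
  assumes "x \<in> \<Omega>" "z \<in> \<Omega>" "x \<le> z"
  shows "(\<integral>\<^sup>+s\<in>{x..z}. ennreal (dW s) \<partial>lborel) = ennreal (W z - W x)"
  by (rule nn_integral_FTC_Icc)
     (use interval_subset[OF assms(1,2)] assms(3) in \<open>auto intro!: DERIV_W' dW_nonneg\<close>)

end

section \<open>Uniform continuity of the escort density: boundedness, decay at the ends, integration
  by parts\<close>

locale adapted_ac = adapted_smooth p q a \<Omega> f fs xi xf \<alpha>
  for p q a \<Omega> f fs xi xf \<alpha> +
  fixes c :: real
  assumes c: "c \<in> \<Omega>" and ac: "ac_on UNIV (rel_escort \<alpha> \<Omega> (h_star p \<alpha> \<Omega> fs) c f)"
begin

sublocale E: escort \<alpha> c xi xf \<Omega> f "h_star p \<alpha> \<Omega> fs"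
  by (intro escort.intro \<Omega>_eq c f_pos h_pos cont_f cont_h)

lemma \<rho>_u: "x \<in> \<Omega> \<Longrightarrow> E.\<rho> (E.coord x) = u x"
  by (simp add: E.\<rho>_coord u_h)

text \<open>If \<open>u x > 1 + 2 / \<delta>\<close>, the escort density stays above
  \<open>2 / \<delta>\<close> on a stretch of coordinate length \<open>\<delta> / 2\<close>, which
  would carry mass above 1.\<close>

lemma u_bounded: "\<exists>B. \<forall>x\<in>\<Omega>. u x \<le> B"
proof -
  obtain \<delta> where \<delta>: "0 < \<delta>" "\<And>x y. \<bar>x - y\<bar> < \<delta> \<Longrightarrow> \<bar>E.\<rho> x - E.\<rho> y\<bar> < 1"
    using ac_on_uniform[OF ac zero_less_one] by blast
  have "u x \<le> 1 + 2 / \<delta>" if x: "x \<in> \<Omega>" for x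
  proof (rule ccontr)
    assume "\<not> ?thesis"
    then have big: "1 + 2 / \<delta> < u x" by simp
    moreover have "0 < 2 / \<delta>" using \<delta>(1) by simp
    ultimately have "1 < E.\<rho> (E.coord x)" unfolding \<rho>_u[OF x] by linarith
    from E.mass_near(1)[OF \<delta> DERIV_F' x this]
    obtain z where "(u x - 1) * (\<delta> / 2) \<le> F z - F x" unfolding \<rho>_u[OF x] by blast
    also have "\<dots> \<le> 1" using cdf_bounded_prob[of z] cdf_nonneg[of x] by linarith
    finally have "u x - 1 \<le> 2 / \<delta>" using \<delta>(1) by (simp add: field_simps)
    with big show False by linarith
  qed
  then show ?thesis by blast
qed

text \<open>A point where \<open>u\<close> exceeds \<open>2 * \<eta>\<close> has more than mass
  \<open>t\<close> on either side of it, while only mass \<open>t\<close> remains beyond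
  \<open>z\<close>.\<close>

lemma u_decay:
  assumes \<eta>: "0 < \<eta>"
  shows "\<exists>z\<in>\<Omega>. \<forall>x\<in>\<Omega>. z \<le> x \<longrightarrow> u x \<le> 2 * \<eta>" "\<exists>z\<in>\<Omega>. \<forall>x\<in>\<Omega>. x \<le> z \<longrightarrow> u x \<le> 2 * \<eta>"
proof -
  obtain \<delta> where \<delta>: "0 < \<delta>" "\<And>x y. \<bar>x - y\<bar> < \<delta> \<Longrightarrow> \<bar>E.\<rho> x - E.\<rho> y\<bar> < \<eta>"
    using ac_on_uniform[OF ac \<eta>] by blast
  \<comment> \<open>Half of the mass \<open>\<eta> * (\<delta> / 2)\<close> that a value above
    \<open>2 * \<eta>\<close> brings, capped so that both \<open>t\<close> and \<open>1 - t\<close>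
    are values of \<open>F\<close> on \<Omega>.\<close>
  define t where "t = min (1 / 2) (\<eta> * \<delta> / 4)"
  have t: "0 < t" "t < 1" "t < \<eta> * (\<delta> / 2)" using \<eta> \<delta>(1) by (auto simp: t_def min_def)
  have gain: "t < (u x - \<eta>) * (\<delta> / 2)" "\<eta> < E.\<rho> (E.coord x)" if "x \<in> \<Omega>" "2 * \<eta> < u x" for x
  proof -
    have "\<eta> * (\<delta> / 2) < (u x - \<eta>) * (\<delta> / 2)" using that(2) \<delta>(1) by (intro mult_strict_right_mono) auto
    with t(3) show "t < (u x - \<eta>) * (\<delta> / 2)" by linarith
    show "\<eta> < E.\<rho> (E.coord x)" using that(2) \<eta> unfolding \<rho>_u[OF that(1)] by linarith
  qed
  obtain z where z: "z \<in> \<Omega>" "F z = 1 - t" using F_surj[of "1 - t"] t by auto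
  have "u x \<le> 2 * \<eta>" if x: "x \<in> \<Omega>" "z \<le> x" for x
  proof (rule ccontr)
    assume "\<not> ?thesis"
    then have big: "2 * \<eta> < u x" by simp
    from E.mass_near(1)[OF \<delta> DERIV_F' x(1) gain(2)[OF x(1) big]]
    obtain z' where "(u x - \<eta>) * (\<delta> / 2) \<le> F z' - F x" unfolding \<rho>_u[OF x(1)] by blast
    then show False
      using gain(1)[OF x(1) big] cdf_bounded_prob[of z'] cdf_nondecreasing[OF x(2)] z(2) by linarith
  qed
  with z(1) show "\<exists>z\<in>\<Omega>. \<forall>x\<in>\<Omega>. z \<le> x \<longrightarrow> u x \<le> 2 * \<eta>" by blast
  obtain z where z: "z \<in> \<Omega>" "F z = t" using F_surj[of t] t by auto
  have "u x \<le> 2 * \<eta>" if x: "x \<in> \<Omega>" "x \<le> z" for x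
  proof (rule ccontr)
    assume "\<not> ?thesis"
    then have big: "2 * \<eta> < u x" by simp
    from E.mass_near(2)[OF \<delta> DERIV_F' x(1) gain(2)[OF x(1) big]]
    obtain z' where "(u x - \<eta>) * (\<delta> / 2) \<le> F x - F z'" unfolding \<rho>_u[OF x(1)] by blast
    then show False
      using gain(1)[OF x(1) big] cdf_nonneg[of z'] cdf_nondecreasing[OF x(2)] z(2) by linarith
  qed
  with z(1) show "\<exists>z\<in>\<Omega>. \<forall>x\<in>\<Omega>. x \<le> z \<longrightarrow> u x \<le> 2 * \<eta>" by blast
qed

text \<open>Since \<open>u\<close> becomes arbitrarily small towards either end of \<Omega>, its
  value is at most its variation on either side.\<close>

lemma u_le_tail:
  assumes x: "x \<in> \<Omega>"
  shows "ennreal (u x) \<le> (\<integral>\<^sup>+s\<in>\<Omega> \<inter> {x..}. ennreal (v s) \<partial>lborel)"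
    and "ennreal (u x) \<le> (\<integral>\<^sup>+s\<in>\<Omega> \<inter> {..x}. ennreal (v s) \<partial>lborel)"
proof -
  have step: "ennreal (u x) \<le> N + ennreal e"
    if "ennreal \<bar>u x' - u x\<bar> \<le> N" "u x' \<le> e" "x' \<in> \<Omega>" for x' e N
  proof -
    have "ennreal (u x) \<le> ennreal (\<bar>u x' - u x\<bar> + u x')" by (intro ennreal_leI) linarith
    also have "\<dots> = ennreal \<bar>u x' - u x\<bar> + ennreal (u x')" using u_pos[OF that(3)] by (intro ennreal_plus) auto
    also have "\<dots> \<le> N + ennreal e" using that by (intro add_mono ennreal_leI) auto
    finally show ?thesis .
  qed
  show "ennreal (u x) \<le> (\<integral>\<^sup>+s\<in>\<Omega> \<inter> {x..}. ennreal (v s) \<partial>lborel)"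
  proof (rule ennreal_le_epsilon)
    fix e :: real assume "0 < e"
    then obtain z where z: "z \<in> \<Omega>" "\<And>x. x \<in> \<Omega> \<Longrightarrow> z \<le> x \<Longrightarrow> u x \<le> e"
      using u_decay(1)[of "e / 2"] by auto
    have mem: "max x z \<in> \<Omega>" using x z by (auto simp: max_def)
    show "ennreal (u x) \<le> (\<integral>\<^sup>+s\<in>\<Omega> \<inter> {x..}. ennreal (v s) \<partial>lborel) + ennreal e"
      by (rule step[of "max x z"], rule u_diff_le[OF x mem])
         (use interval_subset[OF x mem] z(2)[OF mem] mem in auto)
  qed
  show "ennreal (u x) \<le> (\<integral>\<^sup>+s\<in>\<Omega> \<inter> {..x}. ennreal (v s) \<partial>lborel)"
  proof (rule ennreal_le_epsilon)
    fix e :: real assume "0 < e"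
    then obtain z where z: "z \<in> \<Omega>" "\<And>x. x \<in> \<Omega> \<Longrightarrow> x \<le> z \<Longrightarrow> u x \<le> e"
      using u_decay(2)[of "e / 2"] by auto
    have mem: "min x z \<in> \<Omega>" using x z by (auto simp: min_def)
    show "ennreal (u x) \<le> (\<integral>\<^sup>+s\<in>\<Omega> \<inter> {..x}. ennreal (v s) \<partial>lborel) + ennreal e"
      by (rule step[of "min x z"], subst abs_minus_commute, rule u_diff_le[OF mem x])
         (use interval_subset[OF mem x] z(2)[OF mem] mem in auto)
  qed
qed

text \<open>Integration by parts for \<open>\<integral> u dW\<close>, in the form of Tonelli's theorem: \<open>u\<close> is bounded by its
  variation towards the end of \<open>\<Omega>\<close> on the far side of the zero of \<open>W\<close>.\<close>

lemma nn_integral_u_dW_le: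
  "(\<integral>\<^sup>+x\<in>\<Omega>. ennreal (u x * dW x) \<partial>lborel) \<le> (\<integral>\<^sup>+s\<in>\<Omega>. ennreal (v s * \<bar>W0 s\<bar>) \<partial>lborel)"
proof -
  obtain m0 where m0: "m0 \<in> \<Omega>" "W m0 = 0" using W_surj by blast
  \<comment> \<open>\<open>K x s\<close> says that \<open>x\<close> lies between \<open>m0\<close>
    and \<open>s\<close>. As a condition on \<open>s\<close> it selects the part of \<Omega> beyond
    \<open>x\<close>, seen from \<open>m0\<close>; as a condition on \<open>x\<close> it selects the
    range on which \<open>W\<close> runs between 0 and \<open>W s\<close>.\<close>
  define K :: "real \<Rightarrow> real \<Rightarrow> ennreal"
    where "K x s = (if (m0 \<le> x \<and> x \<le> s) \<or> (s \<le> x \<and> x \<le> m0) then 1 else 0)" for x s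
  have [measurable]: "(\<lambda>(x, s). K x s) \<in> borel_measurable (borel \<Otimes>\<^sub>M borel)"
    unfolding K_def by measurable
  have 1: "ennreal (u x) \<le> (\<integral>\<^sup>+s. ennreal (v s) * indicator \<Omega> s * K x s \<partial>lborel)" if x: "x \<in> \<Omega>" for x
  proof (cases "m0 \<le> x")
    case True
    have "(\<integral>\<^sup>+s\<in>\<Omega> \<inter> {x..}. ennreal (v s) \<partial>lborel) \<le> (\<integral>\<^sup>+s. ennreal (v s) * indicator \<Omega> s * K x s \<partial>lborel)"
      using True by (intro nn_integral_mono) (auto simp: K_def split: split_indicator)
    with u_le_tail(1)[OF x] show ?thesis by (rule order_trans)
  next
    case False
    have "(\<integral>\<^sup>+s\<in>\<Omega> \<inter> {..x}. ennreal (v s) \<partial>lborel) \<le> (\<integral>\<^sup>+s. ennreal (v s) * indicator \<Omega> s * K x s \<partial>lborel)"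
      using False by (intro nn_integral_mono) (auto simp: K_def split: split_indicator)
    with u_le_tail(2)[OF x] show ?thesis by (rule order_trans)
  qed
  have 2: "(\<integral>\<^sup>+x. K x s * (ennreal (dW x) * indicator \<Omega> x) \<partial>lborel) \<le> ennreal \<bar>W0 s\<bar>" if s: "s \<in> \<Omega>" for s
  proof (cases "m0 \<le> s")
    case True
    have "(\<integral>\<^sup>+x. K x s * (ennreal (dW x) * indicator \<Omega> x) \<partial>lborel) \<le> (\<integral>\<^sup>+x\<in>{m0..s}. ennreal (dW x) \<partial>lborel)"
      using True by (intro nn_integral_mono) (auto simp: K_def split: split_indicator)
    also have "\<dots> = ennreal (W s)" using nn_integral_dW[OF m0(1) s True] m0 by simp
    also have "\<dots> \<le> ennreal \<bar>W0 s\<bar>" using s by (intro ennreal_leI) (simp add: W0_eq)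
    finally show ?thesis .
  next
    case False
    have "(\<integral>\<^sup>+x. K x s * (ennreal (dW x) * indicator \<Omega> x) \<partial>lborel) \<le> (\<integral>\<^sup>+x\<in>{s..m0}. ennreal (dW x) \<partial>lborel)"
      using False by (intro nn_integral_mono) (auto simp: K_def split: split_indicator)
    also have "\<dots> = ennreal (- W s)" using nn_integral_dW[OF s m0(1)] False m0 by simp
    also have "\<dots> \<le> ennreal \<bar>W0 s\<bar>" using s by (intro ennreal_leI) (simp add: W0_eq)
    finally show ?thesis .
  qed
  let ?v = "\<lambda>s. ennreal (v s) * indicator \<Omega> s" and ?w = "\<lambda>x. ennreal (dW x) * indicator \<Omega> x"
  have "(\<integral>\<^sup>+x\<in>\<Omega>. ennreal (u x * dW x) \<partial>lborel) \<le> (\<integral>\<^sup>+x. (\<integral>\<^sup>+s. ?v s * K x s \<partial>lborel) * ?w x \<partial>lborel)"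
  proof (intro nn_integral_mono)
    fix x
    show "ennreal (u x * dW x) * indicator \<Omega> x \<le> (\<integral>\<^sup>+s. ?v s * K x s \<partial>lborel) * ?w x"
    proof (cases "x \<in> \<Omega>")
      case True
      then have "ennreal (u x * dW x) = ennreal (u x) * ennreal (dW x)"
        using u_pos[OF True] by (intro ennreal_mult') auto
      also have "\<dots> \<le> (\<integral>\<^sup>+s. ?v s * K x s \<partial>lborel) * ennreal (dW x)"
        by (intro mult_right_mono 1 True) auto
      finally show ?thesis using True by simp
    qed simp
  qed
  also have "\<dots> = (\<integral>\<^sup>+x. (\<integral>\<^sup>+s. ?v s * K x s * ?w x \<partial>lborel) \<partial>lborel)"
    by (intro nn_integral_cong nn_integral_multc[symmetric]) measurable
  also have "\<dots> = (\<integral>\<^sup>+s. (\<integral>\<^sup>+x. ?v s * K x s * ?w x \<partial>lborel) \<partial>lborel)"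
    by (rule lborel_pair.Fubini') measurable
  also have "\<dots> = (\<integral>\<^sup>+s. ?v s * (\<integral>\<^sup>+x. K x s * ?w x \<partial>lborel) \<partial>lborel)"
    unfolding mult.assoc[of "?v _"] by (intro nn_integral_cong nn_integral_cmult) measurable
  also have "\<dots> \<le> (\<integral>\<^sup>+s\<in>\<Omega>. ennreal (v s * \<bar>W0 s\<bar>) \<partial>lborel)"
  proof (intro nn_integral_mono)
    fix s
    show "?v s * (\<integral>\<^sup>+x. K x s * ?w x \<partial>lborel) \<le> ennreal (v s * \<bar>W0 s\<bar>) * indicator \<Omega> s"
    proof (cases "s \<in> \<Omega>")
      case True
      have "ennreal (v s) * (\<integral>\<^sup>+x. K x s * ?w x \<partial>lborel) \<le> ennreal (v s) * ennreal \<bar>W0 s\<bar>"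
        by (intro mult_left_mono 2 True) auto
      then show ?thesis using True by (simp add: ennreal_mult' v_nonneg)
    qed simp
  qed
  finally show ?thesis .
qed

end

section \<open>Hoelder's and Jensen's inequalities, and the case of equality\<close>

context transport
begin

lemma nn_integral_moment_W: "(\<integral>\<^sup>+x\<in>\<Omega>. ennreal (\<bar>W0 x\<bar> powr q * f x) \<partial>lborel) = ennreal (1 / q)"
proof -
  have "(\<integral>\<^sup>+x\<in>\<Omega>. ennreal (\<bar>W0 x\<bar> powr q * f x) \<partial>lborel) = (\<integral>\<^sup>+x\<in>\<Omega>. ennreal (f x) * ennreal (\<bar>W x\<bar> powr q) \<partial>lborel)"
    by (intro nn_integral_cong) (auto simp: W0_eq ennreal_mult'[OF f_nonneg] mult.commute split: split_indicator)
  also have "\<dots> = (\<integral>\<^sup>+t. ennreal (g t) * ennreal (\<bar>t\<bar> powr q) \<partial>lborel)"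
    by (rule nn_integral_transport) measurable
  also have "\<dots> = (\<integral>\<^sup>+t. ennreal (\<bar>t\<bar> powr q * g t) \<partial>lborel)"
    by (intro nn_integral_cong) (simp add: ennreal_mult'[OF less_imp_le[OF g_pos]] mult.commute)
  also have "\<dots> = ennreal (1 / q)" by (rule nn_integral_moment)
  finally show ?thesis .
qed

lemma set_integrable_moment_W: "set_integrable lborel \<Omega> (\<lambda>x. \<bar>W0 x\<bar> powr q * f x)"
  by (rule set_integrable_of_nn_integral)
     (use f_nonneg in \<open>auto simp: nn_integral_moment_W set_borel_measurable_def\<close>)

lemma set_integral_moment_W: "(LBINT x:\<Omega>. \<bar>W0 x\<bar> powr q * f x) = 1 / q"
proof -
  have "0 \<le> (LBINT x:\<Omega>. \<bar>W0 x\<bar> powr q * f x)"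
    unfolding set_lebesgue_integral_def using f_nonneg by (auto intro!: Bochner_Integration.integral_nonneg)
  then show ?thesis
    using nn_integral_moment_W set_nn_integral_eq_set_integral[OF set_integrable_moment_W] f_nonneg q_pos
    by (simp del: set_integral_mult_left)
qed

end

context adapted_smooth
begin

text \<open>On \<Omega> this is the modulus of the logarithmic derivative of the escort density in
  its own coordinate, divided by \<alpha>: by mass conservation that logarithmic derivative is
  \<open>\<alpha> * u * dl / f\<close>.\<close>

definition A :: "real \<Rightarrow> real" where "A x = \<bar>dl x\<bar> * u x / f x"

lemma borel_measurable_A [measurable]: "A \<in> borel_measurable borel"
  unfolding A_def[abs_def] by measurable

lemma A_nonneg: "0 \<le> A x"
  using f_nonneg by (simp add: A_def u_def)

definition X :: ennreal where "X = (\<integral>\<^sup>+x\<in>\<Omega>. ennreal (A x powr p * f x) \<partial>lborel)"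

lemma rel_fisher_eq: "rel_fisher p \<alpha> \<Omega> f h = enn_powr X (1 / (p * \<alpha>))"
proof -
  have "f x powr (1 + p * (\<alpha> - 1)) * h x powr (- \<alpha> * p) * \<bar>deriv (\<lambda>t. ln (f t / h t)) x\<bar> powr p = A x powr p * f x"
    if x: "x \<in> \<Omega>" for x
  proof -
    have pos: "0 < f x" "0 < h x" using f_pos[OF x] h_pos[OF x] by auto
    have dl: "deriv (\<lambda>t. ln (f t / h t)) x = dl x" using x by (simp add: dl_eq l_def[abs_def])
    have "f x powr (1 + p * (\<alpha> - 1)) = f x * f x powr (\<alpha> * p) / f x powr p"
      using pos by (simp add: powr_add powr_diff right_diff_distrib mult.commute)
    moreover have "A x powr p = \<bar>dl x\<bar> powr p * (f x powr (\<alpha> * p) / h x powr (\<alpha> * p)) / f x powr p"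
      using pos by (simp add: A_def u_h[OF x] powr_mult powr_divide powr_powr)
    moreover have "h x powr (- \<alpha> * p) = 1 / h x powr (\<alpha> * p)"
      by (simp add: powr_minus_divide)
    ultimately show ?thesis unfolding dl by (simp add: mult_ac)
  qed
  then have "(\<integral>\<^sup>+x\<in>\<Omega>. ennreal (f x powr (1 + p * (\<alpha> - 1)) * h x powr (- \<alpha> * p) *
      \<bar>deriv (\<lambda>t. ln (f t / h t)) x\<bar> powr p) \<partial>lborel) = X"
    unfolding X_def by (intro nn_integral_cong) (auto split: split_indicator)
  then show ?thesis by (simp add: rel_fisher_def)
qed

text \<open>Young's inequality for \<open>A\<close> and \<open>W0\<close>, each divided by its norm
  or a bound of it; \<open>(1 / q) powr (1 / q)\<close> is the \<open>q\<close>-norm of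
  \<open>W0\<close> under \<open>f\<close>. An upper bound \<open>x\<close> stands in for
  \<open>X\<close>, so that the case \<open>X = 0\<close> can be treated by letting \<open>x\<close>
  be small.\<close>

lemma holder:
  assumes x: "0 < x" "X \<le> ennreal x"
  shows "(\<integral>\<^sup>+s\<in>\<Omega>. ennreal (v s * \<bar>W0 s\<bar>) \<partial>lborel) \<le> ennreal (\<alpha> * (x powr (1 / p) * (1 / q) powr (1 / q)))"
proof -
  define K where "K = x powr (1 / p) * (1 / q) powr (1 / q)"
  have K: "0 < K" using x q_pos by (simp add: K_def)
  note pq = conjugate_exponents[OF p1]
  have pt: "v s * \<bar>W0 s\<bar> \<le> \<alpha> * K / (p * x) * (A s powr p * f s) + \<alpha> * K * (\<bar>W0 s\<bar> powr q * f s)" if s: "s \<in> \<Omega>" for s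
  proof -
    have "A s / x powr (1 / p) * (\<bar>W0 s\<bar> / (1 / q) powr (1 / q))
        \<le> (A s / x powr (1 / p)) powr p / p + (\<bar>W0 s\<bar> / (1 / q) powr (1 / q)) powr q / q"
      using p1 pq A_nonneg x by (intro Youngs_inequality) auto
    also have "\<dots> = A s powr p / (p * x) + \<bar>W0 s\<bar> powr q"
      using A_nonneg x p1 q_pos by (simp add: powr_divide powr_mult powr_powr mult.commute)
    finally have "A s * \<bar>W0 s\<bar> / K \<le> A s powr p / (p * x) + \<bar>W0 s\<bar> powr q"
      by (simp add: K_def)
    then have "A s * \<bar>W0 s\<bar> \<le> (A s powr p / (p * x) + \<bar>W0 s\<bar> powr q) * K"
      using K by (simp add: pos_divide_le_eq)
    then have "(\<alpha> * f s) * (A s * \<bar>W0 s\<bar>) \<le> (\<alpha> * f s) * ((A s powr p / (p * x) + \<bar>W0 s\<bar> powr q) * K)"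
      using \<alpha>_pos f_nonneg by (intro mult_left_mono) auto
    also have "(\<alpha> * f s) * (A s * \<bar>W0 s\<bar>) = v s * \<bar>W0 s\<bar>"
      using f_pos[OF s] by (simp add: A_def v_def)
    finally show ?thesis by (simp add: algebra_simps)
  qed
  have nn: "0 \<le> \<alpha> * K / (p * x)" "0 \<le> \<alpha> * K" using \<alpha>_pos K p1 x by auto
  have "(\<integral>\<^sup>+s\<in>\<Omega>. ennreal (v s * \<bar>W0 s\<bar>) \<partial>lborel)
      \<le> (\<integral>\<^sup>+s. ennreal (\<alpha> * K / (p * x)) * (ennreal (A s powr p * f s) * indicator \<Omega> s)
           + ennreal (\<alpha> * K) * (ennreal (\<bar>W0 s\<bar> powr q * f s) * indicator \<Omega> s) \<partial>lborel)"
  proof (intro nn_integral_mono)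
    fix s
    show "ennreal (v s * \<bar>W0 s\<bar>) * indicator \<Omega> s \<le> ennreal (\<alpha> * K / (p * x)) * (ennreal (A s powr p * f s) * indicator \<Omega> s)
           + ennreal (\<alpha> * K) * (ennreal (\<bar>W0 s\<bar> powr q * f s) * indicator \<Omega> s)"
    proof (cases "s \<in> \<Omega>")
      case True
      have "ennreal (v s * \<bar>W0 s\<bar>) \<le> ennreal (\<alpha> * K / (p * x) * (A s powr p * f s) + \<alpha> * K * (\<bar>W0 s\<bar> powr q * f s))"
        by (rule ennreal_leI[OF pt[OF True]])
      also have "\<dots> = ennreal (\<alpha> * K / (p * x) * (A s powr p * f s)) + ennreal (\<alpha> * K * (\<bar>W0 s\<bar> powr q * f s))"
        by (intro ennreal_plus mult_nonneg_nonneg[OF nn(1)] mult_nonneg_nonneg[OF nn(2)]) (simp_all add: f_nonneg)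
      also have "\<dots> = ennreal (\<alpha> * K / (p * x)) * ennreal (A s powr p * f s) + ennreal (\<alpha> * K) * ennreal (\<bar>W0 s\<bar> powr q * f s)"
        by (simp only: ennreal_mult'[OF nn(1)] ennreal_mult'[OF nn(2)])
      finally show ?thesis using True by simp
    qed simp
  qed
  also have "\<dots> = ennreal (\<alpha> * K / (p * x)) * X + ennreal (\<alpha> * K) * ennreal (1 / q)"
    by (subst nn_integral_add, measurable, subst (1 2) nn_integral_cmult, measurable)
       (simp add: X_def nn_integral_moment_W)
  also have "\<dots> \<le> ennreal (\<alpha> * K / (p * x)) * ennreal x + ennreal (\<alpha> * K) * ennreal (1 / q)"
    by (intro add_right_mono mult_left_mono x) auto
  also have "\<dots> = ennreal (\<alpha> * K / (p * x) * x + \<alpha> * K * (1 / q))"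
    unfolding ennreal_mult'[OF nn(1), symmetric] ennreal_mult'[OF nn(2), symmetric]
    by (intro ennreal_plus[symmetric] mult_nonneg_nonneg[OF nn(1)] mult_nonneg_nonneg[OF nn(2)])
       (use x q_pos in auto)
  also have "\<alpha> * K / (p * x) * x + \<alpha> * K * (1 / q) = \<alpha> * K * (1 / p + 1 / q)"
    using x by (simp add: distrib_left)
  also have "\<dots> = \<alpha> * K" using pq by simp
  finally show ?thesis by (simp add: K_def)
qed

definition V :: "real \<Rightarrow> real" where "V x = u x / g (W x)"

lemma V_pos: "x \<in> \<Omega> \<Longrightarrow> 0 < V x"
  using u_pos[of x] g_pos[of "W x"] by (simp add: V_def)

lemma u_dW: "x \<in> \<Omega> \<Longrightarrow> u x * dW x = f x * V x"
  by (simp add: dW_def V_def W0_eq)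

lemma cont_V: "continuous_on \<Omega> V"
proof -
  have "continuous_on \<Omega> u" using DERIV_u DERIV_isCont by (blast intro: continuous_at_imp_continuous_on)
  moreover have "continuous_on UNIV g" by (auto intro!: continuous_at_imp_continuous_on isCont_g)
  then have "continuous_on \<Omega> (\<lambda>x. g (W x))" by (rule continuous_on_compose2[OF _ continuous_on_W]) auto
  ultimately show ?thesis
    unfolding V_def[abs_def] using g_pos by (intro continuous_on_divide) (auto simp: less_imp_neq[symmetric])
qed

definition B :: ennreal where "B = (\<integral>\<^sup>+x\<in>\<Omega>. ennreal (u x * dW x) \<partial>lborel)"

lemma B_pos: "B \<noteq> 0"
proof
  assume "B = 0"
  then have "\<exists>x\<in>\<Omega>. ennreal (u x * dW x) = 0"
    unfolding B_def using W_surj by (intro nn_integral_zero_witness[where A = \<Omega>]) auto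
  then obtain x where x: "x \<in> \<Omega>" "ennreal (u x * dW x) = 0" by blast
  moreover have "0 < f x * V x" using f_pos[OF x(1)] V_pos[OF x(1)] by simp
  ultimately show False by (simp add: u_dW ennreal_eq_0_iff)
qed

text \<open>The inequality \<open>ln t \<le> t - 1\<close> at \<open>t = V x / b\<close>, where
  \<open>b\<close> is the integral of \<open>f * V\<close>, gives Jensen's inequality with the
  integral of the nonnegative \<open>T\<close> as its deficit.\<close>

lemma jensen:
  assumes D: "D \<noteq> \<infinity>" and L: "L \<noteq> \<infinity>" and b: "B = ennreal b" "0 < b"
  shows "\<alpha> * real_of_ereal D - real_of_ereal L \<le> ln a - 1 / q + ln b"
    and "\<alpha> * real_of_ereal D - real_of_ereal L = ln a - 1 / q + ln b \<Longrightarrow> \<forall>x\<in>\<Omega>. u x = b * g (W x)"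
proof -
  note int_D = D_finite[OF D] and int_L = L_finite[OF L]
  have nonneg: "0 \<le> u x * dW x" for x using dW_nonneg by (simp add: u_def)
  have int_u: "set_integrable lborel \<Omega> (\<lambda>x. u x * dW x)"
    by (rule set_integrable_of_nn_integral)
       (use b nonneg in \<open>auto simp: B_def intro!: set_borel_measurable_\<Omega>\<close>)
  have int_u_eq: "(LBINT x:\<Omega>. u x * dW x) = b"
  proof -
    have "0 \<le> (LBINT x:\<Omega>. u x * dW x)"
      unfolding set_lebesgue_integral_def using nonneg by (auto intro!: Bochner_Integration.integral_nonneg)
    then show ?thesis
      using b nonneg set_nn_integral_eq_set_integral[OF int_u] by (simp add: B_def)
  qed
  \<comment> \<open>On \<Omega>, \<open>T1\<close> is \<open>f * (V / b - 1)\<close>,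
    \<open>T2\<close> is \<open>f * ln u\<close> and \<open>T3\<close> is
    \<open>f * ln (b * g (W))\<close>; each is integrable with a known integral.\<close>
  define T1 where "T1 x = (u x * dW x) / b - f x" for x
  define T2 where "T2 x = \<alpha> * (f x * ln (f x / fs x)) - f x * ln (C x)" for x
  define T3 where "T3 x = (ln a + ln b) * f x - \<bar>W0 x\<bar> powr q * f x" for x
  have T1: "set_integrable lborel \<Omega> T1" "(LBINT x:\<Omega>. T1 x) = 0"
    unfolding T1_def[abs_def] using int_u set_integrable_\<Omega> b int_u_eq
    by (auto simp: set_integral_diff set_integral_\<Omega>)
  have T2: "set_integrable lborel \<Omega> T2" "(LBINT x:\<Omega>. T2 x) = \<alpha> * real_of_ereal D - real_of_ereal L"
    unfolding T2_def[abs_def] using int_D int_L by (auto simp: set_integral_diff)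
  have T3: "set_integrable lborel \<Omega> T3" "(LBINT x:\<Omega>. T3 x) = ln a + ln b - 1 / q"
    unfolding T3_def[abs_def] using set_integrable_\<Omega> set_integrable_moment_W
    by (auto simp: set_integral_diff set_integral_\<Omega> set_integral_moment_W)
  define T where "T x = T1 x - (T2 x - T3 x)" for x
  have T: "set_integrable lborel \<Omega> T"
    "(LBINT x:\<Omega>. T x) = - (\<alpha> * real_of_ereal D - real_of_ereal L - (ln a + ln b - 1 / q))"
    unfolding T_def[abs_def] using T1 T2 T3 by (auto simp: set_integral_diff)
  have T_eq: "T x = f x * (V x / b - 1 - ln (V x / b))" if x: "x \<in> \<Omega>" for x
  proof -
    have "ln (V x / b) = ln (u x) - (ln a - \<bar>W0 x\<bar> powr q) - ln b"
      using u_pos[OF x] g_pos[of "W x"] b by (simp add: V_def ln_div ln_mult ln_g W0_eq[OF x])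
    then have "ln (V x / b) = (\<alpha> * ln (f x / fs x) - ln (C x)) - (ln a - \<bar>W0 x\<bar> powr q) - ln b"
      unfolding ln_u[OF x] .
    then show ?thesis
      unfolding T_def T1_def T2_def T3_def u_dW[OF x] by (simp only:) (simp add: algebra_simps)
  qed
  have T_nonneg: "0 \<le> T x" if x: "x \<in> \<Omega>" for x
  proof -
    have "0 \<le> V x / b - 1 - ln (V x / b)" using V_pos[OF x] b ln_le_minus_one[of "V x / b"] by auto
    then show ?thesis using f_nonneg[of x] unfolding T_eq[OF x] by (intro mult_nonneg_nonneg) auto
  qed
  have "0 \<le> (LBINT x:\<Omega>. T x)"
    unfolding set_lebesgue_integral_def
    using T_nonneg by (intro Bochner_Integration.integral_nonneg) (auto simp: indicator_def)
  then show "\<alpha> * real_of_ereal D - real_of_ereal L \<le> ln a - 1 / q + ln b" using T(2) by linarith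
  assume "\<alpha> * real_of_ereal D - real_of_ereal L = ln a - 1 / q + ln b"
  then have "(\<integral>\<^sup>+x\<in>\<Omega>. ennreal (T x) \<partial>lborel) = 0"
    using T(2) set_nn_integral_eq_set_integral[OF T(1)] T_nonneg by auto
  moreover have [measurable]: "T \<in> borel_measurable borel"
    unfolding T_def[abs_def] T1_def T2_def T3_def by measurable
  \<comment> \<open>\<open>T\<close> vanishes almost everywhere on \<Omega> and is positive on this
    set. A set that is open and null is empty, so \<open>V = b\<close> holds everywhere on
    \<Omega>.\<close>
  moreover have "open {x\<in>\<Omega>. V x \<noteq> b}"
  proof -
    have "open (\<Omega> \<inter> V -` (- {b}))" by (rule continuous_open_preimage[OF cont_V open_\<Omega>]) auto
    also have "\<Omega> \<inter> V -` (- {b}) = {x\<in>\<Omega>. V x \<noteq> b}" by auto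
    finally show ?thesis .
  qed
  moreover have "ennreal (T x) \<noteq> 0" if x: "x \<in> \<Omega>" "V x \<noteq> b" for x
  proof -
    have "ln (V x / b) \<noteq> V x / b - 1"
      using ln_eq_minus_one[of "V x / b"] x b V_pos[OF x(1)] by auto
    then have "V x / b - 1 - ln (V x / b) > 0"
      using ln_le_minus_one[of "V x / b"] V_pos[OF x(1)] b by auto
    then have "0 < T x" using f_pos[OF x(1)] unfolding T_eq[OF x(1)] by (rule mult_pos_pos[rotated])
    then show ?thesis by (simp add: ennreal_eq_0_iff)
  qed
  ultimately have "{x\<in>\<Omega>. V x \<noteq> b} = {}"
    using nn_integral_zero_witness[where A = \<Omega> and S = "{x\<in>\<Omega>. V x \<noteq> b}" and k = "\<lambda>x. ennreal (T x)"] by auto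
  then have V: "V x = b" if "x \<in> \<Omega>" for x using that by auto
  show "\<forall>x\<in>\<Omega>. u x = b * g (W x)"
  proof
    fix x assume "x \<in> \<Omega>"
    from V[OF this] show "u x = b * g (W x)" using g_pos[of "W x"] by (simp add: V_def field_simps)
  qed
qed

end

context adapted
begin

lemma W_eq_of_density_eq:
  assumes "\<forall>x\<in>\<Omega>. f x = fs x" "x \<in> \<Omega>" shows "W x = S.W x"
proof -
  have "F x = S.F x" unfolding F_eq S.F_eq using assms by (intro set_lebesgue_integral_cong) auto
  then show ?thesis by (simp add: W_def S.W_def)
qed

end

context adapted_smooth
begin

lemma u_C: assumes "x \<in> \<Omega>" shows "u x = (f x / fs x) powr \<alpha> * (r * g (S.W x))"
proof -
  have "ln (u x) = ln ((f x / fs x) powr \<alpha> * (r * g (S.W x)))"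
    using ln_u[OF assms] f_pos[OF assms] S.f_pos[OF assms] r_pos g_pos[of "S.W x"]
    by (simp add: C_def S.W0_eq[OF assms] ln_mult ln_div ln_powr)
  then show ?thesis
    using u_pos[OF assms] f_pos[OF assms] S.f_pos[OF assms] r_pos g_pos[of "S.W x"] by simp
qed

text \<open>A constant ratio \<open>u / g(W)\<close> means \<open>g(W)\<^sup>\<gamma> dW = const \<cdot> g(w)\<^sup>\<gamma> dw\<close> for \<open>\<gamma> = 1 - 1/\<alpha>\<close>
  and \<open>w = S.W\<close>.  Both sides integrate \<open>g\<^sup>\<gamma>\<close> over the line, so the constant is \<open>1\<close>, and then the
  primitives agree.\<close>

lemma density_eq_of_proportional:
  assumes b: "0 < b" and u_eq: "\<forall>x\<in>\<Omega>. u x = b * g (W x)"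
  shows "\<forall>x\<in>\<Omega>. f x = fs x"
proof -
  define \<gamma> where "\<gamma> = (\<alpha> - 1) / \<alpha>"
  have \<gamma>: "\<gamma> = 1 - 1 / \<alpha>" using \<alpha>_pos by (simp add: \<gamma>_def field_simps)
  have [measurable]: "g \<in> borel_measurable borel" by (rule G.borel_measurable_density)
  define J where "J T = (\<integral>\<^sup>+t. ennreal (g t powr \<gamma>) * indicator T t \<partial>lborel)" for T
  have J_fin: "J UNIV < \<infinity>" using r_const_pos(2)[OF \<alpha>_pos entropy_fin] by (simp add: J_def \<gamma>_def)
  have J_pos: "J T \<noteq> 0" if "T \<in> sets borel" "open S" "S \<noteq> {}" "S \<subseteq> T" for S T
  proof
    assume "J T = 0"
    then have "\<exists>t\<in>S. ennreal (g t powr \<gamma>) = 0"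
      unfolding J_def using that by (intro nn_integral_zero_witness) auto
    then obtain t where "ennreal (g t powr \<gamma>) = 0" by blast
    with g_pos[of t] show False by (simp add: ennreal_eq_0_iff)
  qed
  have g_mult: "g t * g t powr (- 1 / \<alpha>) = g t powr \<gamma>" for t
    using g_pos[of t] powr_add[of "g t" 1 "- 1 / \<alpha>"] by (simp add: \<gamma>)
  have J_eq: "(\<integral>\<^sup>+t. ennreal (g t) * (ennreal (g t powr (- 1 / \<alpha>)) * indicator T t) \<partial>lborel) = J T" for T
    unfolding J_def g_mult[symmetric]
    by (intro nn_integral_cong) (simp add: ennreal_mult'[OF less_imp_le[OF g_pos]] mult.assoc)
  have J_W: "(\<integral>\<^sup>+x\<in>\<Omega>. ennreal (f x) * (ennreal (g (W x) powr (- 1 / \<alpha>)) * indicator T (W x)) \<partial>lborel) = J T"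
    if [measurable]: "T \<in> sets borel" for T
    unfolding J_eq[symmetric] by (rule nn_integral_transport) measurable
  have J_S: "(\<integral>\<^sup>+x\<in>\<Omega>. ennreal (fs x) * (ennreal (g (S.W x) powr (- 1 / \<alpha>)) * indicator T (S.W x)) \<partial>lborel) = J T"
    if [measurable]: "T \<in> sets borel" for T
    unfolding J_eq[symmetric] by (rule S.nn_integral_transport) measurable
  \<comment> \<open>The constant left after taking the \<alpha>-th root of
    \<open>(f / fs) powr \<alpha> * (r * g (S.W)) = b * g (W)\<close>.\<close>
  define \<kappa> where "\<kappa> = (b / r) powr (1 / \<alpha>)"
  have \<kappa>: "0 < \<kappa>" using b r_pos by (simp add: \<kappa>_def)
  have eq: "f x * g (W x) powr (- 1 / \<alpha>) = \<kappa> * (fs x * g (S.W x) powr (- 1 / \<alpha>))" if x: "x \<in> \<Omega>" for x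
  proof -
    have pos: "0 < f x" "0 < fs x" "0 < g (W x)" "0 < g (S.W x)" using f_pos[OF x] S.f_pos[OF x] g_pos by auto
    have "ln ((f x / fs x) powr \<alpha> * (r * g (S.W x))) = ln (b * g (W x))"
      using u_eq x u_C[OF x] by simp
    then have "\<alpha> * (ln (f x) - ln (fs x)) + ln r + ln (g (S.W x)) = ln b + ln (g (W x))"
      using pos r_pos b by (simp add: ln_mult ln_div ln_powr)
    then have "(\<alpha> * (ln (f x) - ln (fs x)) + ln r + ln (g (S.W x))) / \<alpha> = (ln b + ln (g (W x))) / \<alpha>" by simp
    then have "ln (f x) - ln (g (W x)) / \<alpha> = (ln b - ln r) / \<alpha> + (ln (fs x) - ln (g (S.W x)) / \<alpha>)"
      using \<alpha>_pos by (simp add: add_divide_distrib diff_divide_distrib)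
    then have "ln (f x * g (W x) powr (- 1 / \<alpha>)) = ln (\<kappa> * (fs x * g (S.W x) powr (- 1 / \<alpha>)))"
      using pos r_pos b by (simp add: \<kappa>_def ln_mult ln_div ln_powr diff_divide_distrib)
    then show ?thesis using pos \<kappa> by simp
  qed
  \<comment> \<open>\<open>T\<close> and \<open>T'\<close> have the same preimage in \<Omega> under
    \<open>W\<close> and \<open>S.W\<close>, so the transport formulas for \<open>f\<close> and
    \<open>fs\<close> integrate the two sides of \<open>eq\<close> over the same set.\<close>
  have transfer: "J T = ennreal \<kappa> * J T'"
    if T: "T \<in> sets borel" "T' \<in> sets borel" "\<And>x. x \<in> \<Omega> \<Longrightarrow> W x \<in> T \<longleftrightarrow> S.W x \<in> T'" for T T'
  proof -
    have [measurable]: "T' \<in> sets borel" by (fact T)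
    have "J T = (\<integral>\<^sup>+x\<in>\<Omega>. ennreal (f x) * (ennreal (g (W x) powr (- 1 / \<alpha>)) * indicator T (W x)) \<partial>lborel)"
      using J_W[OF T(1)] by simp
    also have "\<dots> = (\<integral>\<^sup>+x. ennreal \<kappa> * (ennreal (fs x) * (ennreal (g (S.W0 x) powr (- 1 / \<alpha>)) * indicator T' (S.W0 x)) * indicator \<Omega> x) \<partial>lborel)"
    proof (intro nn_integral_cong)
      fix x
      show "ennreal (f x) * (ennreal (g (W x) powr (- 1 / \<alpha>)) * indicator T (W x)) * indicator \<Omega> x
        = ennreal \<kappa> * (ennreal (fs x) * (ennreal (g (S.W0 x) powr (- 1 / \<alpha>)) * indicator T' (S.W0 x)) * indicator \<Omega> x)"
      proof (cases "x \<in> \<Omega>")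
        case True
        have "ennreal (f x) * ennreal (g (W x) powr (- 1 / \<alpha>)) = ennreal \<kappa> * (ennreal (fs x) * ennreal (g (S.W x) powr (- 1 / \<alpha>)))"
          using eq[OF True] \<kappa> by (simp add: f_nonneg S.f_nonneg flip: ennreal_mult')
        moreover have "indicator T (W x) = (indicator T' (S.W x) :: ennreal)"
          using T(3)[OF True] by (simp add: indicator_def)
        ultimately show ?thesis using True by (simp add: S.W0_eq mult.assoc[symmetric])
      qed simp
    qed
    also have "\<dots> = ennreal \<kappa> * (\<integral>\<^sup>+x. (ennreal (fs x) * (ennreal (g (S.W0 x) powr (- 1 / \<alpha>)) * indicator T' (S.W0 x)) * indicator \<Omega> x) \<partial>lborel)"
      by (rule nn_integral_cmult) measurable
    also have "(\<integral>\<^sup>+x. (ennreal (fs x) * (ennreal (g (S.W0 x) powr (- 1 / \<alpha>)) * indicator T' (S.W0 x)) * indicator \<Omega> x) \<partial>lborel) = J T'"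
      unfolding J_S[OF T(2), symmetric] by (intro nn_integral_cong) (simp add: S.W0_eq split: split_indicator)
    finally show ?thesis .
  qed
  have "\<kappa> = 1"
  proof -
    obtain j where j: "J UNIV = ennreal j" "0 \<le> j" using J_fin by (cases "J UNIV") auto
    have "j \<noteq> 0" using J_pos[of UNIV UNIV] j by auto
    moreover have "ennreal j = ennreal (\<kappa> * j)" using transfer[of UNIV UNIV] \<kappa> by (simp add: j ennreal_mult')
    ultimately show ?thesis using j \<kappa> by simp
  qed
  then have br: "b = r"
  proof -
    have "ln \<kappa> = (1 / \<alpha>) * ln (b / r)" using b r_pos by (simp add: \<kappa>_def ln_powr)
    then have "ln (b / r) = 0" using \<open>\<kappa> = 1\<close> \<alpha>_pos by simp
    then show ?thesis using b r_pos by simp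
  qed
  have J_mono: "J {..s} \<noteq> J {..t}" if "s < t" for s t
  proof
    assume "J {..s} = J {..t}"
    also have "J {..t} = (\<integral>\<^sup>+z. ennreal (g z powr \<gamma>) * indicator {..s} z + ennreal (g z powr \<gamma>) * indicator {s<..t} z \<partial>lborel)"
      unfolding J_def using that by (intro nn_integral_cong) (auto split: split_indicator)
    also have "\<dots> = J {..s} + J {s<..t}" unfolding J_def by (rule nn_integral_add) measurable
    finally have "J {..s} + 0 = J {..s} + J {s<..t}" by simp
    moreover have "J {..s} \<le> J UNIV" unfolding J_def by (intro nn_integral_mono) (auto split: split_indicator)
    then have "J {..s} \<noteq> \<infinity>" using J_fin by (auto simp: top_unique)
    ultimately have "J {s<..t} = 0" by (simp add: ennreal_add_left_cancel)
    moreover have "{s<..<t} \<subseteq> {s<..t}" by (rule subsetI) simp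
    ultimately show False using J_pos[of "{s<..t}" "{s<..<t}"] that by simp
  qed
  show ?thesis
  proof
    fix x assume x: "x \<in> \<Omega>"
    \<comment> \<open>Both half-lines pull back to the part of \<Omega> up to \<open>x\<close>, and
      \<open>J\<close> distinguishes half-lines with different endpoints.\<close>
    have "J {..W x} = J {..S.W x}"
      using transfer[of "{..W x}" "{..S.W x}"] W_le_iff[OF _ x] S.W_le_iff[OF _ x] \<open>\<kappa> = 1\<close> by simp
    then have "W x = S.W x" using J_mono[of "W x" "S.W x"] J_mono[of "S.W x" "W x"]
      by (cases "W x" "S.W x" rule: linorder_cases) auto
    then show "f x = fs x" using eq[OF x] \<open>\<kappa> = 1\<close> g_pos[of "S.W x"] by simp
  qed
qed

text \<open>These values show that equality is attained, and that the cases with an infinite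
  quotient exclude the minimizer. Here \<open>A\<close> equals
  \<open>q * r / \<alpha> * \<bar>W0\<bar> powr (q - 1)\<close>, so \<open>A powr p\<close> is
  proportional to \<open>\<bar>W0\<bar> powr q\<close>, which is the equality case of Hoelder's
  inequality.\<close>

lemma values_of_density_eq:
  assumes eq: "\<forall>x\<in>\<Omega>. f x = fs x"
  shows "D = 0" "L = ereal (1 / q - ln (r * a))" "X = ennreal ((q * r / \<alpha>) powr p / q)"
proof -
  have W: "S.W0 x = W0 x" if "x \<in> \<Omega>" for x
    using W_eq_of_density_eq[OF eq that] that by (simp add: W0_eq S.W0_eq)
  have "D = ext_integral \<Omega> (\<lambda>_. 0)"
    unfolding rel_entropy_def using eq S.f_pos by (intro ext_integral_cong) (auto simp: less_imp_neq[symmetric])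
  then show "D = 0" by (simp add: ext_integral_def)
  have "L = ext_integral \<Omega> (\<lambda>x. \<bar>W0 x\<bar> powr q * f x - ln (r * a) * f x)"
    unfolding L_eq by (intro ext_integral_cong) (simp add: ln_C W algebra_simps)
  also have "\<dots> = ereal (LBINT x:\<Omega>. \<bar>W0 x\<bar> powr q * f x - ln (r * a) * f x)"
    using set_integrable_moment_W set_integrable_\<Omega> by (intro ext_integral_eq set_integral_diff) auto
  also have "(LBINT x:\<Omega>. \<bar>W0 x\<bar> powr q * f x - ln (r * a) * f x) = 1 / q - ln (r * a)"
    using set_integrable_moment_W set_integrable_\<Omega>
    by (auto simp: set_integral_diff set_integral_\<Omega> set_integral_moment_W)
  finally show "L = ereal (1 / q - ln (r * a))" .
  note pq = conjugate_exponents[OF p1]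
  have A: "A x powr p * f x = (q * r / \<alpha>) powr p * (\<bar>W0 x\<bar> powr q * f x)" if x: "x \<in> \<Omega>" for x
  proof -
    have "((\<lambda>x. (ln (r * a) - \<bar>S.W x\<bar> powr q) / \<alpha>) has_real_derivative
      (0 - q * \<bar>S.W x\<bar> powr (q - 1) * sgn (S.W x) * (fs x / g (S.W x))) / \<alpha>) (at x)"
      by (intro DERIV_diff DERIV_cdivide DERIV_const DERIV_abs_W x)
    then have "(l has_real_derivative (0 - q * \<bar>S.W x\<bar> powr (q - 1) * sgn (S.W x) * (fs x / g (S.W x))) / \<alpha>) (at x)"
      by (rule has_field_derivative_transform_within_open[OF _ open_\<Omega> x]) (simp add: l_eq eq)
    from DERIV_imp_deriv[OF this]
    have "\<bar>dl x\<bar> = q * \<bar>W0 x\<bar> powr (q - 1) * (f x / g (W0 x)) / \<alpha>"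
      using x eq W[OF x] S.W0_eq[OF x] q_pos \<alpha>_pos f_nonneg[of x] S.f_nonneg[of x] g_pos[of "W0 x"] pq(1)
      by (simp add: dl_eq abs_mult abs_sgn_eq)
    moreover have "u x = r * g (W0 x)"
      using u_C[OF x] eq x S.f_pos[OF x] W[OF x] S.W0_eq[OF x] by simp
    ultimately have "A x = q * r / \<alpha> * \<bar>W0 x\<bar> powr (q - 1)"
      using f_pos[OF x] g_pos[of "W0 x"] by (simp add: A_def)
    then have "A x powr p = (q * r / \<alpha> * \<bar>W0 x\<bar> powr (q - 1)) powr p" by (simp only:)
    also have "\<dots> = (q * r / \<alpha>) powr p * (\<bar>W0 x\<bar> powr (q - 1)) powr p"
      by (rule powr_mult)
    also have "\<dots> = (q * r / \<alpha>) powr p * \<bar>W0 x\<bar> powr q" using pq(3) by (simp add: powr_powr)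
    finally show ?thesis by simp
  qed
  have "X = (\<integral>\<^sup>+x. ennreal ((q * r / \<alpha>) powr p) * (ennreal (\<bar>W0 x\<bar> powr q * f x) * indicator \<Omega> x) \<partial>lborel)"
    unfolding X_def
  proof (intro nn_integral_cong)
    fix x
    show "ennreal (A x powr p * f x) * indicator \<Omega> x
        = ennreal ((q * r / \<alpha>) powr p) * (ennreal (\<bar>W0 x\<bar> powr q * f x) * indicator \<Omega> x)"
    proof (cases "x \<in> \<Omega>")
      case True
      then show ?thesis by (simp only: A[OF True] ennreal_mult'[OF powr_ge_zero] mult.assoc)
    qed simp
  qed
  also have "\<dots> = ennreal ((q * r / \<alpha>) powr p) * ennreal (1 / q)"
    by (subst nn_integral_cmult) (auto simp: nn_integral_moment_W)
  also have "\<dots> = ennreal ((q * r / \<alpha>) powr p / q)" by (simp flip: ennreal_mult')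
  finally show "X = ennreal ((q * r / \<alpha>) powr p / q)" .
qed

end

context adapted_ac
begin

lemma B_le: "0 < x \<Longrightarrow> X \<le> ennreal x \<Longrightarrow> B \<le> ennreal (\<alpha> * (x powr (1 / p) * (1 / q) powr (1 / q)))"
  using nn_integral_u_dW_le holder unfolding B_def by (blast intro: order_trans)

text \<open>Otherwise \<open>B_le\<close> would hold for every positive \<open>x\<close>, and its
  bound tends to 0 with \<open>x\<close>, while \<open>B\<close> is nonzero.\<close>

lemma X_pos: "X \<noteq> 0"
proof
  assume X0: "X = 0"
  then have "B \<le> ennreal (\<alpha> * (1 powr (1 / p) * (1 / q) powr (1 / q)))" by (intro B_le) auto
  then obtain b where b: "B = ennreal b" "0 < b"
    using B_pos by (cases B) (auto simp: less_le top_unique)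
  define k where "k = \<alpha> * (1 / q) powr (1 / q)"
  have k: "0 < k" using \<alpha>_pos q_pos by (simp add: k_def)
  \<comment> \<open>The choice \<open>x = (b / (2 * k)) powr p\<close> makes the bound equal to
    \<open>b / 2\<close>.\<close>
  have "B \<le> ennreal (\<alpha> * (((b / (2 * k)) powr p) powr (1 / p) * (1 / q) powr (1 / q)))"
    using b k X0 by (intro B_le) auto
  also have "\<alpha> * (((b / (2 * k)) powr p) powr (1 / p) * (1 / q) powr (1 / q)) = b / (2 * k) * k"
    using b k p1 by (simp add: powr_powr k_def)
  also have "\<dots> = b / 2" using k by simp
  finally show False using b by (simp add: ennreal_le_iff)
qed

text \<open>The identity \<open>\<alpha> * ln (f / fs) = ln u + ln C\<close> together with an upper
  bound of \<open>u\<close> controls the integrand of \<open>D\<close> by that of \<open>L\<close>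
  and a multiple of \<open>f\<close>.\<close>

lemma D_neq_inf: assumes L: "L \<noteq> \<infinity>" shows "D \<noteq> \<infinity>"
proof -
  obtain M where M: "\<And>x. x \<in> \<Omega> \<Longrightarrow> u x \<le> M" using u_bounded by blast
  note int_L = L_finite(1)[OF L]
  let ?R = "\<lambda>x. \<bar>f x * ln (C x)\<bar> / \<alpha> + \<bar>ln M\<bar> / \<alpha> * f x"
  have int_R: "set_integrable lborel \<Omega> ?R"
    using set_integrable_abs[OF int_L] set_integrable_\<Omega> by (intro set_integral_add(1) set_integrable_divide set_integrable_mult_right) auto
  have le: "f x * ln (f x / fs x) \<le> ?R x" if x: "x \<in> \<Omega>" for x
  proof -
    have "ln (u x) \<le> ln M" using M[OF x] u_pos[OF x] by simp
    then have "\<alpha> * ln (f x / fs x) \<le> ln (C x) + \<bar>ln M\<bar>" unfolding ln_u[OF x] by linarith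
    then have "f x * (\<alpha> * ln (f x / fs x)) \<le> f x * (ln (C x) + \<bar>ln M\<bar>)" by (intro mult_left_mono f_nonneg)
    also have "\<dots> \<le> \<bar>f x * ln (C x)\<bar> + \<bar>ln M\<bar> * f x" by (simp add: algebra_simps)
    finally have "\<alpha> * (f x * ln (f x / fs x)) \<le> \<bar>f x * ln (C x)\<bar> + \<bar>ln M\<bar> * f x" by (simp add: mult_ac)
    then have "f x * ln (f x / fs x) \<le> (\<bar>f x * ln (C x)\<bar> + \<bar>ln M\<bar> * f x) / \<alpha>"
      using \<alpha>_pos by (simp add: pos_le_divide_eq mult.commute)
    then show ?thesis by (simp add: add_divide_distrib)
  qed
  have "(\<integral>\<^sup>+x\<in>\<Omega>. ennreal (f x * ln (f x / fs x)) \<partial>lborel) \<le> (\<integral>\<^sup>+x\<in>\<Omega>. ennreal (?R x) \<partial>lborel)"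
    using le by (intro nn_integral_mono) (auto intro!: ennreal_leI split: split_indicator)
  also have "\<dots> = ennreal (LBINT x:\<Omega>. ?R x)"
    using \<alpha>_pos f_nonneg by (intro set_nn_integral_eq_set_integral int_R add_nonneg_nonneg) auto
  finally have "(\<integral>\<^sup>+x\<in>\<Omega>. ennreal (f x * ln (f x / fs x)) \<partial>lborel) \<noteq> \<infinity>" by (auto simp: top_unique)
  then show ?thesis
    using D_neg unfolding rel_entropy_def ext_integral_def
    by (cases "\<integral>\<^sup>+x\<in>\<Omega>. ennreal (f x * ln (f x / fs x)) \<partial>lborel";
        cases "\<integral>\<^sup>+x\<in>\<Omega>. ennreal (- (f x * ln (f x / fs x))) \<partial>lborel") auto
qed

end

text \<open>\<open>not_both\<close> keeps the difference in the exponent meaningful. An infinite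
  \<open>L\<close> or \<open>X\<close> then makes the quotient infinite; otherwise everything is
  finite and logarithms are compared.\<close>

lemma (in adapted_ac) fisher_ineq:
  assumes not_both: "\<not> (D = \<infinity> \<and> L = \<infinity>)"
  shows "rel_fisher p \<alpha> \<Omega> f h / exp_ereal (D - ereal (1 / \<alpha>) * L) \<ge> enn_powr (K1 p / ennreal \<alpha>) (1 / \<alpha>)"
    and "rel_fisher p \<alpha> \<Omega> f h / exp_ereal (D - ereal (1 / \<alpha>) * L) = enn_powr (K1 p / ennreal \<alpha>) (1 / \<alpha>)
      \<longleftrightarrow> (\<forall>x\<in>\<Omega>. f x = fs x)"
proof -
  let ?R = "rel_fisher p \<alpha> \<Omega> f h / exp_ereal (D - ereal (1 / \<alpha>) * L)"
  define Kc where "Kc = q powr (1 / q) * (exp (1 / q) / a) / \<alpha>"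
  have Kc: "0 < Kc" "ln Kc = ln q / q + 1 / q - ln a - ln \<alpha>"
    using q_pos a_pos \<alpha>_pos by (auto simp: Kc_def ln_mult ln_div ln_powr)
  have rhs: "enn_powr (K1 p / ennreal \<alpha>) (1 / \<alpha>) = ennreal (Kc powr (1 / \<alpha>))"
    using Kc(1) \<alpha>_pos a_pos unfolding K1_eq[OF p1]
    by (subst divide_ennreal) (auto simp: Kc_def enn_powr_ennreal simp del: times_divide_eq_right)
  have p\<alpha>: "0 < 1 / (p * \<alpha>)" using p1 \<alpha>_pos by simp
  have infinite: "?R = \<infinity> \<Longrightarrow> \<not> (\<forall>x\<in>\<Omega>. f x = fs x) \<Longrightarrow>
      ?R \<ge> enn_powr (K1 p / ennreal \<alpha>) (1 / \<alpha>) \<and> (?R = enn_powr (K1 p / ennreal \<alpha>) (1 / \<alpha>) \<longleftrightarrow> (\<forall>x\<in>\<Omega>. f x = fs x))"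
    by (simp add: rhs)
  have "?R \<ge> enn_powr (K1 p / ennreal \<alpha>) (1 / \<alpha>) \<and> (?R = enn_powr (K1 p / ennreal \<alpha>) (1 / \<alpha>) \<longleftrightarrow> (\<forall>x\<in>\<Omega>. f x = fs x))"
  proof (cases "L = \<infinity>")
    case True
    then obtain d where d: "D = ereal d" using not_both D_neq_minf by (cases D) auto
    have E: "exp_ereal (D - ereal (1 / \<alpha>) * L) = 0" using True \<alpha>_pos by (simp add: d exp_ereal_def)
    have "rel_fisher p \<alpha> \<Omega> f h \<noteq> 0"
      unfolding rel_fisher_eq using X_pos p\<alpha> by (cases X) (auto simp: enn_powr_def ennreal_eq_0_iff)
    \<comment> \<open>In \<open>ennreal\<close> a nonzero numerator over 0 gives \<infinity>,
      whereas 0 over 0 is 0; this is where positivity of the Fisher term matters.\<close>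
    then have "?R = \<infinity>" unfolding E by (simp add: divide_ennreal_def ennreal_mult_top)
    moreover have "\<not> (\<forall>x\<in>\<Omega>. f x = fs x)" using values_of_density_eq(2) True by auto
    ultimately show ?thesis by (rule infinite)
  next
    case False
    note L = this and D = D_neq_inf[OF this]
    obtain d where d: "D = ereal d" using D D_neq_minf by (cases D) auto
    obtain l where l: "L = ereal l" using L L_neq_minf by (cases L) auto
    have E: "exp_ereal (D - ereal (1 / \<alpha>) * L) = ennreal (exp (d - l / \<alpha>))" by (simp add: d l exp_ereal_def)
    show ?thesis
    proof (cases "X = \<infinity>")
      case True
      then have "?R = \<infinity>"
        unfolding rel_fisher_eq E using p\<alpha> by (simp add: enn_powr_def divide_ennreal_def ennreal_top_mult)
      moreover have "\<not> (\<forall>x\<in>\<Omega>. f x = fs x)" using values_of_density_eq(3) True by auto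
      ultimately show ?thesis by (rule infinite)
    next
      case False
      then obtain x where x: "X = ennreal x" "0 < x" using X_pos by (cases X) (auto simp: less_le)
      have B: "B \<le> ennreal (\<alpha> * (x powr (1 / p) * (1 / q) powr (1 / q)))" using x by (intro B_le) auto
      then obtain b where b: "B = ennreal b" "0 < b" using B_pos by (cases B) (auto simp: less_le top_unique)
      have "b \<le> \<alpha> * (x powr (1 / p) * (1 / q) powr (1 / q))"
        using B \<alpha>_pos unfolding b(1) by (subst (asm) ennreal_le_iff) auto
      then have "ln b \<le> ln (\<alpha> * (x powr (1 / p) * (1 / q) powr (1 / q)))" using b by simp
      also have "\<dots> = ln \<alpha> + ln x / p - ln q / q"
        using x \<alpha>_pos q_pos by (simp add: ln_mult ln_powr ln_div)
      finally have ln_b: "ln b \<le> ln \<alpha> + ln x / p - ln q / q" .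
      have J: "\<alpha> * d - l \<le> ln a - 1 / q + ln b"
        "\<alpha> * d - l = ln a - 1 / q + ln b \<Longrightarrow> \<forall>x\<in>\<Omega>. u x = b * g (W x)"
        using jensen[OF D L b] by (simp_all add: d l)
      define R where "R = x powr (1 / (p * \<alpha>)) / exp (d - l / \<alpha>)"
      have R: "0 < R" using x by (simp add: R_def)
      have Kp: "0 < Kc powr (1 / \<alpha>)" using Kc(1) by simp
      have R_eq: "?R = ennreal R"
        unfolding rel_fisher_eq E x(1) using x(2) by (simp add: enn_powr_ennreal divide_ennreal R_def)
      have ln_R: "ln R = (ln x / p - (\<alpha> * d - l)) / \<alpha>"
        using x p1 \<alpha>_pos by (simp add: R_def ln_div ln_powr diff_divide_distrib)
      have ln_K: "ln (Kc powr (1 / \<alpha>)) = ln Kc / \<alpha>" using Kc by (simp add: ln_powr)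
      have ge: "ln Kc \<le> ln x / p - (\<alpha> * d - l)" using J(1) ln_b unfolding Kc(2) by linarith
      then have "ln (Kc powr (1 / \<alpha>)) \<le> ln R"
        unfolding ln_R ln_K using \<alpha>_pos by (intro divide_right_mono) auto
      then have "Kc powr (1 / \<alpha>) \<le> R" by (simp only: ln_le_cancel_iff[OF Kp R])
      moreover have "R = Kc powr (1 / \<alpha>) \<longleftrightarrow> (\<forall>x\<in>\<Omega>. f x = fs x)"
      proof
        assume "R = Kc powr (1 / \<alpha>)"
        then have "(ln x / p - (\<alpha> * d - l)) / \<alpha> = ln Kc / \<alpha>"
          unfolding ln_R[symmetric] ln_K[symmetric] by (simp only:)
        then have "ln x / p - (\<alpha> * d - l) = ln Kc"
          using \<alpha>_pos unfolding divide_cancel_right by blast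
        \<comment> \<open>The bound is the sum of Jensen's inequality \<open>J(1)\<close> and
          \<open>ln_b\<close>, so equality in the sum forces equality in each.\<close>
        then have "\<alpha> * d - l = ln a - 1 / q + ln b" using J(1) ln_b unfolding Kc(2) by linarith
        from density_eq_of_proportional[OF b(2) J(2)[OF this]] show "\<forall>x\<in>\<Omega>. f x = fs x" .
      next
        assume eq: "\<forall>x\<in>\<Omega>. f x = fs x"
        note vals = values_of_density_eq[OF eq]
        have d0: "d = 0" using vals(1) d by simp
        have l_val: "l = 1 / q - ln (r * a)" using vals(2) l by simp
        have pos: "0 < q * r / \<alpha>" using q_pos r_pos \<alpha>_pos by simp
        have x_val: "x = (q * r / \<alpha>) powr p / q" using vals(3) x q_pos by simp
        have "ln x = p * ln (q * r / \<alpha>) - ln q"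
          unfolding x_val using pos q_pos by (subst ln_div) (auto simp: ln_powr)
        then have "ln x / p = ln (q * r / \<alpha>) - ln q * (1 / p)" using p1 by (simp add: diff_divide_distrib)
        also have "1 / p = 1 - 1 / q" using conjugate_exponents(2)[OF p1] by linarith
        finally have "ln x / p = ln r - ln \<alpha> + ln q / q"
          using q_pos r_pos \<alpha>_pos by (simp add: ln_mult ln_div algebra_simps)
        then have "ln x / p - (\<alpha> * d - l) = ln Kc"
          using r_pos a_pos by (simp add: d0 l_val Kc(2) ln_mult)
        then have "ln R = ln (Kc powr (1 / \<alpha>))" unfolding ln_R ln_K by simp
        then show "R = Kc powr (1 / \<alpha>)" by (simp only: ln_inj_iff[OF R Kp])
      qed
      ultimately show ?thesis
        unfolding R_eq rhs using R by (auto intro: ennreal_leI)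
    qed
  qed
  then show "?R \<ge> enn_powr (K1 p / ennreal \<alpha>) (1 / \<alpha>)"
    and "?R = enn_powr (K1 p / ennreal \<alpha>) (1 / \<alpha>) \<longleftrightarrow> (\<forall>x\<in>\<Omega>. f x = fs x)" by auto
qed

text \<open>The base point \<open>c\<close> picks one translate of each escort density. The
  assertion on the escort density of \<open>fstar\<close> makes \<open>fstar\<close> a genuine
  competitor in (ii), so the equality case describes a minimum that is attained. The two quantities
  in the exponent must not both be \<infinity>, since their difference would have no
  meaning.\<close>

theorem mainTheorem5:
  fixes xi xf :: ereal and \<Omega> :: "real set" and p \<alpha> c :: real and fstar f hstar :: "real \<Rightarrow> real"
  assumes "xi < xf" and "\<Omega> = einterval xi xf"
    and "density_on \<Omega> fstar"
    and "hconj p > 0"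
    and "\<alpha> > 0"
    and "entropy_power ((\<alpha> - 1) / \<alpha>) (gen_gauss p) < \<infinity>"
    and "hstar = h_star p \<alpha> \<Omega> fstar"
    and "density_on \<Omega> f"
    and "c \<in> \<Omega>"
  shows
    "adapted_moment p (hconj p) \<alpha> \<Omega> fstar f * exp_ereal (rel_entropy \<Omega> f fstar)
       \<ge> enn_powr (K0 p) (1 / \<alpha>) * exp_ereal (ereal (1 / \<alpha>) * mean_log_C p \<alpha> \<Omega> fstar f)
     \<and>
     (p > 1 \<and> fstar differentiable_on \<Omega> \<longrightarrow>
        ac_on UNIV (rel_escort \<alpha> \<Omega> hstar c fstar) \<and>
        (f differentiable_on \<Omega> \<and> ac_on UNIV (rel_escort \<alpha> \<Omega> hstar c f) \<and>
         \<not> (rel_entropy \<Omega> f fstar = \<infinity> \<and> mean_log_C p \<alpha> \<Omega> fstar f = \<infinity>) \<longrightarrow>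
           rel_fisher p \<alpha> \<Omega> f hstar
             / exp_ereal (rel_entropy \<Omega> f fstar - ereal (1 / \<alpha>) * mean_log_C p \<alpha> \<Omega> fstar f)
             \<ge> enn_powr (K1 p / ennreal \<alpha>) (1 / \<alpha>) \<and>
           (rel_fisher p \<alpha> \<Omega> f hstar
             / exp_ereal (rel_entropy \<Omega> f fstar - ereal (1 / \<alpha>) * mean_log_C p \<alpha> \<Omega> fstar f)
             = enn_powr (K1 p / ennreal \<alpha>) (1 / \<alpha>) \<longleftrightarrow> (\<forall>x\<in>\<Omega>. f x = fstar x))))"
proof -
  have transport: "transport p (hconj p) (gauss_const p) \<Omega> \<phi> xi xf" if "density_on \<Omega> \<phi>" for \<phi>
    using assms that
    by (intro transport.intro gen_gaussian.intro interval_density.intro real_density.intro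
          interval_density_axioms.intro) auto
  interpret adapted p "hconj p" "gauss_const p" \<Omega> f fstar xi xf \<alpha>
    using assms by (intro adapted.intro transport adapted_axioms.intro) auto
  have "adapted_moment p (hconj p) \<alpha> \<Omega> fstar f * exp_ereal (rel_entropy \<Omega> f fstar)
       \<ge> enn_powr (K0 p) (1 / \<alpha>) * exp_ereal (ereal (1 / \<alpha>) * mean_log_C p \<alpha> \<Omega> fstar f)"
    by (rule adapted_moment_ineq)
  moreover have "ac_on UNIV (rel_escort \<alpha> \<Omega> hstar c fstar)" if "1 < p" "fstar differentiable_on \<Omega>"
    unfolding assms(7) using that assms
    by (intro S.ac_on_escort_self r_pos differentiable_imp_continuous_on)
  moreover have
    "rel_fisher p \<alpha> \<Omega> f hstar
        / exp_ereal (rel_entropy \<Omega> f fstar - ereal (1 / \<alpha>) * mean_log_C p \<alpha> \<Omega> fstar f)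
        \<ge> enn_powr (K1 p / ennreal \<alpha>) (1 / \<alpha>) \<and>
      (rel_fisher p \<alpha> \<Omega> f hstar
        / exp_ereal (rel_entropy \<Omega> f fstar - ereal (1 / \<alpha>) * mean_log_C p \<alpha> \<Omega> fstar f)
        = enn_powr (K1 p / ennreal \<alpha>) (1 / \<alpha>) \<longleftrightarrow> (\<forall>x\<in>\<Omega>. f x = fstar x))"
    if "1 < p" "fstar differentiable_on \<Omega>" "f differentiable_on \<Omega>" "ac_on UNIV (rel_escort \<alpha> \<Omega> hstar c f)"
      "\<not> (rel_entropy \<Omega> f fstar = \<infinity> \<and> mean_log_C p \<alpha> \<Omega> fstar f = \<infinity>)"
  proof -
    interpret adapted_ac p "hconj p" "gauss_const p" \<Omega> f fstar xi xf \<alpha> c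
      using that assms
      by (intro adapted_ac.intro adapted_smooth.intro adapted_smooth_axioms.intro adapted_ac_axioms.intro
            adapted_axioms) auto
    show ?thesis unfolding assms(7) using fisher_ineq[OF that(5)] by blast
  qed
  ultimately show ?thesis by blast
qed

end
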